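(* Let $0\le\delta<\rho\le1$. An operator $A\in\mathrm{Op}(S^\mu_{\rho,\delta}(\mathbb{Z}^n\times\mathbb{T}^n))$ is elliptic if and only if there exists $B\in\mathrm{Op}(S^{-\mu}_{\rho,\delta}(\mathbb{Z}^n\times\mathbb{T}^n))$ such that $$BA\sim I\sim AB\quad\text{modulo }\mathrm{Op}(S^{-\infty}(\mathbb{Z}^n\times\mathbb{T}^n)),$$ where $I$ is the identity operator. Moreover, let $A$ (elliptic) have an expansion $A\sim\sum_{l=0}^\infty A_l$, where $A_l\in\mathrm{Op}(S^{\mu-(\rho-\delta)l}_{\rho,\delta}(\mathbb{Z}^n\times\mathbb{T}^n))$. Then an asymptotic expansion $B\sim\sum_{j=0}^\infty B_j$ with $B_j\in\mathrm{Op}(S^{-\mu-(\rho-\delta)j}_{\rho,\delta}(\mathbb{Z}^n\times\mathbb{T}^n))$ can be obtained by setting $\sigma_{B_0}:=\frac{1}{\sigma_{A_0}}$, and then recursively $$\sigma_{B_N}(k,x)=\frac{-1}{\sigma_{A_0}(k,x)}\sum_{j=0}^{N-1}\sum_{l=0}^{N-1}\ \sum_{|\gamma|=N-j-l}\frac{1}{\gamma!}\Big[D_x^{(\gamma)}\sigma_{B_j}(k,x)\Big]\Delta_k^\gamma\sigma_{A_l}(k,x).$$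
   Context: $\mathbb{T}^n=\mathbb{R}^n/\mathbb{Z}^n$. For suitable $f:\mathbb{Z}^n\to\mathbb{C}$, $\widehat f(x)=\sum_{k\in\mathbb{Z}^n}e^{-2\pi i k\cdot x}f(k)$, and for $\sigma:\mathbb{Z}^n\times\mathbb{T}^n\to\mathbb{C}$, $\mathrm{Op}(\sigma)f(k)=\int_{\mathbb{T}^n}e^{2\pi i k\cdot x}\sigma(k,x)\widehat f(x)\,dx$, $k\in\mathbb{Z}^n$. $\sigma_A$ denotes the symbol of $A$, i.e. $A=\mathrm{Op}(\sigma_A)$. Difference operators: $\Delta^\alpha=\Delta_1^{\alpha_1}\cdots\Delta_n^{\alpha_n}$, $\Delta_j\tau(k)=\tau(k+v_j)-\tau(k)$, with $v_j$ the $j$-th standard unit vector; $\Delta_k^\alpha$ acts in the variable $k$. Derivatives: $D_x^{(\alpha)}=D_{x_1}^{(\alpha_1)}\cdots D_{x_n}^{(\alpha_n)}$, where $D_{x_j}^{(0)}=I$ and $D_{x_j}^{(\ell)}=\prod_{m=0}^{\ell}\big(\frac{1}{2\pi i}\frac{\partial}{\partial x_j}-m\big)$ for $\ell\in\mathbb{N}$. Symbol classes: $S^\mu_{\rho,\delta}(\mathbb{Z}^n\times\mathbb{T}^n)$, $\mu\in\mathbb{R}$, is the set of $\sigma:\mathbb{Z}^n\times\mathbb{T}^n\to\mathbb{C}$ such that $\sigma(k,\cdot)\in C^\infty(\mathbb{T}^n)$ for all $k$ and for all multi-indices $\alpha,\beta$ there is $C_{\alpha,\beta}>0$ with $|D_x^{(\beta)}\Delta_k^\alpha\sigma(k,x)|\le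 C_{\alpha,\beta}(1+|k|)^{\mu-\rho|\alpha|+\delta|\beta|}$ for all $(k,x)$. $S^{-\infty}(\mathbb{Z}^n\times\mathbb{T}^n)=\bigcap_{\nu\in\mathbb{R}}S^\nu_{\rho,\delta}(\mathbb{Z}^n\times\mathbb{T}^n)$ (independent of $\rho,\delta$). $\mathrm{Op}(S)$ denotes the set of operators $\mathrm{Op}(\sigma)$ with $\sigma\in S$. $AB\sim I$ modulo $\mathrm{Op}(S^{-\infty})$ means that $I-AB$ has symbol in $S^{-\infty}$; similarly for $BA$. Ellipticity: $\sigma\in S^\mu_{\rho,\delta}$ (and the operator $\mathrm{Op}(\sigma)$) is elliptic (of order $\mu$) if there are $C>0$, $M>0$ with $|\sigma(k,x)|\ge C(1+|k|)^\mu$ for all $x\in\mathbb{T}^n$ and all $k\in\mathbb{Z}^n$ with $|k|\ge M$. In the construction of $B$ one restricts to $|k|\ge M$. Expansions: $A\sim\sum_l A_l$ means $\sigma_A-\sum_{l<N}\sigma_{A_l}\in S^{\mu-(\rho-\delta)N}_{\rho,\delta}$ for all $N\in\mathbb{N}$; similarly $B\sim\sum_j B_j$ means $\sigma_B-\sum_{j<N}\sigma_{B_j}\in S^{-\mu-(\rho-\delta)N}_{\rho,\delta}$ for all $N\in\mathbb{N}$.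
   Formalization: As printed the recursion is false; two corrections: D_{x_j}^{(ℓ)} is the product over m=0,…,ℓ−1 (not up to ℓ), also in the symbol classes, and the sum over l in the formula for σ_{B_N} runs from 0 to N (not N−1), restoring the term σ_{B_0}σ_{A_N}. *)

theory Defs
  imports "HOL-Analysis.Analysis"
begin

(* The lattice Z^n is the type int^'n and functions on the torus T^n = R^n/Z^n are the
   Z^n-periodic functions on real^'n.  The index type 'n is linearly ordered only so that the
   ordered products over the coordinates 1, ..., n below have a meaning; every n >= 1 occurs. *)

definition rvec :: "int ^ 'n \<Rightarrow> real ^ 'n::finite" where
  "rvec k = (\<chi> i. real_of_int (k $ i))"

definition bracket :: "int ^ 'n::finite \<Rightarrow> real" where
  "bracket k = 1 + norm (rvec k)"

definition torus_char :: "int ^ 'n::finite \<Rightarrow> real ^ 'n \<Rightarrow> complex" where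
  "torus_char k x = exp (2 * of_real pi * \<i> * of_real (rvec k \<bullet> x))"


section \<open>Smooth functions on the torus\<close>

definition partial_deriv :: "'n::finite \<Rightarrow> (real ^ 'n \<Rightarrow> complex) \<Rightarrow> real ^ 'n \<Rightarrow> complex" where
  "partial_deriv j g x = vector_derivative (\<lambda>t::real. g (x + t *\<^sub>R axis j 1)) (at 0)"

(* Differentiability of every iterated partial derivative makes all of them continuous,
   hence this is exactly C^infinity. *)
definition torus_smooth :: "(real ^ 'n::finite \<Rightarrow> complex) \<Rightarrow> bool" where
  "torus_smooth g \<longleftrightarrow>
     (\<forall>(m::int ^ 'n) x. g (x + rvec m) = g x) \<and>
     (\<forall>js. foldr partial_deriv js g differentiable_on UNIV)"


section \<open>Difference operators and the derivatives adapted to them\<close>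

definition mi_abs :: "nat ^ 'n::finite \<Rightarrow> nat" where
  "mi_abs \<alpha> = (\<Sum>i\<in>UNIV. \<alpha> $ i)"

definition mi_fact :: "nat ^ 'n::finite \<Rightarrow> nat" where
  "mi_fact \<alpha> = (\<Prod>i\<in>UNIV. fact (\<alpha> $ i))"

definition difference :: "'n::finite \<Rightarrow> (int ^ 'n \<Rightarrow> complex) \<Rightarrow> int ^ 'n \<Rightarrow> complex" where
  "difference j \<tau> k = \<tau> (k + axis j 1) - \<tau> k"

definition differences ::
  "nat ^ 'n::{finite,linorder} \<Rightarrow> (int ^ 'n::{finite,linorder} \<Rightarrow> complex)
     \<Rightarrow> int ^ 'n::{finite,linorder} \<Rightarrow> complex" where
  "differences \<alpha> \<tau> = foldr (\<lambda>j. difference j ^^ (\<alpha> $ j)) (sorted_list_of_set UNIV) \<tau>"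

(* falling_deriv j l = prod_{m=0}^{l-1} ((1/(2 pi i)) d/dx_j - m), a product of l factors.
   It multiplies exp (2 pi i p.x) by the falling factorial p_j (p_j - 1) ... (p_j - l + 1),
   which matches the Newton expansion
   tau(k + p) ~ sum_gamma (1/gamma!) p^(gamma) (Delta^gamma tau)(k)
   behind the composition formula; taking the product up to m = l would break that formula. *)
primrec falling_deriv ::
  "'n::finite \<Rightarrow> nat \<Rightarrow> (real ^ 'n \<Rightarrow> complex) \<Rightarrow> real ^ 'n \<Rightarrow> complex" where
  "falling_deriv j 0 g = g"
| "falling_deriv j (Suc l) g =
     (\<lambda>x. 1 / (2 * of_real pi * \<i>) * partial_deriv j (falling_deriv j l g) x
          - of_nat l * falling_deriv j l g x)"

definition falling_derivs ::
  "nat ^ 'n::{finite,linorder} \<Rightarrow> (real ^ 'n::{finite,linorder} \<Rightarrow> complex)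
     \<Rightarrow> real ^ 'n::{finite,linorder} \<Rightarrow> complex" where
  "falling_derivs \<beta> g = foldr (\<lambda>j. falling_deriv j (\<beta> $ j)) (sorted_list_of_set UNIV) g"


section \<open>Symbols\<close>

type_synonym 'n lattice_symbol = "int ^ 'n \<Rightarrow> real ^ 'n \<Rightarrow> complex"

definition symbol_class ::
  "real \<Rightarrow> real \<Rightarrow> real \<Rightarrow> 'n::{finite,linorder} lattice_symbol set" where
  "symbol_class \<rho> \<delta> \<mu> =
     {\<sigma>. (\<forall>k. torus_smooth (\<sigma> k)) \<and>
        (\<forall>\<alpha> \<beta>. \<exists>C>0. \<forall>k x.
           norm (falling_derivs \<beta> (\<lambda>y. differences \<alpha> (\<lambda>m. \<sigma> m y) k) x)
             \<le> C * bracket k powr (\<mu> - \<rho> * real (mi_abs \<alpha>) + \<delta> * real (mi_abs \<beta>)))}"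

definition smoothing_class :: "real \<Rightarrow> real \<Rightarrow> 'n::{finite,linorder} lattice_symbol set" where
  "smoothing_class \<rho> \<delta> = (\<Inter>\<nu>. symbol_class \<rho> \<delta> \<nu>)"

definition elliptic_symbol ::
  "real \<Rightarrow> real \<Rightarrow> real \<Rightarrow> 'n::{finite,linorder} lattice_symbol \<Rightarrow> bool" where
  "elliptic_symbol \<rho> \<delta> \<mu> \<sigma> \<longleftrightarrow> \<sigma> \<in> symbol_class \<rho> \<delta> \<mu> \<and>
     (\<exists>C>0. \<exists>M>0. \<forall>k x. M \<le> norm (rvec k) \<longrightarrow> C * bracket k powr \<mu> \<le> norm (\<sigma> k x))"


section \<open>Operators\<close>

(* Operators act on the rapidly decreasing functions on Z^n, a space that is mapped into itself
   by every operator considered here.  As HOL functions they are total; only their values on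
   this space are ever used. *)
type_synonym 'n lattice_operator = "(int ^ 'n \<Rightarrow> complex) \<Rightarrow> int ^ 'n \<Rightarrow> complex"

definition rapidly_decreasing :: "(int ^ 'n::finite \<Rightarrow> complex) set" where
  "rapidly_decreasing = {f. \<forall>N::nat. \<exists>C. \<forall>k. norm (f k) * bracket k ^ N \<le> C}"

definition lattice_fourier :: "(int ^ 'n::finite \<Rightarrow> complex) \<Rightarrow> real ^ 'n \<Rightarrow> complex" where
  "lattice_fourier f x = (\<Sum>\<^sub>\<infinity>k. torus_char (- k) x * f k)"

definition Op :: "'n::finite lattice_symbol \<Rightarrow> 'n lattice_operator" where
  "Op \<sigma> f k = integral (cbox 0 1) (\<lambda>x. torus_char k x * \<sigma> k x * lattice_fourier f x)"

definition has_symbol :: "'n::finite lattice_operator \<Rightarrow> 'n lattice_symbol \<Rightarrow> bool" where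
  "has_symbol A \<sigma> \<longleftrightarrow>
     (\<forall>k. torus_smooth (\<sigma> k)) \<and> (\<forall>f\<in>rapidly_decreasing. A f = Op \<sigma> f)"

(* Unique when it exists: applying A to unit point masses yields all Fourier coefficients
   of the continuous functions \<sigma>(k, .). *)
definition symbol_of :: "'n::finite lattice_operator \<Rightarrow> 'n lattice_symbol" where
  "symbol_of A = (THE \<sigma>. has_symbol A \<sigma>)"

definition op_class :: "'n::finite lattice_symbol set \<Rightarrow> 'n lattice_operator set" where
  "op_class S = {A. \<exists>\<sigma>\<in>S. has_symbol A \<sigma>}"

definition elliptic_operator ::
  "real \<Rightarrow> real \<Rightarrow> real \<Rightarrow> 'n::{finite,linorder} lattice_operator \<Rightarrow> bool" where
  "elliptic_operator \<rho> \<delta> \<mu> A \<longleftrightarrow>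
     A \<in> op_class (symbol_class \<rho> \<delta> \<mu>) \<and> elliptic_symbol \<rho> \<delta> \<mu> (symbol_of A)"

definition equiv_mod_smoothing ::
  "real \<Rightarrow> real \<Rightarrow> 'n::{finite,linorder} lattice_operator \<Rightarrow> 'n lattice_operator \<Rightarrow> bool" where
  "equiv_mod_smoothing \<rho> \<delta> P Q \<longleftrightarrow>
     (\<lambda>f k. P f k - Q f k) \<in> op_class (smoothing_class \<rho> \<delta>)"

definition parametrix ::
  "real \<Rightarrow> real \<Rightarrow> 'n::{finite,linorder} lattice_operator \<Rightarrow> 'n lattice_operator \<Rightarrow> bool" where
  "parametrix \<rho> \<delta> A B \<longleftrightarrow>
     equiv_mod_smoothing \<rho> \<delta> id (B \<circ> A) \<and> equiv_mod_smoothing \<rho> \<delta> id (A \<circ> B)"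

definition asymptotic_expansion ::
  "real \<Rightarrow> real \<Rightarrow> real \<Rightarrow> 'n::{finite,linorder} lattice_operator
     \<Rightarrow> (nat \<Rightarrow> 'n lattice_operator) \<Rightarrow> bool" where
  "asymptotic_expansion \<rho> \<delta> \<mu> A As \<longleftrightarrow>
     (\<forall>N. (\<lambda>k x. symbol_of A k x - (\<Sum>l<N. symbol_of (As l) k x))
            \<in> symbol_class \<rho> \<delta> (\<mu> - (\<rho> - \<delta>) * real N))"

(* Right-hand side of the recursion, for the symbols a l of A_l and b j of B_j.  It solves
   the degree-N part of sigma_{BA} ~ sum_gamma (1/gamma!) (D_x^(gamma) b) (Delta_k^gamma a) = 1,
   that is sum_{j + l + |gamma| = N} (1/gamma!) (D_x^(gamma) b_j) (Delta_k^gamma a_l) = 0,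
   for b_N.  The index l has to run up to N: the upper bound N - 1 would lose the
   term b_0 a_N (j = 0, l = N, gamma = 0).  Inner sums with j + l > N are empty. *)
definition parametrix_term ::
  "(nat \<Rightarrow> 'n::{finite,linorder} lattice_symbol) \<Rightarrow> (nat \<Rightarrow> 'n lattice_symbol)
     \<Rightarrow> nat \<Rightarrow> 'n lattice_symbol" where
  "parametrix_term a b N k x =
     - 1 / a 0 k x *
       (\<Sum>j<N. \<Sum>l\<le>N. \<Sum>\<gamma> | mi_abs \<gamma> + j + l = N.
          1 / of_nat (mi_fact \<gamma>) * falling_derivs \<gamma> (b j k) x
            * differences \<gamma> (\<lambda>m. a l m x) k)"

end

theory Submission
  imports Defs
begin

text \<open>
  The symbol of \<open>A B\<close> is \<open>\<Sum>q. c\<^sub>q e\<^sub>q(x) b(k + q, x)\<close>, where \<open>c\<^sub>q\<close> are the Fourier coefficients of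
  \<open>a(k, x)\<close> in \<open>x\<close>. Expanding \<open>b(k + q, x)\<close> in \<open>q\<close> by Newton's formula gives the composition formula, because
  the falling derivatives multiply \<open>e\<^sub>q\<close> by falling factorials of \<open>q\<close>. The remainder after \<open>N\<close> terms need
  only be estimated with a loss of decay independent of \<open>N\<close>, and without differences in \<open>k\<close>: comparison
  with a remainder of much higher order repairs the loss.

  If \<open>a\<close> is elliptic, then \<open>1/a\<close>, cut off near \<open>k = 0\<close>, inverts \<open>a\<close> on both sides up to order
  \<open>-(\<rho> - \<delta>)\<close>, and an asymptotic Neumann series improves this to a smoothing error. Conversely, if \<open>B A\<close>
  is the identity up to a smoothing operator, then \<open>b a - 1\<close> has negative order, which bounds \<open>a\<close> from
  below. By the composition formula the partial sums of the recursion are left inverses of \<open>A\<close> up to order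
  \<open>-(\<rho> - \<delta>) N\<close>; multiplying by a parametrix \<open>B\<close> from the right turns this into the expansion of \<open>B\<close>.
\<close>

section \<open>Smooth functions on the torus\<close>

text \<open>A Fourier coefficient of \<open>a k\<close> gains a power of \<open>bracket q\<close> in
  the denominator only at the price of \<delta> orders in \<open>k\<close>. The Newton remainder of
  degree N grows like \<open>bracket q ^ N\<close>, which costs \<delta> N and turns its gain \<rho>
  N into (\<rho> - \<delta>) N; summability over \<open>q\<close> takes another
  \<open>2 * CARD('n)\<close> powers, and these are the whole loss. Where \<open>q\<close> is large
  against \<open>k\<close>, powers of \<open>k\<close> are traded for powers of \<open>q\<close>,
  each gaining 1 and costing \<delta>, so that \<delta> < 1 is decisive. Multi-index estimates are
  avoided by classes closed under one derivative or one difference at a time; they are identified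
  with the given symbol classes once. Algebraic identities (commuting derivatives, associativity and
  unit of the symbol product) are read off from Fourier coefficients or from operators, so
  uniqueness of Fourier coefficients carries much of the algebra. Since the lattice is discrete,
  changing a symbol at finitely many \<open>k\<close> is a smoothing perturbation, which makes sharp
  cutoffs harmless.\<close>

lemma has_derivative_along_axis:
  fixes g :: "real ^ 'n::finite \<Rightarrow> complex"
  assumes "(g has_derivative g') (at x)"
  shows "((\<lambda>t. g (x + t *\<^sub>R axis j 1)) has_vector_derivative g' (axis j 1)) (at 0)"
proof -
  have "((\<lambda>t::real. x + t *\<^sub>R axis j 1) has_derivative (\<lambda>t. t *\<^sub>R axis j 1)) (at 0)"
    by (auto intro!: derivative_eq_intros)
  moreover have "(g has_derivative g') (at (x + 0 *\<^sub>R axis j 1))"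
    using assms by simp
  ultimately have "((\<lambda>t. g (x + t *\<^sub>R axis j 1)) has_derivative (\<lambda>t. g' (t *\<^sub>R axis j 1))) (at 0)"
    using has_derivative_compose by blast
  moreover have "g' (t *\<^sub>R axis j 1) = t *\<^sub>R g' (axis j 1)" for t
    using assms by (simp add: has_derivative_linear linear_scale)
  ultimately show ?thesis
    by (simp add: has_vector_derivative_def)
qed

lemma partial_deriv_eqI:
  "((\<lambda>t. g (x + t *\<^sub>R axis j 1)) has_vector_derivative D) (at 0) \<Longrightarrow> partial_deriv j g x = D"
  unfolding partial_deriv_def by (rule vector_derivative_at)

lemma partial_deriv_has_derivative:
  "(g has_derivative g') (at x) \<Longrightarrow> partial_deriv j g x = g' (axis j 1)"
  by (intro partial_deriv_eqI has_derivative_along_axis)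

text \<open>Differentiation under the integral sign in \<open>integral_partial_deriv\<close> needs
  the derivative along a whole segment, hence at every \<open>s\<close> and not only at 0.\<close>

lemma has_vector_derivative_partial_deriv:
  assumes "g differentiable (at (x + s *\<^sub>R axis j 1))"
  shows "((\<lambda>t. g (x + t *\<^sub>R axis j 1)) has_vector_derivative partial_deriv j g (x + s *\<^sub>R axis j 1)) (at s)"
proof -
  obtain g' where g': "(g has_derivative g') (at (x + s *\<^sub>R axis j 1))"
    using assms differentiable_def by blast
  have "((\<lambda>t::real. x + t *\<^sub>R axis j 1) has_derivative (\<lambda>t. t *\<^sub>R axis j 1)) (at s)"
    by (auto intro!: derivative_eq_intros)
  from has_derivative_compose[OF this g']
  have "((\<lambda>t. g (x + t *\<^sub>R axis j 1)) has_derivative (\<lambda>t. g' (t *\<^sub>R axis j 1))) (at s)" .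
  moreover have "g' (t *\<^sub>R axis j 1) = t *\<^sub>R g' (axis j 1)" for t
    using g' by (simp add: has_derivative_linear linear_scale)
  ultimately show ?thesis
    by (simp add: has_vector_derivative_def partial_deriv_has_derivative[OF g'])
qed

text \<open>Termwise differentiation of series is available for total derivatives; in this form its
  uniform convergence hypothesis reduces to finitely many partial derivatives.\<close>

lemma has_derivative_partial_derivs:
  fixes g :: "real ^ 'n::finite \<Rightarrow> complex"
  assumes "g differentiable (at x)"
  shows "(g has_derivative (\<lambda>h. \<Sum>j\<in>UNIV. (h $ j) *\<^sub>R partial_deriv j g x)) (at x)"
proof -
  obtain g' where g': "(g has_derivative g') (at x)"
    using assms differentiable_def by blast
  have "g' h = (\<Sum>j\<in>UNIV. (h $ j) *\<^sub>R partial_deriv j g x)" for h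
  proof -
    have lin: "linear g'" using g' by (rule has_derivative_linear)
    have "h = (\<Sum>j\<in>UNIV. (h $ j) *\<^sub>R axis j 1)"
      by (metis (no_types, lifting) basis_expansion scalar_mult_eq_scaleR sum.cong)
    then have "g' h = g' (\<Sum>j\<in>UNIV. (h $ j) *\<^sub>R axis j 1)" by simp
    also have "\<dots> = (\<Sum>j\<in>UNIV. (h $ j) *\<^sub>R g' (axis j 1))"
      by (simp add: linear_sum[OF lin] linear_scale[OF lin])
    finally show ?thesis by (simp add: partial_deriv_has_derivative[OF g'])
  qed
  then have "g' = (\<lambda>h. \<Sum>j\<in>UNIV. (h $ j) *\<^sub>R partial_deriv j g x)" by (rule ext)
  with g' show ?thesis by simp
qed

lemma differentiable_on_UNIV: "g differentiable_on UNIV \<longleftrightarrow> (\<forall>x. g differentiable (at x))"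
  by (simp add: differentiable_on_def)

lemma partial_deriv_const [simp]: "partial_deriv j (\<lambda>x. c) = (\<lambda>x. 0)"
  by (intro ext partial_deriv_eqI) simp

lemma has_vector_derivative_partial_deriv0:
  "g differentiable_on UNIV \<Longrightarrow>
    ((\<lambda>t. g (x + t *\<^sub>R axis j 1)) has_vector_derivative partial_deriv j g x) (at 0)"
  using has_vector_derivative_partial_deriv[of g x 0 j] by (simp add: differentiable_on_UNIV)

lemma partial_deriv_add:
  assumes "f differentiable_on UNIV" "g differentiable_on UNIV"
  shows "partial_deriv j (\<lambda>x. f x + g x) = (\<lambda>x. partial_deriv j f x + partial_deriv j g x)"
  by (intro ext partial_deriv_eqI has_vector_derivative_add has_vector_derivative_partial_deriv0 assms)

lemma partial_deriv_mult:
  assumes "f differentiable_on UNIV" "g differentiable_on UNIV"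
  shows "partial_deriv j (\<lambda>x. f x * g x) = (\<lambda>x. partial_deriv j f x * g x + f x * partial_deriv j g x)"
proof (intro ext partial_deriv_eqI)
  fix x
  show "((\<lambda>t. f (x + t *\<^sub>R axis j 1) * g (x + t *\<^sub>R axis j 1)) has_vector_derivative
           partial_deriv j f x * g x + f x * partial_deriv j g x) (at 0)"
    using has_vector_derivative_mult[OF has_vector_derivative_partial_deriv0[OF assms(1)]
        has_vector_derivative_partial_deriv0[OF assms(2)], of x j x j]
    by (simp add: algebra_simps)
qed

lemma partial_deriv_cmult:
  assumes "f differentiable_on UNIV"
  shows "partial_deriv j (\<lambda>x. c * f x) = (\<lambda>x. c * partial_deriv j f x)"
  using partial_deriv_mult[of "\<lambda>_. c" f j] assms by simp

lemma partial_deriv_diff: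
  assumes "f differentiable_on UNIV" "g differentiable_on UNIV"
  shows "partial_deriv j (\<lambda>x. f x - g x) = (\<lambda>x. partial_deriv j f x - partial_deriv j g x)"
  by (intro ext partial_deriv_eqI has_vector_derivative_diff has_vector_derivative_partial_deriv0 assms)

lemma partial_deriv_sum:
  assumes "\<And>i. i \<in> I \<Longrightarrow> f i differentiable_on UNIV"
  shows "partial_deriv j (\<lambda>x. \<Sum>i\<in>I. f i x) = (\<lambda>x. \<Sum>i\<in>I. partial_deriv j (f i) x)"
  by (intro ext partial_deriv_eqI has_vector_derivative_sum has_vector_derivative_partial_deriv0 assms)

lemma differentiable_on_inverse_complex:
  fixes f :: "real ^ 'n::finite \<Rightarrow> complex"
  assumes "f differentiable_on UNIV" "\<And>x. f x \<noteq> 0"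
  shows "(\<lambda>x. inverse (f x)) differentiable_on UNIV"
  using assms by (simp add: differentiable_on_UNIV)

lemma partial_deriv_inverse:
  fixes f :: "real ^ 'n::finite \<Rightarrow> complex"
  assumes "f differentiable_on UNIV" "\<And>x. f x \<noteq> 0"
  shows "partial_deriv j (\<lambda>x. inverse (f x)) = (\<lambda>x. - (inverse (f x) * inverse (f x) * partial_deriv j f x))"
proof
  fix x
  obtain f' where f': "(f has_derivative f') (at x)"
    using assms(1) by (auto simp: differentiable_on_UNIV differentiable_def)
  show "partial_deriv j (\<lambda>x. inverse (f x)) x = - (inverse (f x) * inverse (f x) * partial_deriv j f x)"
    using partial_deriv_has_derivative[OF Deriv.has_derivative_inverse[OF assms(2) f'], of j]
    by (simp add: partial_deriv_has_derivative[OF f'] mult_ac)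
qed

section \<open>Closure properties of smooth periodic functions\<close>

definition torus_periodic :: "(real ^ 'n::finite \<Rightarrow> complex) \<Rightarrow> bool" where
  "torus_periodic g \<longleftrightarrow> (\<forall>m x. g (x + rvec m) = g x)"

text \<open>Graded so that closure under products and reciprocals follows by induction: a derivative
  of a product is a sum of products of factors known to one order less. The formulation of
  \<open>torus_smooth\<close> by lists of derivatives offers no such induction.\<close>

primrec torus_Cn :: "nat \<Rightarrow> (real ^ 'n::finite \<Rightarrow> complex) \<Rightarrow> bool" where
  "torus_Cn 0 g \<longleftrightarrow> torus_periodic g"
| "torus_Cn (Suc n) g \<longleftrightarrow>
     torus_periodic g \<and> g differentiable_on UNIV \<and> (\<forall>j. torus_Cn n (partial_deriv j g))"

lemma torus_periodic_partial_deriv: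
  assumes "torus_periodic g" shows "torus_periodic (partial_deriv j g)"
proof -
  have "g (x + rvec m + y) = g (x + y)" for x y m
    using assms by (metis add.assoc add.commute torus_periodic_def)
  then show ?thesis by (simp add: torus_periodic_def partial_deriv_def)
qed

lemma torus_Cn_periodic: "torus_Cn n g \<Longrightarrow> torus_periodic g"
  by (cases n) auto

lemma torus_Cn_SucD: "torus_Cn (Suc n) g \<Longrightarrow> torus_Cn n g"
  by (induction n arbitrary: g) auto

lemma torus_smooth_periodic: "torus_smooth g \<Longrightarrow> torus_periodic g"
  by (simp add: torus_smooth_def torus_periodic_def)

lemma torus_smooth_differentiable: "torus_smooth g \<Longrightarrow> g differentiable_on UNIV"
  unfolding torus_smooth_def by (metis foldr.simps(1) id_apply)

lemma torus_smooth_partial_deriv: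
  assumes "torus_smooth g" shows "torus_smooth (partial_deriv j g)"
proof -
  have "foldr partial_deriv js (partial_deriv j g) differentiable_on UNIV" for js
  proof -
    have "foldr partial_deriv js (partial_deriv j g) = foldr partial_deriv (js @ [j]) g" by simp
    then show ?thesis using assms unfolding torus_smooth_def by metis
  qed
  then show ?thesis
    using torus_periodic_partial_deriv[OF torus_smooth_periodic[OF assms], of j]
    by (simp add: torus_smooth_def torus_periodic_def)
qed

lemma torus_smooth_iff_Cn: "torus_smooth g \<longleftrightarrow> (\<forall>n. torus_Cn n g)"
proof
  have "torus_smooth g \<Longrightarrow> torus_Cn n g" for n
    by (induction n arbitrary: g)
      (auto simp: torus_smooth_periodic torus_smooth_differentiable torus_smooth_partial_deriv)
  then show "torus_smooth g \<Longrightarrow> \<forall>n. torus_Cn n g" by blast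
next
  assume *: "\<forall>n. torus_Cn n g"
  \<comment> \<open>\<open>foldr\<close> applies the last index of the list first, hence the
    induction from the end of the list.\<close>
  have "torus_Cn (Suc (length js)) g \<Longrightarrow> foldr partial_deriv js g differentiable_on UNIV" for js
    by (induction js arbitrary: g rule: rev_induct) auto
  with * show "torus_smooth g"
    using torus_Cn_periodic[of 0 g] unfolding torus_smooth_def torus_periodic_def by blast
qed

lemma torus_Cn_const: "torus_Cn n (\<lambda>x. c)"
  by (induction n arbitrary: c) (auto simp: torus_periodic_def)

lemma torus_Cn_add: "torus_Cn n f \<Longrightarrow> torus_Cn n g \<Longrightarrow> torus_Cn n (\<lambda>x. f x + g x)"
  by (induction n arbitrary: f g) (auto simp: torus_periodic_def partial_deriv_add)

lemma torus_Cn_mult: "torus_Cn n f \<Longrightarrow> torus_Cn n g \<Longrightarrow> torus_Cn n (\<lambda>x. f x * g x)"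
proof (induction n arbitrary: f g)
  case (Suc n)
  then show ?case
    using torus_Cn_SucD[of n f] torus_Cn_SucD[of n g]
    by (auto simp: torus_periodic_def partial_deriv_mult simp del: torus_Cn.simps(1) intro!: torus_Cn_add)
qed (auto simp: torus_periodic_def)

lemma torus_Cn_inverse: "torus_Cn n f \<Longrightarrow> (\<And>x. f x \<noteq> 0) \<Longrightarrow> torus_Cn n (\<lambda>x. inverse (f x))"
proof (induction n arbitrary: f)
  case (Suc n)
  have "torus_Cn n (\<lambda>x. (-1) * (inverse (f x) * inverse (f x) * partial_deriv j f x))" for j
    using Suc torus_Cn_SucD[OF Suc.prems(1)] by (intro torus_Cn_mult torus_Cn_const) auto
  then show ?case
    using Suc.prems by (auto simp: torus_periodic_def partial_deriv_inverse differentiable_on_inverse_complex)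
qed (auto simp: torus_periodic_def)

lemma torus_smooth_const [simp]: "torus_smooth (\<lambda>x. c)"
  by (simp add: torus_smooth_iff_Cn torus_Cn_const)

lemma torus_smooth_add: "torus_smooth f \<Longrightarrow> torus_smooth g \<Longrightarrow> torus_smooth (\<lambda>x. f x + g x)"
  by (simp add: torus_smooth_iff_Cn torus_Cn_add)

lemma torus_smooth_mult: "torus_smooth f \<Longrightarrow> torus_smooth g \<Longrightarrow> torus_smooth (\<lambda>x. f x * g x)"
  by (simp add: torus_smooth_iff_Cn torus_Cn_mult)

lemma torus_smooth_cmult: "torus_smooth f \<Longrightarrow> torus_smooth (\<lambda>x. c * f x)"
  by (simp add: torus_smooth_mult)

lemma torus_smooth_uminus: "torus_smooth f \<Longrightarrow> torus_smooth (\<lambda>x. - f x)"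
  using torus_smooth_cmult[of f "-1"] by simp

lemma torus_smooth_diff: "torus_smooth f \<Longrightarrow> torus_smooth g \<Longrightarrow> torus_smooth (\<lambda>x. f x - g x)"
  using torus_smooth_add[OF _ torus_smooth_uminus, of f g] by simp

lemma torus_smooth_sum: "(\<And>i. i \<in> I \<Longrightarrow> torus_smooth (f i)) \<Longrightarrow> torus_smooth (\<lambda>x. \<Sum>i\<in>I. f i x)"
  by (induction I rule: infinite_finite_induct) (auto intro: torus_smooth_add)

lemma torus_smooth_inverse: "torus_smooth f \<Longrightarrow> (\<And>x. f x \<noteq> 0) \<Longrightarrow> torus_smooth (\<lambda>x. inverse (f x))"
  by (simp add: torus_smooth_iff_Cn torus_Cn_inverse)

lemma torus_smooth_continuous: "torus_smooth g \<Longrightarrow> continuous_on S g"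
  using torus_smooth_differentiable differentiable_imp_continuous_on continuous_on_subset by blast

section \<open>Characters of the torus\<close>

lemma rvec_axis: "rvec (axis j c) = axis j (real_of_int c)"
  by (simp add: rvec_def axis_def vec_eq_iff)

lemma rvec_add: "rvec (k + m) = rvec k + rvec m"
  by (simp add: rvec_def vec_eq_iff)

lemma rvec_uminus: "rvec (- k) = - rvec k"
  by (simp add: rvec_def vec_eq_iff)

lemma rvec_0 [simp]: "rvec 0 = 0"
  by (simp add: rvec_def vec_eq_iff)

lemma torus_char_add: "torus_char (p + q) x = torus_char p x * torus_char q x"
  by (simp add: torus_char_def rvec_add inner_add_left exp_add[symmetric] algebra_simps)

lemma torus_char_0 [simp]: "torus_char 0 x = 1"
  by (simp add: torus_char_def)

lemma norm_torus_char [simp]: "norm (torus_char p x) = 1"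
  by (simp add: torus_char_def norm_exp_eq_Re)

lemma torus_char_has_derivative:
  "(torus_char p has_derivative
     (\<lambda>h. 2 * of_real pi * \<i> * of_real (rvec p \<bullet> h) * torus_char p x)) (at x)"
proof -
  have 1: "((\<lambda>x. 2 * of_real pi * \<i> * of_real (rvec p \<bullet> x) :: complex) has_derivative
     (\<lambda>h. 2 * of_real pi * \<i> * of_real (rvec p \<bullet> h))) (at x)"
    by (auto intro!: derivative_eq_intros)
  have 2: "(exp has_derivative (*) (exp z)) (at z)" for z :: complex
    using DERIV_exp[of z] by (simp add: has_field_derivative_def)
  from has_derivative_compose[OF 1 2] show ?thesis
    by (simp add: torus_char_def[abs_def] mult_ac)
qed

lemma partial_deriv_torus_char:
  "partial_deriv j (torus_char p) = (\<lambda>x. 2 * of_real pi * \<i> * of_int (p $ j) * torus_char p x)"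
  by (rule ext, subst partial_deriv_has_derivative[OF torus_char_has_derivative])
     (simp add: inner_axis rvec_def)

lemma torus_char_periodic: "torus_periodic (torus_char p)"
proof -
  have "torus_char p (rvec m) = 1" for m
  proof -
    have "rvec p \<bullet> rvec m = real_of_int (\<Sum>i\<in>UNIV. p $ i * m $ i)"
      by (simp add: rvec_def inner_vec_def)
    then have "torus_char p (rvec m) = exp (2 * of_int (\<Sum>i\<in>UNIV. p $ i * m $ i) * of_real pi * \<i>)"
      unfolding torus_char_def by (simp add: mult_ac)
    then show ?thesis using exp_integer_2pi[of "of_int (\<Sum>i\<in>UNIV. p $ i * m $ i)"] by (simp only: Ints_of_int of_real_mult of_real_numeral of_real_of_int_eq mult_ac)
  qed
  moreover have "torus_char p (x + y) = torus_char p x * torus_char p y" for x y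
    by (simp add: torus_char_def inner_add_right exp_add[symmetric] algebra_simps)
  ultimately show ?thesis by (simp add: torus_periodic_def)
qed

lemma torus_char_differentiable: "torus_char p differentiable_on UNIV"
  unfolding differentiable_on_UNIV differentiable_def using torus_char_has_derivative by blast

lemma torus_smooth_torus_char [simp]: "torus_smooth (torus_char p)"
proof -
  \<comment> \<open>Scalar multiples are included because the derivative of a character is a
    multiple of that character.\<close>
  have "torus_Cn n (\<lambda>x. c * torus_char p x)" for n c
  proof (induction n arbitrary: c)
    case 0
    then show ?case using torus_char_periodic[of p] by (simp add: torus_periodic_def)
  next
    case (Suc n)
    have "(\<lambda>x. c * torus_char p x) differentiable_on UNIV"
      using torus_char_differentiable[of p] by (simp add: differentiable_on_UNIV)
    moreover have "partial_deriv j (\<lambda>x. c * torus_char p x) =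
        (\<lambda>x. (c * (2 * of_real pi * \<i> * of_int (p $ j))) * torus_char p x)" for j
      by (simp add: partial_deriv_cmult torus_char_differentiable partial_deriv_torus_char mult_ac)
    ultimately show ?case
      using Suc torus_char_periodic[of p] by (simp add: torus_periodic_def)
  qed
  from this[of _ 1] show ?thesis by (simp add: torus_smooth_iff_Cn)
qed

section \<open>Lattice sums\<close>

lemma bracket_ge_1: "1 \<le> bracket k"
  by (simp add: bracket_def)

lemma bracket_pos [simp]: "0 < bracket k"
  using bracket_ge_1[of k] by linarith

lemma bracket_nonneg [simp]: "0 \<le> bracket k"
  using bracket_pos[of k] by linarith

lemma bracket_uminus [simp]: "bracket (- k) = bracket k"
  by (simp add: bracket_def rvec_uminus)

lemma bracket_0 [simp]: "bracket 0 = 1"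
  by (simp add: bracket_def)

lemma bracket_add: "bracket (k + p) \<le> bracket k * bracket p"
proof -
  have "norm (rvec (k + p)) \<le> norm (rvec k) + norm (rvec p)"
    by (simp add: rvec_add norm_triangle_ineq)
  moreover have "0 \<le> norm (rvec k) * norm (rvec p)" by simp
  ultimately show ?thesis unfolding bracket_def distrib_left distrib_right by linarith
qed

lemma abs_component_le_bracket: "1 + \<bar>real_of_int (p $ j)\<bar> \<le> bracket p"
  using component_le_norm_cart[of "rvec p" j] by (simp add: bracket_def rvec_def)

lemma bracket_le_sum: "bracket p \<le> 1 + (\<Sum>j\<in>UNIV. \<bar>real_of_int (p $ j)\<bar>)"
  using norm_le_l1_cart[of "rvec p"] by (simp add: bracket_def rvec_def)

lemma bracket_powr_mono: "a \<le> b \<Longrightarrow> bracket k powr a \<le> bracket k powr b"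
  by (simp add: bracket_ge_1 powr_mono)

lemma bracket_powr_pos [simp]: "0 < bracket k powr a"
  by (simp add: less_imp_neq[OF bracket_pos, symmetric])

text \<open>Peetre's inequality. For negative exponents \<open>bracket_add\<close> is used with the
  roles of \<open>k\<close> and \<open>k + p\<close> exchanged.\<close>

lemma bracket_powr_shift:
  fixes k p :: "int ^ 'n::finite"
  shows "bracket (k + p) powr m \<le> bracket k powr m * bracket p powr \<bar>m\<bar>"
proof (cases "m \<ge> 0")
  case True
  have "bracket (k + p) powr m \<le> (bracket k * bracket p) powr m"
    using True by (intro powr_mono2 bracket_add) auto
  with True show ?thesis by (simp add: powr_mult)
next
  case False
  have "bracket k \<le> bracket (k + p) * bracket p"
    using bracket_add[of "k + p" "- p"] by simp
  then have "(bracket (k + p) * bracket p) powr m \<le> bracket k powr m"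
    using False by (intro powr_mono2') auto
  then have "bracket (k + p) powr m * bracket p powr m \<le> bracket k powr m"
    by (simp add: powr_mult)
  then have "bracket (k + p) powr m * bracket p powr m * bracket p powr (- m)
      \<le> bracket k powr m * bracket p powr (- m)"
    by (intro mult_right_mono) auto
  moreover have "bracket p powr m * bracket p powr (- m) = 1"
    by (metis add.right_inverse bracket_pos less_irrefl powr_add powr_zero_eq_one)
  ultimately show ?thesis using False by (simp add: mult.assoc)
qed

lemma finite_int_box: "finite {k :: int ^ 'n::finite. \<forall>i. \<bar>k $ i\<bar> \<le> N}"
proof -
  have inj: "inj_on (\<lambda>k::int ^ 'n. ($) k) {k. \<forall>i. \<bar>k $ i\<bar> \<le> N}"
    by (auto simp: inj_on_def vec_eq_iff)
  have sub: "(\<lambda>k::int ^ 'n. ($) k) ` {k. \<forall>i. \<bar>k $ i\<bar> \<le> N} \<subseteq> PiE UNIV (\<lambda>_. {-N..N})"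
    by (auto simp: PiE_def abs_le_iff) (metis minus_le_iff)
  have "finite (PiE (UNIV :: 'n set) (\<lambda>_. {-N..N}))"
    by (intro finite_PiE) auto
  from finite_imageD[OF finite_subset[OF sub this] inj] show ?thesis .
qed

lemma finite_lattice_ball: "finite {k :: int ^ 'n::finite. norm (rvec k) \<le> R}"
proof (rule finite_subset[OF _ finite_int_box[of "\<lceil>R\<rceil>"]])
  show "{k :: int ^ 'n. norm (rvec k) \<le> R} \<subseteq> {k. \<forall>i. \<bar>k $ i\<bar> \<le> \<lceil>R\<rceil>}"
  proof clarify
    fix k :: "int ^ 'n" and i assume "norm (rvec k) \<le> R"
    then have "\<bar>real_of_int (k $ i)\<bar> \<le> R"
      using abs_component_le_bracket[of k i] by (simp add: bracket_def)
    then show "\<bar>k $ i\<bar> \<le> \<lceil>R\<rceil>" by linarith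
  qed
qed

lemma summable_on_int_inverse_square: "(\<lambda>i::int. 1 / (1 + \<bar>real_of_int i\<bar>)\<^sup>2) summable_on UNIV"
proof -
  have "summable (\<lambda>n::nat. 1 / (1 + real n)\<^sup>2)"
    using inverse_power_summable[of 2, where ?'a = real] summable_Suc_iff[of "\<lambda>n. inverse ((real n)\<^sup>2)"]
    by (simp add: inverse_eq_divide add.commute)
  then have *: "(\<lambda>n::nat. 1 / (1 + real n)\<^sup>2) summable_on UNIV"
    by (subst summable_on_UNIV_nonneg_real_iff) auto
  have "(\<lambda>i::int. 1 / (1 + \<bar>real_of_int i\<bar>)\<^sup>2) summable_on (int ` UNIV)"
    by (subst summable_on_reindex) (use * in \<open>auto simp: o_def\<close>)
  moreover have "(\<lambda>i::int. 1 / (1 + \<bar>real_of_int i\<bar>)\<^sup>2) summable_on ((\<lambda>n. - int n) ` UNIV)"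
    by (subst summable_on_reindex) (use * in \<open>auto simp: o_def inj_def\<close>)
  moreover have "UNIV = int ` UNIV \<union> (\<lambda>n. - int n) ` UNIV"
    by (metis (mono_tags, lifting) UNIV_eq_I UnCI int_cases2 rangeI)
  ultimately show ?thesis
    by (metis summable_on_union)
qed

text \<open>Since \<open>bracket p\<close> dominates each \<open>1 + \<bar>p $ i\<bar>\<close>,
  spending two of the \<open>2 * CARD('n)\<close> powers on each coordinate bounds the sum by a
  product of one-dimensional sums.\<close>

lemma summable_on_bracket:
  "(\<lambda>p :: int ^ 'n::finite. 1 / bracket p ^ (2 * CARD('n))) summable_on UNIV"
proof (rule nonneg_bdd_above_summable_on)
  let ?s = "\<lambda>i::int. 1 / (1 + \<bar>real_of_int i\<bar>)\<^sup>2"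
  define S where "S = infsum ?s UNIV"
  have "sum (\<lambda>p :: int ^ 'n. 1 / bracket p ^ (2 * CARD('n))) F \<le> S ^ CARD('n)" if "finite F" for F
  proof -
    \<comment> \<open>All coordinate values that occur in \<open>F\<close>; enlarging
      \<open>F\<close> to the full grid over \<open>B\<close> allows sum and product to be
      exchanged.\<close>
    define B where "B = (\<Union>p\<in>F. range (($) p))"
    have B: "finite B" using that by (simp add: B_def)
    have inj: "inj_on (\<lambda>k::int ^ 'n. ($) k) F"
      by (auto simp: inj_on_def vec_eq_iff)
    have le: "1 / bracket p ^ (2 * CARD('n)) \<le> (\<Prod>i\<in>UNIV. ?s (p $ i))" for p :: "int ^ 'n"
    proof -
      have "1 / (bracket p)\<^sup>2 \<le> ?s (p $ i)" for i
        by (rule divide_left_mono[OF power_mono[OF abs_component_le_bracket]])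
        (auto intro!: mult_pos_pos simp: zero_less_power2 add_nonneg_eq_0_iff less_imp_neq[OF bracket_pos, symmetric])
      then have "(\<Prod>i\<in>(UNIV::'n set). 1 / (bracket p)\<^sup>2) \<le> (\<Prod>i\<in>UNIV. ?s (p $ i))"
        by (intro prod_mono) simp
      then show ?thesis by (simp add: power_mult power_divide)
    qed
    have "sum (\<lambda>p :: int ^ 'n. 1 / bracket p ^ (2 * CARD('n))) F \<le> (\<Sum>p\<in>F. \<Prod>i\<in>UNIV. ?s (p $ i))"
      by (intro sum_mono le)
    also have "\<dots> = (\<Sum>h\<in>(\<lambda>k::int ^ 'n. ($) k) ` F. \<Prod>i\<in>UNIV. ?s (h i))"
      by (simp add: sum.reindex[OF inj])
    also have "\<dots> \<le> (\<Sum>h\<in>PiE (UNIV :: 'n set) (\<lambda>_. B). \<Prod>i\<in>UNIV. ?s (h i))"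
    proof (rule sum_mono2)
      show "finite (PiE (UNIV :: 'n set) (\<lambda>_. B))" using B by (intro finite_PiE) auto
    qed (auto simp: B_def intro!: prod_nonneg)
    also have "\<dots> = (\<Prod>i\<in>(UNIV::'n set). \<Sum>y\<in>B. ?s y)"
      by (rule prod_sum_PiE[symmetric]) (use B in auto)
    also have "\<dots> \<le> (\<Prod>i\<in>(UNIV::'n set). S)"
      unfolding S_def using B summable_on_int_inverse_square
      by (intro prod_mono conjI sum_nonneg finite_sum_le_infsum) auto
    finally show ?thesis by simp
  qed
  then show "bdd_above (sum (\<lambda>p :: int ^ 'n. 1 / bracket p ^ (2 * CARD('n))) ` {F. F \<subseteq> UNIV \<and> finite F})"
    by (intro bdd_aboveI2[where M = "S ^ CARD('n)"]) auto
qed auto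

section \<open>Integrals over the torus\<close>

lemma integral_cbox_split_axis:
  fixes g :: "real ^ 'n::finite \<Rightarrow> complex"
  assumes "continuous_on UNIV g" "a $ j \<le> c" "c \<le> b $ j"
  shows "integral (cbox a b) g =
    integral (cbox a (\<chi> i. if i = j then c else b $ i)) g + integral (cbox (\<chi> i. if i = j then c else a $ i) b) g"
proof -
  have "g integrable_on cbox a b"
    using assms(1) continuous_on_subset by (intro integrable_continuous) blast
  then have "integral (cbox a b) g =
      integral (cbox a b \<inter> {x. x \<bullet> axis j 1 \<le> c}) g + integral (cbox a b \<inter> {x. x \<bullet> axis j 1 \<ge> c}) g"
    by (intro integral_split) simp_all
  moreover have "cbox a b \<inter> {x. x \<bullet> axis j 1 \<le> c} = cbox a (\<chi> i. if i = j then c else b $ i)"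
    using assms(3) by (auto simp: mem_box_cart inner_axis split: if_splits intro: order_trans) (metis order_trans)
  moreover have "cbox a b \<inter> {x. x \<bullet> axis j 1 \<ge> c} = cbox (\<chi> i. if i = j then c else a $ i) b"
    using assms(2) by (auto simp: mem_box_cart inner_axis split: if_splits intro: order_trans) (metis order_trans)
  ultimately show ?thesis by simp
qed

text \<open>Cut the translated box at \<open>x $ j = 1\<close>. The part that sticks out, moved back
  by one period, fills exactly the gap at the other end.\<close>

lemma integral_unit_box_translate:
  fixes g :: "real ^ 'n::finite \<Rightarrow> complex"
  assumes cont: "continuous_on UNIV g" and per: "torus_periodic g" and t: "0 \<le> t" "t \<le> 1"
  shows "integral (cbox 0 1) (\<lambda>x. g (x + t *\<^sub>R axis j 1)) = integral (cbox 0 1) g"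
proof -
  let ?e = "axis j 1 :: real ^ 'n"
  let ?u = "\<chi> i. if i = j then t else (0::real)" and ?v = "\<chi> i. if i = j then t else (1::real)"
  have te: "t *\<^sub>R ?e = ?u"
    by (simp add: vec_eq_iff axis_def)
  have "integral (cbox 0 1) (\<lambda>x. g (x + t *\<^sub>R ?e)) = integral (cbox (t *\<^sub>R ?e) (1 + t *\<^sub>R ?e)) g"
    using integral_shift_cbox[of "t *\<^sub>R ?e" "t *\<^sub>R ?e" "1 + t *\<^sub>R ?e" g] by simp
  also have "\<dots> = integral (cbox (t *\<^sub>R ?e) (\<chi> i. if i = j then 1 else (1 + t *\<^sub>R ?e) $ i)) g
      + integral (cbox (\<chi> i. if i = j then 1 else (t *\<^sub>R ?e) $ i) (1 + t *\<^sub>R ?e)) g"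
    using t by (intro integral_cbox_split_axis cont) (auto simp: axis_def)
  also have "(\<chi> i. if i = j then 1 else (1 + t *\<^sub>R ?e) $ i) = 1"
    by (simp add: vec_eq_iff axis_def)
  also note te
  also have "integral (cbox (\<chi> i. if i = j then 1 else ?u $ i) (1 + ?u)) g
      = integral (cbox ((\<chi> i. if i = j then 1 else ?u $ i) - ?e) (1 + ?u - ?e)) (\<lambda>x. g (x + ?e))"
    by (rule integral_shift_cbox[symmetric])
  also have "(\<lambda>x. g (x + ?e)) = g"
    using per[unfolded torus_periodic_def, rule_format, of _ "axis j 1"] rvec_axis[of j 1] by auto
  also have "(\<chi> i. if i = j then 1 else ?u $ i) - ?e = 0"
    by (simp add: vec_eq_iff axis_def)
  also have "1 + ?u - ?e = ?v"
    by (simp add: vec_eq_iff axis_def)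
  finally have 1: "integral (cbox 0 1) (\<lambda>x. g (x + ?u)) = integral (cbox ?u 1) g + integral (cbox 0 ?v) g" .
  have "integral (cbox 0 1) g = integral (cbox 0 (\<chi> i. if i = j then t else 1 $ i)) g
      + integral (cbox (\<chi> i. if i = j then t else 0 $ i) 1) g"
    using t by (intro integral_cbox_split_axis cont) auto
  with 1 show ?thesis unfolding te by (simp cong: if_cong)
qed

text \<open>The integral of the translate of \<open>g\<close> by \<open>t\<close> along the axis
  does not depend on \<open>t\<close>, and its derivative at 0 is the integral of the partial
  derivative.\<close>

lemma integral_partial_deriv:
  fixes g :: "real ^ 'n::finite \<Rightarrow> complex"
  assumes g: "torus_smooth g"
  shows "integral (cbox 0 1) (partial_deriv j g) = 0"
proof -
  let ?I = "\<lambda>t. integral (cbox 0 1) (\<lambda>x. g (x + t *\<^sub>R axis j 1))"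
  have cont: "continuous_on UNIV g" "continuous_on UNIV (partial_deriv j g)"
    using g by (auto intro: torus_smooth_continuous torus_smooth_partial_deriv)
  have "(?I has_vector_derivative integral (cbox 0 1) (\<lambda>x. partial_deriv j g (x + 0 *\<^sub>R axis j 1))) (at 0 within {0..1})"
  proof (rule leibniz_rule_vector_derivative)
    show "((\<lambda>t. g (x + t *\<^sub>R axis j 1)) has_vector_derivative partial_deriv j g (x + t *\<^sub>R axis j 1)) (at t within {0..1})" for x t
      using torus_smooth_differentiable[OF g]
      by (intro has_vector_derivative_at_within[OF has_vector_derivative_partial_deriv]) (simp add: differentiable_on_UNIV)
    show "(\<lambda>x. g (x + t *\<^sub>R axis j 1)) integrable_on cbox 0 1" for t
      by (intro integrable_continuous continuous_on_compose2[OF cont(1)] continuous_intros) auto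
    show "continuous_on ({0..1} \<times> cbox 0 1) (\<lambda>(t, x). partial_deriv j g (x + t *\<^sub>R axis j 1))"
      unfolding case_prod_beta by (intro continuous_on_compose2[OF cont(2)] continuous_intros) auto
  qed auto
  \<comment> \<open>Translation invariance is at hand for \<open>t\<close> between 0 and 1 only, so
    both derivatives at 0 are one-sided.\<close>
  moreover have "(?I has_vector_derivative 0) (at 0 within {0..1})"
  proof (rule has_vector_derivative_transform[of _ "{0..1}"])
    show "((\<lambda>_. integral (cbox 0 1) g) has_vector_derivative 0) (at 0 within {0..1})" by simp
    show "?I t = integral (cbox 0 1) g" if "t \<in> {0..1}" for t
      using that g cont by (intro integral_unit_box_translate torus_smooth_periodic) auto
  qed auto
  ultimately show ?thesis
    using vector_derivative_unique_within[of 0 "{0..1}" ?I]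
    by (metis (no_types, lifting) add.right_neutral ext scaleR_zero_left trivial_limit_within islimpt_Icc zero_less_one order_refl zero_le_one atLeastAtMost_iff)
qed

section \<open>Fourier coefficients and integration by parts\<close>

definition fourier_coeff :: "(real ^ 'n::finite \<Rightarrow> complex) \<Rightarrow> int ^ 'n \<Rightarrow> complex" where
  "fourier_coeff g p = integral (cbox 0 1) (\<lambda>x. torus_char (- p) x * g x)"

lemma continuous_torus_char [continuous_intros]: "continuous_on S (torus_char p)"
  by (simp add: torus_smooth_continuous)

text \<open>Integration by parts: the derivative of the periodic function
  \<open>torus_char (- p) x * g x\<close> integrates to 0.\<close>

lemma fourier_coeff_partial_deriv:
  assumes g: "torus_smooth g"
  shows "fourier_coeff (partial_deriv j g) p = 2 * of_real pi * \<i> * of_int (p $ j) * fourier_coeff g p"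
proof -
  have c: "continuous_on S g" "continuous_on S (partial_deriv j g)" for S
    using g by (auto intro: torus_smooth_continuous torus_smooth_partial_deriv)
  have i: "(\<lambda>x. torus_char (- p) x * g x) integrable_on cbox 0 1"
      "(\<lambda>x. torus_char (- p) x * partial_deriv j g x) integrable_on cbox 0 1"
    by (auto intro!: integrable_continuous continuous_intros c)
  have "0 = integral (cbox 0 1) (partial_deriv j (\<lambda>x. torus_char (- p) x * g x))"
    by (rule integral_partial_deriv[symmetric]) (intro torus_smooth_mult g torus_smooth_torus_char)
  also have "partial_deriv j (\<lambda>x. torus_char (- p) x * g x) =
      (\<lambda>x. (- (2 * of_real pi * \<i> * of_int (p $ j))) * (torus_char (- p) x * g x) + torus_char (- p) x * partial_deriv j g x)"
    by (subst partial_deriv_mult)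
       (auto intro!: torus_smooth_differentiable g simp: partial_deriv_torus_char mult_ac)
  also have "integral (cbox 0 1) \<dots> =
      (- (2 * of_real pi * \<i> * of_int (p $ j))) * fourier_coeff g p + fourier_coeff (partial_deriv j g) p"
    unfolding fourier_coeff_def
    by (subst integral_add[OF integrable_on_mult_right[OF i(1)] i(2)]) simp
  finally show ?thesis by simp
qed

lemma content_unit_box_cart: "measure lborel (cbox 0 (1 :: real ^ 'n::finite)) = 1"
  by (subst content_cbox_cart) (auto simp: interval_ne_empty_cart)

text \<open>For \<open>p \<noteq> 0\<close> the character is, up to a nonzero factor, its own
  derivative in a direction with \<open>p $ j \<noteq> 0\<close>, and derivatives integrate to
  0.\<close>

lemma integral_torus_char:
  fixes p :: "int ^ 'n::finite"
  shows "integral (cbox 0 1) (torus_char p) = (if p = 0 then 1 else 0)"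
proof (cases "p = 0")
  case True
  have "torus_char 0 = (\<lambda>x::real ^ 'n. 1)" by (rule ext) simp
  with True show ?thesis by (simp add: content_unit_box_cart)
next
  case False
  then obtain j where j: "p $ j \<noteq> 0" by (auto simp: vec_eq_iff)
  have "integral (cbox 0 1) (\<lambda>x. 2 * of_real pi * \<i> * of_int (p $ j) * torus_char p x) = 0"
    using integral_partial_deriv[of "torus_char p" j] by (simp add: partial_deriv_torus_char)
  with j False show ?thesis by simp
qed

lemma fourier_coeff_torus_char: "fourier_coeff (torus_char q) p = (if p = q then 1 else 0)"
  using integral_torus_char[of "q - p"]
  by (simp add: fourier_coeff_def torus_char_add[symmetric] cong: if_cong)

lemma norm_integral_unit_box_le:
  fixes g :: "real ^ 'n::finite \<Rightarrow> complex"
  assumes "continuous_on (cbox 0 1) g" "\<And>x. x \<in> cbox 0 1 \<Longrightarrow> norm (g x) \<le> B"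
  shows "norm (integral (cbox 0 1) g) \<le> B"
proof -
  have "(g has_integral integral (cbox 0 1) g) (cbox 0 1)"
    using assms(1) by (simp add: integrable_continuous integrable_integral)
  moreover have "0 \<le> B"
  proof -
    have "(0::real ^ 'n) \<in> cbox 0 1" by (simp add: mem_box_cart)
    from assms(2)[OF this] show ?thesis using norm_ge_zero order_trans by blast
  qed
  ultimately show ?thesis
    using has_integral_bound[of B g _ 0 1] assms(2) content_unit_box_cart by (metis mult_1_right)
qed

lemma norm_fourier_coeff_le:
  assumes "continuous_on (cbox 0 1) g" "\<And>x. x \<in> cbox 0 1 \<Longrightarrow> norm (g x) \<le> B"
  shows "norm (fourier_coeff g p) \<le> B"
  unfolding fourier_coeff_def using assms
  by (intro norm_integral_unit_box_le continuous_intros) (auto simp: norm_mult)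

lemma fourier_coeff_add:
  assumes "continuous_on (cbox 0 1) f" "continuous_on (cbox 0 1) g"
  shows "fourier_coeff (\<lambda>x. f x + g x) p = fourier_coeff f p + fourier_coeff g p"
  unfolding fourier_coeff_def distrib_left
  by (intro integral_add integrable_continuous continuous_intros assms)

lemma fourier_coeff_diff:
  assumes "continuous_on (cbox 0 1) f" "continuous_on (cbox 0 1) g"
  shows "fourier_coeff (\<lambda>x. f x - g x) p = fourier_coeff f p - fourier_coeff g p"
  unfolding fourier_coeff_def right_diff_distrib
  by (intro integral_diff integrable_continuous continuous_intros assms)

lemma fourier_coeff_cmult: "fourier_coeff (\<lambda>x. c * g x) p = c * fourier_coeff g p"
  unfolding fourier_coeff_def by (simp add: mult.left_commute)

text \<open>The majorant makes the net of finite partial sums converge uniformly, and integration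
  over a box is continuous under uniform limits along any filter.\<close>

lemma integral_infsum_dominated:
  fixes u :: "'i \<Rightarrow> real ^ 'n::finite \<Rightarrow> complex"
  assumes cont: "\<And>i. continuous_on (cbox a b) (u i)"
    and le: "\<And>i x. x \<in> cbox a b \<Longrightarrow> norm (u i x) \<le> M i" and M: "M summable_on UNIV"
  shows "integral (cbox a b) (\<lambda>x. \<Sum>\<^sub>\<infinity>i. u i x) = (\<Sum>\<^sub>\<infinity>i. integral (cbox a b) (u i))"
proof -
  have lim: "uniform_limit (cbox a b) (\<lambda>F x. \<Sum>i\<in>F. u i x) (\<lambda>x. \<Sum>\<^sub>\<infinity>i. u i x) (finite_subsets_at_top UNIV)"
    by (rule Weierstrass_m_test_general[OF le M])
  have cs: "continuous_on (cbox a b) (\<lambda>x. \<Sum>i\<in>F. u i x)" for F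
    by (intro continuous_intros cont)
  obtain I J where IJ: "\<And>F. ((\<lambda>x. \<Sum>i\<in>F. u i x) has_integral I F) (cbox a b)"
      "((\<lambda>x. \<Sum>\<^sub>\<infinity>i. u i x) has_integral J) (cbox a b)" "(I \<longlongrightarrow> J) (finite_subsets_at_top UNIV)"
    using uniform_limit_integral_cbox[OF lim cs] by auto
  have "I F = (\<Sum>i\<in>F. integral (cbox a b) (u i))" if "finite F" for F
    using integral_unique[OF IJ(1)[of F]] that cont by (simp add: integral_sum integrable_continuous)
  then have "((\<lambda>F. \<Sum>i\<in>F. integral (cbox a b) (u i)) \<longlongrightarrow> J) (finite_subsets_at_top UNIV)"
    using IJ(3) by (elim Lim_transform_eventually) (auto intro: eventually_finite_subsets_at_top_weakI)
  then have "(\<Sum>\<^sub>\<infinity>i. integral (cbox a b) (u i)) = J"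
    by (intro infsumI) (simp add: has_sum_def)
  with IJ(2) show "integral (cbox a b) (\<lambda>x. \<Sum>\<^sub>\<infinity>i. u i x) = (\<Sum>\<^sub>\<infinity>i. integral (cbox a b) (u i))"
    by (simp add: integral_unique)
qed

section \<open>Uniqueness of Fourier coefficients\<close>

text \<open>
  If a continuous function \<open>g\<close> with vanishing Fourier coefficients were nonzero at \<open>x0\<close>, then integrating
  it against powers of a trigonometric polynomial that exceeds \<open>1\<close> only near \<open>x0\<close> would give a nonzero value.
\<close>

lemma torus_char_conv_cos:
  "torus_char (axis j 1) x * torus_char (- axis j 1) y + torus_char (- axis j 1) x * torus_char (axis j 1) y
    = of_real (2 * cos (2 * pi * (x $ j - y $ j)))"
proof -
  have e: "torus_char (axis j 1) z = exp (\<i> * of_real (2 * pi * (z $ j)))"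
    "torus_char (- axis j 1) z = exp (- (\<i> * of_real (2 * pi * (z $ j))))" for z
    by (simp_all add: torus_char_def rvec_uminus rvec_axis inner_axis' mult_ac)
  have "of_real (2 * cos (2 * pi * (x $ j - y $ j))) = 2 * cos (complex_of_real (2 * pi * (x $ j)) - of_real (2 * pi * (y $ j)))"
    by (simp add: cos_of_real[symmetric] algebra_simps)
  also have "\<dots> = exp (\<i> * (of_real (2 * pi * (x $ j)) - of_real (2 * pi * (y $ j))))
      + exp (- (\<i> * (of_real (2 * pi * (x $ j)) - of_real (2 * pi * (y $ j)))))"
    by (simp add: cos_exp_eq)
  finally show ?thesis
    by (simp add: e exp_add[symmetric] algebra_simps)
qed

lemma integral_trig_peak_power:
  fixes g :: "real ^ 'n::finite \<Rightarrow> complex" and x0 :: "real ^ 'n" and c d :: real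
  assumes cont: "continuous_on (cbox 0 1) g" and zero: "\<And>p. fourier_coeff g p = 0"
  shows "integral (cbox 0 1) (\<lambda>x. g x * of_real (c + d * (\<Sum>j\<in>UNIV. 2 * cos (2 * pi * (x $ j - x0 $ j)))) ^ N) = 0"
proof -
  let ?T = "\<lambda>x. of_real (c + d * (\<Sum>j\<in>UNIV. 2 * cos (2 * pi * (x $ j - x0 $ j)))) :: complex"
  have T: "?T x = of_real c + of_real d * (\<Sum>j\<in>UNIV. torus_char (axis j 1) x * torus_char (- axis j 1) x0
      + torus_char (- axis j 1) x * torus_char (axis j 1) x0)" for x
    by (simp add: torus_char_conv_cos of_real_sum)
  have contT: "continuous_on (cbox 0 1) ?T"
    by (intro continuous_intros)
  \<comment> \<open>One factor of the peak moves the frequency \<open>p\<close> to itself and its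
    lattice neighbours, so the induction has to treat all frequencies at once.\<close>
  have "integral (cbox 0 1) (\<lambda>x. torus_char p x * (g x * ?T x ^ N)) = 0" for p
  proof (induction N arbitrary: p)
    case 0
    then show ?case using zero[of "- p"] by (simp add: fourier_coeff_def)
  next
    case (Suc N)
    let ?h = "\<lambda>p x. torus_char p x * (g x * ?T x ^ N)"
    have int: "(\<lambda>x. a * ?h p x) integrable_on cbox 0 1" for a p
      by (intro integrable_continuous continuous_intros cont)
    have "torus_char p x * (g x * ?T x ^ Suc N) = of_real c * ?h p x
        + (\<Sum>j\<in>UNIV. (of_real d * torus_char (- axis j 1) x0) * ?h (p + axis j 1) x
              + (of_real d * torus_char (axis j 1) x0) * ?h (p - axis j 1) x)" for x
    proof -
      have "torus_char p x * (g x * ?T x ^ Suc N) = ?T x * ?h p x"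
        by (simp only: power_Suc mult_ac)
      also have "\<dots> = of_real c * ?h p x + (\<Sum>j\<in>UNIV. of_real d * (torus_char (axis j 1) x * torus_char (- axis j 1) x0
            + torus_char (- axis j 1) x * torus_char (axis j 1) x0) * ?h p x)"
        by (subst T) (simp only: distrib_right sum_distrib_left sum_distrib_right)
      also have "(\<Sum>j\<in>UNIV. of_real d * (torus_char (axis j 1) x * torus_char (- axis j 1) x0
            + torus_char (- axis j 1) x * torus_char (axis j 1) x0) * ?h p x)
         = (\<Sum>j\<in>UNIV. (of_real d * torus_char (- axis j 1) x0) * ?h (p + axis j 1) x
              + (of_real d * torus_char (axis j 1) x0) * ?h (p - axis j 1) x)"
        by (intro sum.cong refl) (simp only: diff_conv_add_uminus torus_char_add distrib_left distrib_right mult_ac)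
      finally show ?thesis .
    qed
    then have "integral (cbox 0 1) (\<lambda>x. torus_char p x * (g x * ?T x ^ Suc N)) =
      integral (cbox 0 1) (\<lambda>x. of_real c * ?h p x
        + (\<Sum>j\<in>UNIV. (of_real d * torus_char (- axis j 1) x0) * ?h (p + axis j 1) x
              + (of_real d * torus_char (axis j 1) x0) * ?h (p - axis j 1) x))"
      by presburger
    also have "\<dots> = of_real c * integral (cbox 0 1) (?h p)
        + (\<Sum>j\<in>UNIV. (of_real d * torus_char (- axis j 1) x0) * integral (cbox 0 1) (?h (p + axis j 1))
              + (of_real d * torus_char (axis j 1) x0) * integral (cbox 0 1) (?h (p - axis j 1)))"
      by (simp only: integral_add integral_sum integrable_add integrable_sum int finite integral_mult_right)
    also have "\<dots> = 0" by (simp only: Suc.IH) simp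
    finally show ?case .
  qed
  from this[of 0] show ?thesis by simp
qed

text \<open>For an interior \<open>x0\<close> no other point of the closed box represents the same
  point of the torus, so the peak has a unique maximum there. Boundary points would have copies on
  opposite faces.\<close>

lemma fourier_coeff_eq_0_interior:
  fixes g :: "real ^ 'n::finite \<Rightarrow> complex"
  assumes cont: "continuous_on (cbox 0 1) g" and zero: "\<And>p. fourier_coeff g p = 0" and x0: "x0 \<in> box 0 1"
  shows "g x0 = 0"
proof (rule ccontr)
  assume nz: "g x0 \<noteq> 0"
  define n where "n = real CARD('n)"
  have n: "n > 0" by (simp add: n_def)
  \<comment> \<open>The factor \<open>cnj (g x0)\<close> rotates the value at \<open>x0\<close> to
    the positive real axis.\<close>
  define h where "h x = Re (cnj (g x0) * g x)" for x
  \<comment> \<open>The mean over the coordinates of the squared cosines of pi (x_j - x0_j): it has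
    values in [0, 1] and reaches 1 in the box only at \<open>x0\<close>.\<close>
  define s where "s x = (\<Sum>j\<in>UNIV. (1 + cos (2 * pi * (x $ j - x0 $ j))) / 2) / n" for x :: "real ^ 'n"
  have conth: "continuous_on (cbox 0 1) h" unfolding h_def by (intro continuous_intros cont)
  have conts: "continuous_on S s" for S unfolding s_def by (intro continuous_intros) (use n in auto)
  have h0: "h x0 > 0"
  proof -
    have "h x0 = (norm (g x0))\<^sup>2" by (simp add: h_def cmod_power2) (simp add: power2_eq_square)
    then show ?thesis using nz by simp
  qed
  have s0: "0 \<le> s x" for x
    unfolding s_def using n cos_ge_minus_one by (intro divide_nonneg_pos sum_nonneg) (smt (verit, best) field_sum_of_halves)+
  have x0_in: "x0 \<in> cbox 0 1" using x0 box_subset_cbox by blast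
  have s1: "s x < 1" if x: "x \<in> cbox 0 1" "x \<noteq> x0" for x
  proof -
    obtain i where i: "x $ i \<noteq> x0 $ i" using x by (auto simp: vec_eq_iff)
    have b: "0 < x0 $ i" "x0 $ i < 1" "0 \<le> x $ i" "x $ i \<le> 1"
      using x0 x by (auto simp: mem_box_cart)
    have "cos (2 * pi * (x $ i - x0 $ i)) \<noteq> 1"
    proof
      assume "cos (2 * pi * (x $ i - x0 $ i)) = 1"
      then obtain m :: int where "2 * pi * (x $ i - x0 $ i) = real_of_int m * 2 * pi"
        unfolding cos_one_2pi_int by blast
      then have m: "x $ i - x0 $ i = real_of_int m" by simp
      with b have "real_of_int m < 1" "real_of_int m > -1" by linarith+
      then have "m = 0" by linarith
      with m i show False by simp
    qed
    then have lt: "(1 + cos (2 * pi * (x $ i - x0 $ i))) / 2 < 1"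
      using cos_le_one[of "2 * pi * (x $ i - x0 $ i)"] by (simp add: less_le)
    have "(\<Sum>j\<in>UNIV. (1 + cos (2 * pi * (x $ j - x0 $ j))) / 2) < (\<Sum>j\<in>(UNIV :: 'n set). 1)"
      using lt by (intro sum_strict_mono_ex1) auto
    then show ?thesis using n by (simp add: s_def n_def)
  qed
  obtain r where r: "r > 0" "\<And>x. x \<in> cbox 0 1 \<Longrightarrow> dist x x0 < r \<Longrightarrow> \<bar>h x - h x0\<bar> < h x0 / 2"
    using conth[unfolded continuous_on_iff, rule_format, OF x0_in, of "h x0 / 2"] h0 by (auto simp: dist_real_def)
  define K where "K = cbox 0 1 - ball x0 r"
  have K: "compact K" by (simp add: K_def compact_diff)
  \<comment> \<open>The gap \<eta> makes \<open>\<eta> + s x\<close> at most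
    \<open>1 - \<eta>\<close> away from \<open>x0\<close>, whereas it exceeds 1 as soon as
    \<open>s x > 1 - \<eta>\<close>, hence on a neighbourhood of \<open>x0\<close>.\<close>
  have "\<exists>\<eta>>0. \<eta> < 1/2 \<and> (\<forall>x\<in>K. s x \<le> 1 - 2 * \<eta>)"
  proof (cases "K = {}")
    case True
    then show ?thesis by (intro exI[of _ "1/4"]) auto
  next
    case False
    then obtain y where y: "y \<in> K" "\<And>x. x \<in> K \<Longrightarrow> s x \<le> s y"
      using continuous_attains_sup[OF K False conts] by blast
    have "y \<noteq> x0" using y(1) r(1) by (auto simp: K_def)
    then have "s y < 1" using y(1) by (intro s1) (auto simp: K_def)
    with s0[of y] y show ?thesis by (intro exI[of _ "(1 - s y) / 3"]) (auto simp: field_simps, smt (verit) y)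
  qed
  then obtain \<eta> where \<eta>: "\<eta> > 0" "\<eta> < 1/2" "\<And>x. x \<in> K \<Longrightarrow> s x \<le> 1 - 2 * \<eta>" by blast
  have sx0: "s x0 = 1" using n by (simp add: s_def n_def)
  have "open (box 0 1 \<inter> ball x0 r \<inter> s -` {1 - \<eta> <..})"
    by (intro open_Int open_box open_ball open_vimage conts) auto
  moreover have "x0 \<in> box 0 1 \<inter> ball x0 r \<inter> s -` {1 - \<eta> <..}"
    using x0 r \<eta> sx0 by auto
  ultimately obtain a b where ab: "x0 \<in> box a b" "cbox a b \<subseteq> box 0 1 \<inter> ball x0 r \<inter> s -` {1 - \<eta> <..}"
    by (elim open_contains_cbox) auto
  define B where "B = cbox a b"
  have Bpos: "measure lborel B > 0"
    using ab(1) unfolding B_def by (metis content_pos_lt_eq box_ne_empty(2) empty_iff)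
  have Bsub: "B \<subseteq> cbox 0 1" using ab(2) box_subset_cbox unfolding B_def by blast
  obtain H where H: "\<And>x. x \<in> cbox 0 1 \<Longrightarrow> \<bar>h x\<bar> \<le> H"
    using compact_imp_bounded[OF compact_continuous_image[OF conth compact_cbox]] by (auto simp: bounded_iff)
  \<comment> \<open>The integral of \<open>h x * (\<eta> + s x) ^ N\<close> vanishes. On
    \<open>B\<close> the integrand is at least \<open>h x0 / 2\<close>, on the rest of the ball it
    is nonnegative, and on \<open>K\<close> its modulus is at most the right-hand side; letting
    \<open>N\<close> grow gives the contradiction.\<close>
  have "h x0 / 2 * measure lborel B \<le> H * (1 - \<eta>) ^ N" for N
  proof -
    let ?f = "\<lambda>x. h x * (\<eta> + s x) ^ N"
    have cf: "continuous_on (cbox 0 1) ?f" by (intro continuous_intros conth conts)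
    have "?f x = Re (cnj (g x0) * (g x * of_real ((\<eta> + 1/2) + 1 / (4 * n) * (\<Sum>j\<in>UNIV. 2 * cos (2 * pi * (x $ j - x0 $ j)))) ^ N))" for x
    proof -
      \<comment> \<open>Brings the peak into the shape of \<open>integral_trig_peak_power\<close>:
        averaging \<open>(1 + cos) / 2\<close> gives the constant 1/2 and the weight
        \<open>1 / (4 * n)\<close> for each \<open>2 * cos\<close>.\<close>
      have "\<eta> + s x = (\<eta> + 1/2) + 1 / (4 * n) * (\<Sum>j\<in>UNIV. 2 * cos (2 * pi * (x $ j - x0 $ j)))"
        using n by (simp add: s_def sum_divide_distrib[symmetric] sum.distrib sum_distrib_left[symmetric] n_def field_simps)
      then show ?thesis unfolding h_def by (simp only:) (simp only: of_real_power[symmetric] mult.assoc[symmetric] Re_complex_of_real Im_complex_of_real times_complex.sel(1) mult_zero_right diff_zero)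
    qed
    then have "integral (cbox 0 1) ?f = integral (cbox 0 1) (\<lambda>x. Re (cnj (g x0) * (g x * of_real ((\<eta> + 1/2) + 1 / (4 * n) * (\<Sum>j\<in>UNIV. 2 * cos (2 * pi * (x $ j - x0 $ j)))) ^ N)))"
      by presburger
    also have "\<dots> = Re (integral (cbox 0 1) (\<lambda>x. cnj (g x0) * (g x * of_real ((\<eta> + 1/2) + 1 / (4 * n) * (\<Sum>j\<in>UNIV. 2 * cos (2 * pi * (x $ j - x0 $ j)))) ^ N)))"
      by (intro integral_linear[OF _ bounded_linear_Re, unfolded o_def] integrable_continuous continuous_intros cont)
    also have "\<dots> = 0"
      by (simp only: integral_mult_right integral_trig_peak_power[OF cont zero]) simp
    finally have If: "integral (cbox 0 1) ?f = 0" .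
    let ?b = "\<lambda>x. h x0 / 2 * indicat_real B x - H * (1 - \<eta>) ^ N"
    have Bm: "(indicat_real B has_integral measure lborel B) (cbox 0 1)"
      using has_integral_restrict[OF Bsub, of "\<lambda>_. 1::real" "measure lborel B"] has_integral_const[of "1::real" a b]
      unfolding B_def indicator_def by (simp add: of_bool_def)
    have Ib: "(?b has_integral h x0 / 2 * measure lborel B - H * (1 - \<eta>) ^ N) (cbox 0 1)"
      using has_integral_diff[OF has_integral_mult_right[OF Bm, of "h x0 / 2"] has_integral_const[of "H * (1 - \<eta>) ^ N" 0 1]]
      by (simp add: content_unit_box_cart)
    have "?b x \<le> ?f x" if x: "x \<in> cbox 0 1" for x
    proof -
      have Hp: "0 \<le> H * (1 - \<eta>) ^ N" using H[OF x] \<eta> by (intro mult_nonneg_nonneg zero_le_power) auto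
      have T0: "0 \<le> (\<eta> + s x) ^ N" using s0[of x] \<eta> by simp
      show ?thesis
      proof (cases "x \<in> ball x0 r")
        case True
        then have "\<bar>h x - h x0\<bar> < h x0 / 2" using r(2)[OF x] by (simp add: dist_commute)
        then have hx: "h x0 / 2 \<le> h x" by linarith
        show ?thesis
        proof (cases "x \<in> B")
          case True
          then have "1 \<le> \<eta> + s x" using ab(2) by (auto simp: B_def)
          then have "1 \<le> (\<eta> + s x) ^ N" by (rule one_le_power)
          then have "h x0 / 2 * 1 \<le> h x * (\<eta> + s x) ^ N" using hx h0 by (intro mult_mono) auto
          with True Hp show ?thesis by simp
        next
          case False
          have "0 \<le> h x * (\<eta> + s x) ^ N" using hx h0 T0 by (intro mult_nonneg_nonneg) auto
          with False Hp show ?thesis by simp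
        qed
      next
        case False
        then have xK: "x \<in> K" using x by (simp add: K_def)
        have "x \<notin> B" using False ab(2) unfolding B_def by blast
        have "(\<eta> + s x) ^ N \<le> (1 - \<eta>) ^ N" using \<eta>(3)[OF xK] \<eta>(1) s0[of x] by (intro power_mono) auto
        then have "\<bar>h x * (\<eta> + s x) ^ N\<bar> \<le> H * (1 - \<eta>) ^ N"
          unfolding abs_mult using H[OF x] T0 by (intro mult_mono) auto
        with \<open>x \<notin> B\<close> show ?thesis by simp
      qed
    qed
    then have "h x0 / 2 * measure lborel B - H * (1 - \<eta>) ^ N \<le> integral (cbox 0 1) ?f"
      using Ib cf by (intro has_integral_le[OF Ib integrable_integral[OF integrable_continuous]]) auto
    with If show ?thesis by simp
  qed
  moreover have "(\<lambda>N. H * (1 - \<eta>) ^ N) \<longlonglongrightarrow> H * 0"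
    using \<eta> by (intro tendsto_intros LIMSEQ_realpow_zero) auto
  ultimately have "h x0 / 2 * measure lborel B \<le> H * 0"
    by (intro LIMSEQ_le_const) auto
  with h0 Bpos show False by (simp add: mult_le_0_iff)
qed

text \<open>Vanishing passes from the open box to its closure by continuity and from there to all
  points by periodicity.\<close>

theorem fourier_coeff_unique_0:
  fixes g :: "real ^ 'n::finite \<Rightarrow> complex"
  assumes cont: "continuous_on UNIV g" and per: "torus_periodic g" and zero: "\<And>p. fourier_coeff g p = 0"
  shows "g x = 0"
proof -
  have c: "continuous_on (cbox 0 1) g" using cont continuous_on_subset by blast
  have "g y = 0" if "y \<in> closure (box 0 1)" for y
    by (rule continuous_constant_on_closure[OF _ _ that])
       (use fourier_coeff_eq_0_interior[OF c zero] continuous_on_subset[OF cont subset_UNIV] in auto)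
  moreover have "box 0 (1 :: real ^ 'n) \<noteq> {}" by (simp add: interval_ne_empty_cart)
  ultimately have *: "g y = 0" if "y \<in> cbox 0 1" for y
    using that closure_box by metis
  define m :: "int ^ 'n" where "m = (\<chi> i. - \<lfloor>x $ i\<rfloor>)"
  have "x + rvec m \<in> cbox 0 1"
    by (auto simp: mem_box_cart m_def rvec_def) linarith+
  with * per show ?thesis unfolding torus_periodic_def by metis
qed

lemma fourier_coeff_unique:
  assumes "torus_smooth f" "torus_smooth g" "\<And>p. fourier_coeff f p = fourier_coeff g p"
  shows "f = g"
proof
  fix x
  have "f x - g x = 0"
  proof (rule fourier_coeff_unique_0)
    show "fourier_coeff (\<lambda>x. f x - g x) p = 0" for p
      using assms by (simp add: fourier_coeff_diff torus_smooth_continuous)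
  qed (intro torus_smooth_continuous torus_smooth_periodic torus_smooth_diff assms)+
  then show "f x = g x" by simp
qed

section \<open>Falling derivatives as Fourier multipliers\<close>

lemma torus_smooth_falling_deriv: "torus_smooth g \<Longrightarrow> torus_smooth (falling_deriv j l g)"
proof (induction l)
  case (Suc l)
  then show ?case
    unfolding falling_deriv.simps
    by (intro torus_smooth_diff torus_smooth_cmult torus_smooth_partial_deriv Suc)
qed simp

primrec falling_power :: "int \<Rightarrow> nat \<Rightarrow> complex" where
  "falling_power m 0 = 1"
| "falling_power m (Suc l) = (of_int m - of_nat l) * falling_power m l"

lemma fourier_coeff_falling_deriv:
  assumes "torus_smooth g"
  shows "fourier_coeff (falling_deriv j l g) p = falling_power (p $ j) l * fourier_coeff g p"
proof (induction l)
  case (Suc l)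
  have s: "torus_smooth (falling_deriv j l g)" using assms by (rule torus_smooth_falling_deriv)
  have "fourier_coeff (falling_deriv j (Suc l) g) p =
      1 / (2 * of_real pi * \<i>) * fourier_coeff (partial_deriv j (falling_deriv j l g)) p
      - of_nat l * fourier_coeff (falling_deriv j l g) p"
    unfolding falling_deriv.simps
    by (simp only: fourier_coeff_diff torus_smooth_continuous torus_smooth_cmult torus_smooth_partial_deriv s
        fourier_coeff_cmult)
  then show ?case
    by (simp add: fourier_coeff_partial_deriv[OF s] Suc algebra_simps)
qed auto

lemma torus_smooth_falling_derivs: "torus_smooth g \<Longrightarrow> torus_smooth (falling_derivs \<beta> g)"
proof -
  assume g: "torus_smooth g"
  have "torus_smooth (foldr (\<lambda>j. falling_deriv j (\<beta> $ j)) js g)" for js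
    by (induction js) (auto intro: torus_smooth_falling_deriv g)
  then show ?thesis by (simp add: falling_derivs_def)
qed

lemma fourier_coeff_falling_derivs:
  fixes g :: "real ^ 'n::{finite,linorder} \<Rightarrow> complex"
  assumes g: "torus_smooth g"
  shows "fourier_coeff (falling_derivs \<beta> g) p = (\<Prod>j\<in>UNIV. falling_power (p $ j) (\<beta> $ j)) * fourier_coeff g p"
proof -
  have "distinct js \<Longrightarrow> torus_smooth (foldr (\<lambda>j. falling_deriv j (\<beta> $ j)) js g) \<and>
    fourier_coeff (foldr (\<lambda>j. falling_deriv j (\<beta> $ j)) js g) p
      = (\<Prod>j\<in>set js. falling_power (p $ j) (\<beta> $ j)) * fourier_coeff g p" for js
    by (induction js) (auto simp: g torus_smooth_falling_deriv fourier_coeff_falling_deriv)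
  from this[of "sorted_list_of_set UNIV"] show ?thesis by (simp add: falling_derivs_def)
qed

text \<open>On the Fourier side both operators are multiplications, which commute; symmetry of
  second derivatives never has to be proved directly.\<close>

lemma falling_derivs_partial_deriv:
  assumes g: "torus_smooth g"
  shows "falling_derivs \<beta> (partial_deriv j g) = partial_deriv j (falling_derivs \<beta> g)"
  by (rule fourier_coeff_unique)
     (simp_all add: g torus_smooth_falling_derivs torus_smooth_partial_deriv fourier_coeff_falling_derivs
       fourier_coeff_partial_deriv)

text \<open>Raising \<beta> by one in direction \<open>j\<close> adds the multiplier
  \<open>p $ j - \<beta> $ j\<close>; solved for \<open>p $ j\<close>, this expresses the ordinary
  derivative by falling ones. It is what transfers bounds on falling derivatives to ordinary
  derivatives.\<close>

lemma partial_deriv_falling_derivs: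
  fixes g :: "real ^ 'n::{finite,linorder} \<Rightarrow> complex"
  assumes g: "torus_smooth g"
  shows "falling_derivs \<beta> (partial_deriv j g) x =
    2 * of_real pi * \<i> * falling_derivs (\<beta> + axis j 1) g x + 2 * of_real pi * \<i> * of_nat (\<beta> $ j) * falling_derivs \<beta> g x"
proof -
  have s: "torus_smooth (\<lambda>x. 2 * of_real pi * \<i> * falling_derivs (\<beta> + axis j 1) g x)"
      "torus_smooth (\<lambda>x. 2 * of_real pi * \<i> * of_nat (\<beta> $ j) * falling_derivs \<beta> g x)"
    by (intro torus_smooth_cmult torus_smooth_falling_derivs g)+
  have "falling_derivs \<beta> (partial_deriv j g) = (\<lambda>x.
    2 * of_real pi * \<i> * falling_derivs (\<beta> + axis j 1) g x + 2 * of_real pi * \<i> * of_nat (\<beta> $ j) * falling_derivs \<beta> g x)"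
  proof (rule fourier_coeff_unique)
    fix p :: "int ^ 'n::{finite,linorder}"
    have "(\<Prod>i\<in>UNIV. falling_power (p $ i) ((\<beta> + axis j 1) $ i))
        = (of_int (p $ j) - of_nat (\<beta> $ j)) * (\<Prod>i\<in>UNIV. falling_power (p $ i) (\<beta> $ i))"
      by (simp add: prod.remove[of UNIV j] axis_def cong: if_cong)
    then show "fourier_coeff (falling_derivs \<beta> (partial_deriv j g)) p = fourier_coeff (\<lambda>x.
      2 * of_real pi * \<i> * falling_derivs (\<beta> + axis j 1) g x + 2 * of_real pi * \<i> * of_nat (\<beta> $ j) * falling_derivs \<beta> g x) p"
      by (simp only: fourier_coeff_add torus_smooth_continuous s fourier_coeff_cmult fourier_coeff_falling_derivs g
            torus_smooth_partial_deriv fourier_coeff_partial_deriv) (simp add: algebra_simps)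
  qed (intro torus_smooth_add s torus_smooth_falling_derivs torus_smooth_partial_deriv g)+
  then show ?thesis by simp
qed

section \<open>Differentiation of series\<close>

lemma summable_on_dominated:
  fixes f :: "'i \<Rightarrow> 'b :: banach"
  assumes "M summable_on A" "\<And>x. norm (f x) \<le> M x"
  shows "f summable_on A"
  using Infinite_Sum.abs_summable_on_comparison_test'[of M A f] assms by (simp add: abs_summable_summable)

text \<open>One majorant \<open>M\<close> serves the terms and all their first derivatives. The
  lattice is enumerated because the theorem on derivatives of series speaks of sequences.\<close>

lemma infsum_partial_deriv:
  fixes u :: "int ^ 'm::finite \<Rightarrow> real ^ 'n::finite \<Rightarrow> complex"
  assumes diff: "\<And>i. u i differentiable_on UNIV"
    and le: "\<And>i x. norm (u i x) \<le> M i" and le': "\<And>j i x. norm (partial_deriv j (u i) x) \<le> M i"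
    and M: "M summable_on UNIV"
  shows "(\<lambda>x. \<Sum>\<^sub>\<infinity>i. u i x) differentiable_on UNIV"
    and "partial_deriv j (\<lambda>x. \<Sum>\<^sub>\<infinity>i. u i x) = (\<lambda>x. \<Sum>\<^sub>\<infinity>i. partial_deriv j (u i) x)"
proof -
  have inf: "infinite (UNIV :: (int ^ 'm) set)"
  proof
    assume "finite (UNIV :: (int ^ 'm) set)"
    then have "finite (range (\<lambda>c. axis undefined c :: int ^ 'm))" by (rule finite_subset[rotated]) simp
    moreover have "inj (\<lambda>c::int. axis undefined c :: int ^ 'm)" by (simp add: inj_def axis_eq_axis)
    ultimately show False using finite_imageD infinite_UNIV_int by blast
  qed
  have "countable (UNIV :: (int ^ 'm) set)"
  proof -
    have "k \<in> (\<Union>N::nat. {k :: int ^ 'm. norm (rvec k) \<le> real N})" for k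
      using real_arch_simple[of "norm (rvec k)"] by simp
    then have "UNIV = (\<Union>N::nat. {k :: int ^ 'm. norm (rvec k) \<le> real N})"
      by blast
    moreover have "countable (\<Union>N::nat. {k :: int ^ 'm. norm (rvec k) \<le> real N})"
      by (rule countable_UN) (auto intro: countable_finite finite_lattice_ball)
    ultimately show ?thesis by simp
  qed
  then obtain \<phi> :: "nat \<Rightarrow> int ^ 'm" where \<phi>: "bij \<phi>"
    using inf bij_betw_from_nat_into by blast
  have Ms: "summable (M \<circ> \<phi>)"
  proof -
    have "(M \<circ> \<phi>) summable_on UNIV"
      using M summable_on_reindex_bij_betw[OF \<phi>, of M] by (simp add: o_def)
    then show ?thesis by (rule summable_on_imp_summable)
  qed
  have sums: "(\<lambda>n. v (\<phi> n)) sums (\<Sum>\<^sub>\<infinity>i. v i)" if "\<And>i. norm (v i) \<le> M i" for v :: "int ^ 'm \<Rightarrow> complex"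
  proof -
    have "v summable_on UNIV"
      using M that by (rule summable_on_dominated)
    then have "((\<lambda>n. v (\<phi> n)) has_sum (\<Sum>\<^sub>\<infinity>i. v i)) UNIV"
      using has_sum_reindex_bij_betw[OF \<phi>, of v] by (simp add: has_sum_infsum)
    then show ?thesis by (rule has_sum_imp_sums)
  qed
  define D where "D j x = (\<Sum>\<^sub>\<infinity>i. partial_deriv j (u i) x)" for j x
  have lim: "uniform_limit UNIV (\<lambda>N x. \<Sum>i<N. partial_deriv j (u (\<phi> i)) x) (D j) sequentially" for j
  proof -
    have "uniform_limit UNIV (\<lambda>N x. \<Sum>i<N. partial_deriv j (u (\<phi> i)) x) (\<lambda>x. suminf (\<lambda>i. partial_deriv j (u (\<phi> i)) x)) sequentially"
      by (rule Weierstrass_m_test[OF _ Ms]) (simp add: le')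
    moreover have "suminf (\<lambda>i. partial_deriv j (u (\<phi> i)) x) = D j x" for x
      unfolding D_def by (rule sums_unique[symmetric]) (rule sums, rule le')
    ultimately show ?thesis by simp
  qed
  have "\<exists>g. \<forall>x\<in>UNIV. (\<lambda>n. u (\<phi> n) x) sums g x \<and> (g has_derivative (\<lambda>h. \<Sum>j\<in>UNIV. (h $ j) *\<^sub>R D j x)) (at x within UNIV)"
  proof (rule has_derivative_series[where x = 0])
    show "((\<lambda>x. u (\<phi> n) x) has_derivative (\<lambda>h. \<Sum>j\<in>UNIV. (h $ j) *\<^sub>R partial_deriv j (u (\<phi> n)) x)) (at x within UNIV)" for n x
      using diff by (simp add: has_derivative_partial_derivs differentiable_on_UNIV)
    show "(\<lambda>n. u (\<phi> n) 0) sums (\<Sum>\<^sub>\<infinity>i. u i 0)" by (rule sums) (rule le)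
    fix e :: real assume e: "e > 0"
    \<comment> \<open>The error in the total derivative is at most the sum of the errors in the
      partial derivatives, one for each coordinate.\<close>
    define e' where "e' = e / real CARD('n)"
    have e': "e' > 0" using e by (simp add: e'_def)
    have "\<forall>\<^sub>F n in sequentially. \<forall>j\<in>UNIV. \<forall>x\<in>UNIV. dist (\<Sum>i<n. partial_deriv j (u (\<phi> i)) x) (D j x) < e'"
      using lim e' unfolding uniform_limit_iff by (intro eventually_ball_finite[OF finite] ballI) simp
    then show "\<forall>\<^sub>F n in sequentially. \<forall>x\<in>UNIV. \<forall>h. norm ((\<Sum>i<n. \<Sum>j\<in>UNIV. (h $ j) *\<^sub>R partial_deriv j (u (\<phi> i)) x)
          - (\<Sum>j\<in>UNIV. (h $ j) *\<^sub>R D j x)) \<le> e * norm h"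
    proof eventually_elim
      case (elim n)
      show ?case
      proof (intro ballI allI)
        fix x h :: "real ^ 'n"
        have "(\<Sum>i<n. \<Sum>j\<in>UNIV. (h $ j) *\<^sub>R partial_deriv j (u (\<phi> i)) x) - (\<Sum>j\<in>UNIV. (h $ j) *\<^sub>R D j x)
          = (\<Sum>j\<in>UNIV. (h $ j) *\<^sub>R ((\<Sum>i<n. partial_deriv j (u (\<phi> i)) x) - D j x))"
          by (subst sum.swap) (simp add: scaleR_diff_right scaleR_sum_right sum_subtractf)
        also have "norm \<dots> \<le> (\<Sum>j\<in>(UNIV::'n set). norm h * e')"
          using elim component_le_norm_cart[of h]
          by (intro sum_norm_le) (auto intro!: mult_mono simp: dist_norm less_imp_le)
        also have "\<dots> = e * norm h" by (simp add: e'_def)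
        finally show "norm ((\<Sum>i<n. \<Sum>j\<in>UNIV. (h $ j) *\<^sub>R partial_deriv j (u (\<phi> i)) x)
          - (\<Sum>j\<in>UNIV. (h $ j) *\<^sub>R D j x)) \<le> e * norm h" .
      qed
    qed
  qed auto
  then obtain g where g: "\<And>x. (\<lambda>n. u (\<phi> n) x) sums g x"
      "\<And>x. (g has_derivative (\<lambda>h. \<Sum>j\<in>UNIV. (h $ j) *\<^sub>R D j x)) (at x)" by auto
  have geq: "g = (\<lambda>x. \<Sum>\<^sub>\<infinity>i. u i x)"
    using sums_unique2[OF g(1) sums[OF le]] by (intro ext)
  show "(\<lambda>x. \<Sum>\<^sub>\<infinity>i. u i x) differentiable_on UNIV"
    using g(2) unfolding geq differentiable_on_UNIV differentiable_def by blast
  show "partial_deriv j (\<lambda>x. \<Sum>\<^sub>\<infinity>i. u i x) = (\<lambda>x. \<Sum>\<^sub>\<infinity>i. partial_deriv j (u i) x)"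
  proof
    fix x
    have "(\<Sum>k\<in>UNIV. (axis j 1 $ k) *\<^sub>R D k x) = (\<Sum>k\<in>UNIV. if k = j then D k x else 0)"
      by (intro sum.cong) (auto simp: axis_def)
    then show "partial_deriv j (\<lambda>x. \<Sum>\<^sub>\<infinity>i. u i x) x = (\<Sum>\<^sub>\<infinity>i. partial_deriv j (u i) x)"
      using partial_deriv_has_derivative[OF g(2)[unfolded geq], of j x] by (simp add: D_def)
  qed
qed

section \<open>Symbol classes\<close>

lemma torus_smooth_bounded:
  assumes "torus_smooth g" shows "\<exists>B. \<forall>x. norm (g x) \<le> B"
proof -
  have "bounded (g ` cbox 0 1)"
    using compact_continuous_image[OF torus_smooth_continuous[OF assms] compact_cbox] compact_imp_bounded by blast
  then obtain B where B: "\<And>x. x \<in> cbox 0 1 \<Longrightarrow> norm (g x) \<le> B"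
    by (auto simp: bounded_iff)
  have "norm (g x) \<le> B" for x
  proof -
    define m where "m = (\<chi> i. - \<lfloor>x $ i\<rfloor>)"
    have "x + rvec m \<in> cbox 0 1"
      by (auto simp: mem_box_cart m_def rvec_def) linarith+
    with B torus_smooth_periodic[OF assms] show ?thesis unfolding torus_periodic_def by metis
  qed
  then show ?thesis by blast
qed

section \<open>Single derivatives and differences of symbols\<close>

definition smooth_symbol :: "'n::finite lattice_symbol \<Rightarrow> bool" where
  "smooth_symbol \<sigma> \<longleftrightarrow> (\<forall>k. torus_smooth (\<sigma> k))"

definition symbol_deriv :: "'n::finite \<Rightarrow> 'n lattice_symbol \<Rightarrow> 'n lattice_symbol" where
  "symbol_deriv j \<sigma> k = partial_deriv j (\<sigma> k)"

definition symbol_diff :: "'n::finite \<Rightarrow> 'n lattice_symbol \<Rightarrow> 'n lattice_symbol" where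
  "symbol_diff j \<sigma> k x = \<sigma> (k + axis j 1) x - \<sigma> k x"

lemma smooth_symbolD: "smooth_symbol \<sigma> \<Longrightarrow> torus_smooth (\<sigma> k)"
  by (simp add: smooth_symbol_def)

lemma smooth_symbol_differentiable: "smooth_symbol \<sigma> \<Longrightarrow> (\<sigma> k) differentiable_on UNIV"
  by (simp add: smooth_symbol_def torus_smooth_differentiable)

lemma smooth_symbol_deriv: "smooth_symbol \<sigma> \<Longrightarrow> smooth_symbol (symbol_deriv j \<sigma>)"
  by (simp add: smooth_symbol_def symbol_deriv_def torus_smooth_partial_deriv)

lemma smooth_symbol_diff: "smooth_symbol \<sigma> \<Longrightarrow> smooth_symbol (symbol_diff j \<sigma>)"
  by (simp add: smooth_symbol_def symbol_diff_def[abs_def] torus_smooth_diff)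

lemma smooth_symbol_shift: "smooth_symbol \<sigma> \<Longrightarrow> smooth_symbol (\<lambda>k. \<sigma> (k + p))"
  by (simp add: smooth_symbol_def)

lemma smooth_symbol_add: "smooth_symbol \<sigma> \<Longrightarrow> smooth_symbol \<tau> \<Longrightarrow> smooth_symbol (\<lambda>k x. \<sigma> k x + \<tau> k x)"
  by (simp add: smooth_symbol_def torus_smooth_add)

lemma smooth_symbol_minus: "smooth_symbol \<sigma> \<Longrightarrow> smooth_symbol \<tau> \<Longrightarrow> smooth_symbol (\<lambda>k x. \<sigma> k x - \<tau> k x)"
  by (simp add: smooth_symbol_def torus_smooth_diff)

lemma smooth_symbol_mult: "smooth_symbol \<sigma> \<Longrightarrow> smooth_symbol \<tau> \<Longrightarrow> smooth_symbol (\<lambda>k x. \<sigma> k x * \<tau> k x)"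
  by (simp add: smooth_symbol_def torus_smooth_mult)

lemma smooth_symbol_const [simp]: "smooth_symbol (\<lambda>k x. c)"
  by (simp add: smooth_symbol_def)

lemma smooth_symbol_sum: "(\<And>i. i \<in> I \<Longrightarrow> smooth_symbol (\<sigma> i)) \<Longrightarrow> smooth_symbol (\<lambda>k x. \<Sum>i\<in>I. \<sigma> i k x)"
  by (simp add: smooth_symbol_def torus_smooth_sum)

lemma symbol_deriv_add:
  "smooth_symbol \<sigma> \<Longrightarrow> smooth_symbol \<tau> \<Longrightarrow>
    symbol_deriv j (\<lambda>k x. \<sigma> k x + \<tau> k x) = (\<lambda>k x. symbol_deriv j \<sigma> k x + symbol_deriv j \<tau> k x)"
  by (simp add: symbol_deriv_def[abs_def] partial_deriv_add smooth_symbol_differentiable)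

lemma symbol_deriv_minus:
  "smooth_symbol \<sigma> \<Longrightarrow> smooth_symbol \<tau> \<Longrightarrow>
    symbol_deriv j (\<lambda>k x. \<sigma> k x - \<tau> k x) = (\<lambda>k x. symbol_deriv j \<sigma> k x - symbol_deriv j \<tau> k x)"
  by (simp add: symbol_deriv_def[abs_def] partial_deriv_diff smooth_symbol_differentiable)

lemma symbol_deriv_mult:
  "smooth_symbol \<sigma> \<Longrightarrow> smooth_symbol \<tau> \<Longrightarrow>
    symbol_deriv j (\<lambda>k x. \<sigma> k x * \<tau> k x) = (\<lambda>k x. symbol_deriv j \<sigma> k x * \<tau> k x + \<sigma> k x * symbol_deriv j \<tau> k x)"
  by (simp add: symbol_deriv_def[abs_def] partial_deriv_mult smooth_symbol_differentiable)

lemma symbol_deriv_sum: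
  "(\<And>i. i \<in> I \<Longrightarrow> smooth_symbol (\<sigma> i)) \<Longrightarrow>
    symbol_deriv j (\<lambda>k x. \<Sum>i\<in>I. \<sigma> i k x) = (\<lambda>k x. \<Sum>i\<in>I. symbol_deriv j (\<sigma> i) k x)"
  by (simp add: symbol_deriv_def[abs_def] partial_deriv_sum smooth_symbol_differentiable)

lemma symbol_deriv_const [simp]: "symbol_deriv j (\<lambda>k x. c k) = (\<lambda>k x. 0)"
  by (simp add: symbol_deriv_def[abs_def])

lemma symbol_deriv_shift: "symbol_deriv j (\<lambda>k. \<sigma> (k + p)) = (\<lambda>k. symbol_deriv j \<sigma> (k + p))"
  by (simp add: symbol_deriv_def[abs_def])

lemma symbol_diff_shift: "symbol_diff j (\<lambda>k. \<sigma> (k + p)) = (\<lambda>k. symbol_diff j \<sigma> (k + p))"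
  by (intro ext) (simp add: symbol_diff_def add_ac)

lemma symbol_diff_add:
  "symbol_diff j (\<lambda>k x. \<sigma> k x + \<tau> k x) = (\<lambda>k x. symbol_diff j \<sigma> k x + symbol_diff j \<tau> k x)"
  by (intro ext) (simp add: symbol_diff_def)

lemma symbol_diff_mult:
  "symbol_diff j (\<lambda>k x. \<sigma> k x * \<tau> k x) =
    (\<lambda>k x. symbol_diff j \<sigma> k x * \<tau> (k + axis j 1) x + \<sigma> k x * symbol_diff j \<tau> k x)"
  by (intro ext) (simp add: symbol_diff_def algebra_simps)

lemma symbol_diff_const [simp]: "symbol_diff j (\<lambda>k x. c x) = (\<lambda>k x. 0)"
  by (intro ext) (simp add: symbol_diff_def)

lemma symbol_deriv_diff_commute:
  "smooth_symbol \<sigma> \<Longrightarrow> symbol_deriv i (symbol_diff j \<sigma>) = symbol_diff j (symbol_deriv i \<sigma>)"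
  by (intro ext) (simp add: symbol_deriv_def symbol_diff_def[abs_def] partial_deriv_diff smooth_symbol_differentiable)

lemma bracket_neq_0 [simp]: "bracket k \<noteq> 0"
  using bracket_pos[of k] by linarith

lemma bracket_axis_shift: "bracket (k + axis j 1) powr m \<le> 2 powr \<bar>m\<bar> * bracket k powr m"
  using bracket_powr_shift[of k "axis j 1" m]
  by (simp add: bracket_def rvec_axis norm_axis_1 mult.commute)

section \<open>Calculus of symbol orders\<close>

locale symbol_orders =
  fixes \<rho> \<delta> :: real
  assumes delta_nonneg: "0 \<le> \<delta>" and delta_less_rho: "\<delta> < \<rho>" and rho_le_1: "\<rho> \<le> 1"
begin

lemma rho_pos: "0 < \<rho>" and delta_less_1: "\<delta> < 1" and eps_pos: "0 < \<rho> - \<delta>"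
  using delta_nonneg delta_less_rho rho_le_1 by linarith+

text \<open>\<open>n\<close> counts derivatives and differences together, applied one by one in any
  order. Product and reciprocal rules are then needed only in their one-step form instead of full
  Leibniz formulas.\<close>

primrec ord_bound :: "nat \<Rightarrow> real \<Rightarrow> 'n::finite lattice_symbol \<Rightarrow> bool" where
  "ord_bound 0 m \<sigma> \<longleftrightarrow> (\<exists>C. \<forall>k x. norm (\<sigma> k x) \<le> C * bracket k powr m)"
| "ord_bound (Suc n) m \<sigma> \<longleftrightarrow> ord_bound n m \<sigma> \<and>
     (\<forall>j. ord_bound n (m + \<delta>) (symbol_deriv j \<sigma>)) \<and> (\<forall>j. ord_bound n (m - \<rho>) (symbol_diff j \<sigma>))"

text \<open>Agrees with \<open>symbol_class\<close>, as \<open>symbol_class_eq_sym\<close> shows,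
  but is free of multi-indices and hence of an order on the coordinates.\<close>

definition symb :: "real \<Rightarrow> 'n::finite lattice_symbol set" where
  "symb m = {\<sigma>. smooth_symbol \<sigma> \<and> (\<forall>n. ord_bound n m \<sigma>)}"

lemma ord_bound_mono: "ord_bound n m \<sigma> \<Longrightarrow> m \<le> m' \<Longrightarrow> ord_bound n m' \<sigma>"
proof (induction n arbitrary: m m' \<sigma>)
  case 0
  then obtain C where C: "\<And>k x. norm (\<sigma> k x) \<le> C * bracket k powr m" by auto
  have "norm (\<sigma> k x) \<le> \<bar>C\<bar> * bracket k powr m'" for k x
  proof -
    have "norm (\<sigma> k x) \<le> C * bracket k powr m" by (rule C)
    also have "\<dots> \<le> \<bar>C\<bar> * bracket k powr m'"
      using 0 by (intro mult_mono bracket_powr_mono) auto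
    finally show ?thesis .
  qed
  then show ?case by auto
next
  case (Suc n)
  have "m + \<delta> \<le> m' + \<delta>" "m - \<rho> \<le> m' - \<rho>" using Suc.prems(2) by auto
  from Suc.IH[OF _ this(1)] Suc.IH[OF _ this(2)] Suc.IH[OF _ Suc.prems(2)] Suc.prems(1) show ?case by simp
qed

text \<open>The product rule for differences evaluates one factor at the neighbouring lattice
  point.\<close>

lemma ord_bound_shift: "ord_bound n m \<sigma> \<Longrightarrow> ord_bound n m (\<lambda>k. \<sigma> (k + axis j 1))"
proof (induction n arbitrary: m \<sigma>)
  case 0
  then obtain C where C: "\<And>k x. norm (\<sigma> k x) \<le> C * bracket k powr m" by auto
  have "norm (\<sigma> (k + axis j 1) x) \<le> (\<bar>C\<bar> * 2 powr \<bar>m\<bar>) * bracket k powr m" for k x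
  proof -
    have "norm (\<sigma> (k + axis j 1) x) \<le> C * bracket (k + axis j 1) powr m" by (rule C)
    also have "\<dots> \<le> \<bar>C\<bar> * (2 powr \<bar>m\<bar> * bracket k powr m)"
      by (intro mult_mono bracket_axis_shift) auto
    finally show ?thesis by (simp add: mult.assoc)
  qed
  then show ?case by auto
qed (auto simp: symbol_deriv_shift symbol_diff_shift)

lemma ord_bound_add:
  "ord_bound n m \<sigma> \<Longrightarrow> ord_bound n m \<tau> \<Longrightarrow> smooth_symbol \<sigma> \<Longrightarrow> smooth_symbol \<tau> \<Longrightarrow>
    ord_bound n m (\<lambda>k x. \<sigma> k x + \<tau> k x)"
proof (induction n arbitrary: m \<sigma> \<tau>)
  case 0
  then obtain C D where C: "\<And>k x. norm (\<sigma> k x) \<le> C * bracket k powr m"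
    and D: "\<And>k x. norm (\<tau> k x) \<le> D * bracket k powr m" by auto
  have "norm (\<sigma> k x + \<tau> k x) \<le> (C + D) * bracket k powr m" for k x
    using norm_triangle_mono[OF C D] by (simp add: distrib_right)
  then show ?case by auto
qed (auto simp: symbol_deriv_add symbol_diff_add smooth_symbol_deriv smooth_symbol_diff)

lemma ord_bound_mult:
  "ord_bound n m \<sigma> \<Longrightarrow> ord_bound n m' \<tau> \<Longrightarrow> smooth_symbol \<sigma> \<Longrightarrow> smooth_symbol \<tau> \<Longrightarrow>
    ord_bound n (m + m') (\<lambda>k x. \<sigma> k x * \<tau> k x)"
proof (induction n arbitrary: m m' \<sigma> \<tau>)
  case 0
  then obtain C D where C: "\<And>k x. norm (\<sigma> k x) \<le> C * bracket k powr m"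
    and D: "\<And>k x. norm (\<tau> k x) \<le> D * bracket k powr m'" by auto
  have "norm (\<sigma> k x * \<tau> k x) \<le> (C * D) * bracket k powr (m + m')" for k x
  proof -
    have "norm (\<sigma> k x * \<tau> k x) \<le> (C * bracket k powr m) * (D * bracket k powr m')"
      unfolding norm_mult by (intro mult_mono' C D) auto
    then show ?thesis by (simp add: powr_add mult_ac)
  qed
  then show ?case by auto
next
  case (Suc n)
  note sm = smooth_symbol_deriv smooth_symbol_diff smooth_symbol_mult Suc.prems(3,4) smooth_symbol_shift[OF Suc.prems(4)]
  have s: "ord_bound n m \<sigma>" "ord_bound n (m + \<delta>) (symbol_deriv j \<sigma>)" "ord_bound n (m - \<rho>) (symbol_diff j \<sigma>)" for j
    using Suc.prems(1) by auto
  have t: "ord_bound n m' \<tau>" "ord_bound n (m' + \<delta>) (symbol_deriv j \<tau>)" "ord_bound n (m' - \<rho>) (symbol_diff j \<tau>)" for j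
    using Suc.prems(2) by auto
  have "ord_bound n (m + m') (\<lambda>k x. \<sigma> k x * \<tau> k x)"
    by (intro Suc.IH s t sm)
  moreover have "ord_bound n (m + m' + \<delta>) (symbol_deriv j (\<lambda>k x. \<sigma> k x * \<tau> k x))" for j
  proof -
    have "ord_bound n ((m + \<delta>) + m') (\<lambda>k x. symbol_deriv j \<sigma> k x * \<tau> k x)"
      and "ord_bound n (m + (m' + \<delta>)) (\<lambda>k x. \<sigma> k x * symbol_deriv j \<tau> k x)"
      by (intro Suc.IH s t sm)+
    moreover have "(m + \<delta>) + m' = m + m' + \<delta>" "m + (m' + \<delta>) = m + m' + \<delta>" by simp_all
    ultimately show ?thesis
      unfolding symbol_deriv_mult[OF Suc.prems(3,4)]
      by (simp only: ord_bound_add sm)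
  qed
  moreover have "ord_bound n (m + m' - \<rho>) (symbol_diff j (\<lambda>k x. \<sigma> k x * \<tau> k x))" for j
  proof -
    have "ord_bound n ((m - \<rho>) + m') (\<lambda>k x. symbol_diff j \<sigma> k x * \<tau> (k + axis j 1) x)"
      and "ord_bound n (m + (m' - \<rho>)) (\<lambda>k x. \<sigma> k x * symbol_diff j \<tau> k x)"
      by (intro Suc.IH s t sm ord_bound_shift[OF t(1)])+
    moreover have "(m - \<rho>) + m' = m + m' - \<rho>" "m + (m' - \<rho>) = m + m' - \<rho>" by simp_all
    ultimately show ?thesis
      unfolding symbol_diff_mult
      by (simp only: ord_bound_add sm)
  qed
  ultimately show ?case by simp
qed

lemma symI: "smooth_symbol \<sigma> \<Longrightarrow> (\<And>n. ord_bound n m \<sigma>) \<Longrightarrow> \<sigma> \<in> symb m"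
  by (simp add: symb_def)

lemma sym_smooth: "\<sigma> \<in> symb m \<Longrightarrow> smooth_symbol \<sigma>"
  by (simp add: symb_def)

lemma sym_ord_bound: "\<sigma> \<in> symb m \<Longrightarrow> ord_bound n m \<sigma>"
  by (simp add: symb_def)

lemma sym_bound: "\<sigma> \<in> symb m \<Longrightarrow> \<exists>C>0. \<forall>k x. norm (\<sigma> k x) \<le> C * bracket k powr m"
proof -
  assume "\<sigma> \<in> symb m"
  then obtain C where C: "\<And>k x. norm (\<sigma> k x) \<le> C * bracket k powr m"
    using sym_ord_bound[of \<sigma> m 0] by auto
  have "norm (\<sigma> k x) \<le> (\<bar>C\<bar> + 1) * bracket k powr m" for k x
    using order_trans[OF C mult_right_mono, of "\<bar>C\<bar> + 1" k] by auto
  then show ?thesis by (intro exI[of _ "\<bar>C\<bar> + 1"]) auto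
qed

lemma sym_deriv: "\<sigma> \<in> symb m \<Longrightarrow> symbol_deriv j \<sigma> \<in> symb (m + \<delta>)"
proof (rule symI)
  assume \<sigma>: "\<sigma> \<in> symb m"
  show "smooth_symbol (symbol_deriv j \<sigma>)" using sym_smooth[OF \<sigma>] by (rule smooth_symbol_deriv)
  show "ord_bound n (m + \<delta>) (symbol_deriv j \<sigma>)" for n using sym_ord_bound[OF \<sigma>, of "Suc n"] by simp
qed

lemma sym_diff: "\<sigma> \<in> symb m \<Longrightarrow> symbol_diff j \<sigma> \<in> symb (m - \<rho>)"
proof (rule symI)
  assume \<sigma>: "\<sigma> \<in> symb m"
  show "smooth_symbol (symbol_diff j \<sigma>)" using sym_smooth[OF \<sigma>] by (rule smooth_symbol_diff)
  show "ord_bound n (m - \<rho>) (symbol_diff j \<sigma>)" for n using sym_ord_bound[OF \<sigma>, of "Suc n"] by simp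
qed

lemma sym_mono: "\<sigma> \<in> symb m \<Longrightarrow> m \<le> m' \<Longrightarrow> \<sigma> \<in> symb m'"
  by (auto simp: symb_def intro: ord_bound_mono)

lemma sym_add: "\<sigma> \<in> symb m \<Longrightarrow> \<tau> \<in> symb m \<Longrightarrow> (\<lambda>k x. \<sigma> k x + \<tau> k x) \<in> symb m"
  by (auto simp: symb_def intro: ord_bound_add smooth_symbol_add)

lemma sym_mult: "\<sigma> \<in> symb m \<Longrightarrow> \<tau> \<in> symb m' \<Longrightarrow> (\<lambda>k x. \<sigma> k x * \<tau> k x) \<in> symb (m + m')"
  by (auto simp: symb_def intro: ord_bound_mult smooth_symbol_mult)

text \<open>\<open>symb\<close> is the greatest family with the zeroth-order bound that is closed
  under one derivative and one difference, so membership follows from any such invariant.\<close>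

lemma sym_coinduct:
  assumes "X m \<sigma>"
    and "\<And>m \<sigma>. X m \<sigma> \<Longrightarrow> smooth_symbol \<sigma>"
    and "\<And>m \<sigma>. X m \<sigma> \<Longrightarrow> \<exists>C. \<forall>k x. norm (\<sigma> k x) \<le> C * bracket k powr m"
    and "\<And>m \<sigma> j. X m \<sigma> \<Longrightarrow> X (m + \<delta>) (symbol_deriv j \<sigma>)"
    and "\<And>m \<sigma> j. X m \<sigma> \<Longrightarrow> X (m - \<rho>) (symbol_diff j \<sigma>)"
  shows "\<sigma> \<in> symb m"
proof (rule symI)
  show "smooth_symbol \<sigma>" using assms by blast
  show "ord_bound n m \<sigma>" for n
    using assms(1) by (induction n arbitrary: m \<sigma>) (auto intro: assms(3-5))
qed

text \<open>Only finitely many lattice points lie in a ball.\<close>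

lemma sym_finite_support:
  assumes "smooth_symbol \<sigma>" and "\<And>k x. R \<le> norm (rvec k) \<Longrightarrow> \<sigma> k x = 0"
  shows "\<sigma> \<in> symb m"
proof -
  \<comment> \<open>The invariant forgets the order, since a finite support is compatible with all
    of them, and leaves \<open>R\<close> open because a difference widens the support by one
    unit.\<close>
  let ?X = "\<lambda>(m::real) \<sigma>. smooth_symbol \<sigma> \<and> (\<exists>R. \<forall>k x. R \<le> norm (rvec k) \<longrightarrow> \<sigma> k x = 0)"
  show ?thesis
  proof (rule sym_coinduct[of ?X])
    show "?X m \<sigma>" using assms by blast
    fix m :: real and \<sigma> :: "'a lattice_symbol" assume "?X m \<sigma>"
    then obtain R where sm: "smooth_symbol \<sigma>" and R: "\<And>k x. R \<le> norm (rvec k) \<Longrightarrow> \<sigma> k x = 0" by blast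
    show "smooth_symbol \<sigma>" by (rule sm)
    obtain B where B: "\<And>k x. norm (\<sigma> k x) \<le> B k"
      using torus_smooth_bounded[OF smooth_symbolD[OF sm]] choice[of "\<lambda>k B. \<forall>x. norm (\<sigma> k x) \<le> B"] by blast
    have B0: "0 \<le> B k" for k using order_trans[OF norm_ge_zero B] .
    let ?C = "\<Sum>k | norm (rvec k) \<le> R. B k / bracket k powr m"
    have "norm (\<sigma> k x) \<le> ?C * bracket k powr m" for k x
    proof (cases "norm (rvec k) \<le> R")
      case True
      have "B k / bracket k powr m \<le> ?C"
        using True by (intro member_le_sum finite_lattice_ball) (auto intro!: divide_nonneg_nonneg B0)
      then have "B k \<le> ?C * bracket k powr m"
        by (subst (asm) pos_divide_le_eq) simp_all
      with B show ?thesis using order_trans by blast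
    next
      case False
      moreover have "0 \<le> ?C" by (intro sum_nonneg divide_nonneg_nonneg B0) auto
      ultimately show ?thesis using R[of k x] by simp
    qed
    then show "\<exists>C. \<forall>k x. norm (\<sigma> k x) \<le> C * bracket k powr m" by blast
    fix j
    have "\<sigma> k = (\<lambda>x. 0)" if "R \<le> norm (rvec k)" for k using R that by (intro ext)
    then show "?X (m + \<delta>) (symbol_deriv j \<sigma>)"
      using smooth_symbol_deriv[OF sm] by (intro conjI exI[of _ R]) (auto simp: symbol_deriv_def)
    have "R \<le> norm (rvec (k + axis j 1))" if "R + 1 \<le> norm (rvec k)" for k
    proof -
      have "norm (rvec k) \<le> norm (rvec (k + axis j 1)) + norm (rvec (axis j 1))"
        using norm_triangle_ineq4[of "rvec (k + axis j 1)" "rvec (axis j 1)"] by (simp add: rvec_add)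
      with that show ?thesis by (simp add: rvec_axis norm_axis_1)
    qed
    then show "?X (m - \<rho>) (symbol_diff j \<sigma>)"
      using smooth_symbol_diff[OF sm] R by (intro conjI exI[of _ "R + 1"]) (auto simp: symbol_diff_def)
  qed
qed

lemma sym_const: "(\<lambda>k x. c) \<in> symb 0"
proof -
  let ?X = "\<lambda>(m::real) \<sigma>. (\<exists>c. \<sigma> = (\<lambda>k x. c) \<and> (0 \<le> m \<or> c = 0))"
  show ?thesis
  proof (rule sym_coinduct[of ?X])
    fix m :: real and \<sigma> :: "'a lattice_symbol" assume "?X m \<sigma>"
    then obtain c where c: "\<sigma> = (\<lambda>k x. c)" "0 \<le> m \<or> c = 0" by blast
    have "norm c \<le> norm c * bracket k powr m" for k :: "int ^ 'a"
      using c(2) ge_one_powr_ge_zero[OF bracket_ge_1, of m k] by (auto intro: mult_right_le_one_le simp: mult_le_cancel_left1)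
    with c show "\<exists>C. \<forall>k x. norm (\<sigma> k x) \<le> C * bracket k powr m" by auto
  qed auto
qed

lemma sym_0: "(\<lambda>k x. 0) \<in> symb m"
  by (rule sym_finite_support) auto

lemma sym_cmult: "\<sigma> \<in> symb m \<Longrightarrow> (\<lambda>k x. c * \<sigma> k x) \<in> symb m"
  using sym_mult[OF sym_const] by simp

lemma sym_minus: "\<sigma> \<in> symb m \<Longrightarrow> \<tau> \<in> symb m \<Longrightarrow> (\<lambda>k x. \<sigma> k x - \<tau> k x) \<in> symb m"
  using sym_add[OF _ sym_cmult, of \<sigma> m \<tau> "-1"] by simp

lemma sym_uminus: "\<sigma> \<in> symb m \<Longrightarrow> (\<lambda>k x. - \<sigma> k x) \<in> symb m"
  using sym_cmult[of \<sigma> m "-1"] by simp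

lemma sym_sum: "(\<And>i. i \<in> I \<Longrightarrow> \<sigma> i \<in> symb m) \<Longrightarrow> (\<lambda>k x. \<Sum>i\<in>I. \<sigma> i k x) \<in> symb m"
  by (induction I rule: infinite_finite_induct) (auto intro: sym_0 sym_add)

text \<open>The derivative of a reciprocal is minus its square times the derivative of \<sigma>, and
  its difference is minus the difference of \<sigma> times the reciprocals at both neighbouring
  points. Both consist of the reciprocal itself and a known symbol, so a bound for \<open>n\<close>
  steps yields one for \<open>n + 1\<close>. \<open>M\<close> marks where \<sigma> is nonzero,
  \<open>M'\<close> where the quantitative lower bound starts.\<close>

lemma sym_reciprocal:
  fixes \<sigma> :: "'n::finite lattice_symbol"
  assumes \<sigma>: "\<sigma> \<in> symb m" and nz: "\<And>k x. M \<le> norm (rvec k) \<Longrightarrow> \<sigma> k x \<noteq> 0"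
    and lower: "c > 0" "\<And>k x. M' \<le> norm (rvec k) \<Longrightarrow> c * bracket k powr m \<le> norm (\<sigma> k x)"
  shows "(\<lambda>k x. if M \<le> norm (rvec k) then 1 / \<sigma> k x else 0) \<in> symb (- m)" (is "?b \<in> _")
proof -
  have sm\<sigma>: "smooth_symbol \<sigma>" using \<sigma> by (rule sym_smooth)
  have sm: "smooth_symbol ?b"
    unfolding smooth_symbol_def
  proof
    fix k show "torus_smooth (?b k)"
      using torus_smooth_inverse[OF smooth_symbolD[OF sm\<sigma>], of k] nz[of k]
      by (cases "M \<le> norm (rvec k)") (auto simp: inverse_eq_divide)
  qed
  have D: "symbol_deriv j ?b = (\<lambda>k x. (- 1) * (?b k x * ?b k x * symbol_deriv j \<sigma> k x))" for j
  proof
    fix k show "symbol_deriv j ?b k = (\<lambda>x. (- 1) * (?b k x * ?b k x * symbol_deriv j \<sigma> k x))"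
      using partial_deriv_inverse[OF smooth_symbol_differentiable[OF sm\<sigma>, of k], of j] nz[of k]
      by (cases "M \<le> norm (rvec k)") (auto simp: symbol_deriv_def inverse_eq_divide)
  qed
  \<comment> \<open>Next to the cutoff the quotient rule for differences fails; the defect lives on
    finitely many \<open>k\<close> and therefore has every order.\<close>
  define \<phi> where "\<phi> j k x = symbol_diff j ?b k x - (- 1) * (?b (k + axis j 1) x * ?b k x * symbol_diff j \<sigma> k x)" for j k x
  have sm\<phi>: "smooth_symbol (\<phi> j)" for j
    unfolding \<phi>_def[abs_def]
    by (intro smooth_symbol_minus smooth_symbol_mult smooth_symbol_diff sm sm\<sigma> smooth_symbol_shift[OF sm] smooth_symbol_const)
  have \<phi>: "\<phi> j \<in> symb l" for j l
  proof (rule sym_finite_support[OF sm\<phi>])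
    fix k :: "int ^ 'n" and x assume k: "M + 1 \<le> norm (rvec k)"
    have "norm (rvec k) \<le> norm (rvec (k + axis j 1)) + norm (rvec (axis j 1))"
      using norm_triangle_ineq4[of "rvec (k + axis j 1)" "rvec (axis j 1)"] by (simp add: rvec_add)
    with k have k': "M \<le> norm (rvec (k + axis j 1))" by (simp add: rvec_axis norm_axis_1)
    with k nz[of k x] nz[of "k + axis j 1" x] show "\<phi> j k x = 0"
      by (simp add: \<phi>_def symbol_diff_def field_simps)
  qed
  have \<Delta>: "symbol_diff j ?b = (\<lambda>k x. (- 1) * (?b (k + axis j 1) x * ?b k x * symbol_diff j \<sigma> k x) + \<phi> j k x)" for j
    by (intro ext) (simp add: \<phi>_def)
  have "ord_bound n (- m) ?b" for n
  proof (induction n)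
    case 0
    let ?b' = "\<lambda>k x. if norm (rvec k) < M' then ?b k x else 0"
    have "?b' \<in> symb (- m)"
    proof (rule sym_finite_support[of _ M'])
      show "smooth_symbol ?b'"
        unfolding smooth_symbol_def
      proof
        fix k show "torus_smooth (?b' k)"
          using smooth_symbolD[OF sm, of k] by (cases "norm (rvec k) < M'") simp_all
      qed
    qed auto
    then obtain C where C: "\<And>k x. norm (?b' k x) \<le> C * bracket k powr (- m)"
      using sym_ord_bound[of ?b' "- m" 0] by auto
    have "norm (?b k x) \<le> (\<bar>C\<bar> + 1 / c) * bracket k powr (- m)" for k x
    proof (cases "norm (rvec k) < M'")
      case True
      have "norm (?b k x) \<le> C * bracket k powr (- m)" using C[of k x] True by simp
      also have "\<dots> \<le> (\<bar>C\<bar> + 1 / c) * bracket k powr (- m)"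
        using lower(1) by (intro mult_right_mono add_increasing2) auto
      finally show ?thesis .
    next
      case False
      then have lb: "c * bracket k powr m \<le> norm (\<sigma> k x)" using lower(2) by simp
      have "norm (?b k x) \<le> 1 / norm (\<sigma> k x)" by (auto simp: norm_divide)
      also have "\<dots> \<le> 1 / (c * bracket k powr m)"
        using lb lower(1) less_le_trans[OF mult_pos_pos[OF lower(1) bracket_powr_pos] lb]
        by (intro divide_left_mono mult_pos_pos) auto
      also have "\<dots> = (1 / c) * bracket k powr (- m)"
        by (simp add: powr_minus divide_inverse)
      also have "\<dots> \<le> (\<bar>C\<bar> + 1 / c) * bracket k powr (- m)"
        by (intro mult_right_mono) auto
      finally show ?thesis .
    qed
    then show ?case unfolding ord_bound.simps by blast
  next
    case (Suc n)
    note ord = Suc.IH sym_ord_bound[OF sym_deriv[OF \<sigma>]] sym_ord_bound[OF sym_diff[OF \<sigma>]]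
      sym_ord_bound[OF sym_const] ord_bound_shift[OF Suc.IH] sym_ord_bound[OF \<phi>]
    note sms = smooth_symbol_mult sm smooth_symbol_deriv smooth_symbol_diff sm\<sigma> smooth_symbol_const
      smooth_symbol_shift[OF sm] sm\<phi>
    have "ord_bound n (0 + ((- m + - m) + (m + \<delta>))) (symbol_deriv j ?b)" for j
      unfolding D by (intro ord_bound_mult ord sms)
    moreover have "ord_bound n (0 + ((- m + - m) + (m - \<rho>))) (symbol_diff j ?b)" for j
      unfolding \<Delta> by (intro ord_bound_add ord_bound_mult ord sms)
    ultimately show ?case using Suc.IH by simp
  qed
  then show ?thesis using sm by (rule symI[rotated])
qed

lemma sym_falling_deriv: "\<sigma> \<in> symb m \<Longrightarrow> (\<lambda>k. falling_deriv j l (\<sigma> k)) \<in> symb (m + \<delta> * real l)"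
proof (induction l)
  case (Suc l)
  then have IH: "(\<lambda>k. falling_deriv j l (\<sigma> k)) \<in> symb (m + \<delta> * real l)" by simp
  have e: "m + \<delta> * real l + \<delta> = m + \<delta> * real (Suc l)" by (simp add: algebra_simps)
  have "(\<lambda>k x. 1 / (2 * of_real pi * \<i>) * symbol_deriv j (\<lambda>k. falling_deriv j l (\<sigma> k)) k x) \<in> symb (m + \<delta> * real (Suc l))"
    using sym_cmult[OF sym_deriv[OF IH], of "1 / (2 * of_real pi * \<i>)" j] unfolding e .
  moreover have "(\<lambda>k x. of_nat l * falling_deriv j l (\<sigma> k) x) \<in> symb (m + \<delta> * real (Suc l))"
    using delta_nonneg by (intro sym_cmult sym_mono[OF IH]) (simp add: algebra_simps)
  ultimately show ?case
    using sym_minus by (fastforce simp: symbol_deriv_def)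
qed simp

lemma sym_falling_derivs:
  fixes \<sigma> :: "'n::{finite,linorder} lattice_symbol"
  assumes "\<sigma> \<in> symb m"
  shows "(\<lambda>k. falling_derivs \<beta> (\<sigma> k)) \<in> symb (m + \<delta> * real (mi_abs \<beta>))"
proof -
  have "(\<lambda>k. foldr (\<lambda>j. falling_deriv j (\<beta> $ j)) js (\<sigma> k)) \<in> symb (m + \<delta> * real (\<Sum>j\<leftarrow>js. \<beta> $ j))" for js
  proof (induction js)
    case (Cons j js)
    from sym_falling_deriv[OF this, of j "\<beta> $ j"] show ?case by (simp add: algebra_simps)
  qed (simp add: assms)
  from this[of "sorted_list_of_set UNIV"] show ?thesis
    by (simp add: falling_derivs_def mi_abs_def sum_list_distinct_conv_sum_set)
qed

lemma sym_difference_funpow: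
  "\<sigma> \<in> symb m \<Longrightarrow> (\<lambda>k x. (difference j ^^ l) (\<lambda>m. \<sigma> m x) k) \<in> symb (m - \<rho> * real l)"
proof (induction l)
  case (Suc l)
  then have "(\<lambda>k x. (difference j ^^ l) (\<lambda>m. \<sigma> m x) k) \<in> symb (m - \<rho> * real l)" by simp
  from sym_diff[OF this, of j] show ?case
    by (simp add: symbol_diff_def[abs_def] difference_def[abs_def] algebra_simps)
qed simp

lemma sym_differences:
  fixes \<sigma> :: "'n::{finite,linorder} lattice_symbol"
  assumes "\<sigma> \<in> symb m"
  shows "(\<lambda>k x. differences \<alpha> (\<lambda>m. \<sigma> m x) k) \<in> symb (m - \<rho> * real (mi_abs \<alpha>))"
proof -
  have "(\<lambda>k x. foldr (\<lambda>j. difference j ^^ (\<alpha> $ j)) js (\<lambda>m. \<sigma> m x) k) \<in> symb (m - \<rho> * real (\<Sum>j\<leftarrow>js. \<alpha> $ j))" for js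
  proof (induction js)
    case (Cons j js)
    from sym_difference_funpow[OF this, of "\<alpha> $ j" j] show ?case by (simp add: algebra_simps)
  qed (simp add: assms)
  from this[of "sorted_list_of_set UNIV"] show ?thesis
    by (simp add: differences_def mi_abs_def sum_list_distinct_conv_sum_set)
qed

end

section \<open>Comparison with the multi-index definition\<close>

lemma mi_abs_add_axis: "mi_abs (\<beta> + axis j 1) = Suc (mi_abs \<beta>)"
proof -
  have "(\<Sum>i\<in>UNIV. axis j (1::nat) $ i) = 1"
    by (simp add: axis_def)
  then show ?thesis by (simp add: mi_abs_def sum.distrib)
qed

lemma difference_commute: "difference i (difference j \<tau>) = difference j (difference i \<tau>)"
  by (rule ext) (simp add: difference_def add_ac)

lemma difference_funpow_commute: "(difference i ^^ l) (difference j \<tau>) = difference j ((difference i ^^ l) \<tau>)"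
  by (induction l) (auto simp: difference_commute)

lemma differences_difference:
  fixes \<tau> :: "int ^ 'n::{finite,linorder} \<Rightarrow> complex"
  shows "differences \<alpha> (difference j \<tau>) = difference j (differences \<alpha> \<tau>)"
proof -
  have "foldr (\<lambda>j. difference j ^^ (\<alpha> $ j)) js (difference j \<tau>)
      = difference j (foldr (\<lambda>j. difference j ^^ (\<alpha> $ j)) js \<tau>)" for js
    by (induction js) (auto simp: difference_funpow_commute)
  then show ?thesis by (simp add: differences_def)
qed

text \<open>Differences commute, so the additional one can be moved out of the ordered product over
  the coordinates.\<close>

lemma differences_add_axis:
  fixes \<tau> :: "int ^ 'n::{finite,linorder} \<Rightarrow> complex"
  shows "differences (\<alpha> + axis j 1) \<tau> = differences \<alpha> (difference j \<tau>)"
proof -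
  have "distinct js \<Longrightarrow> foldr (\<lambda>i. difference i ^^ ((\<alpha> + axis j 1) $ i)) js \<tau> =
      (if j \<in> set js then difference j (foldr (\<lambda>i. difference i ^^ (\<alpha> $ i)) js \<tau>)
       else foldr (\<lambda>i. difference i ^^ (\<alpha> $ i)) js \<tau>)" for js
    by (induction js) (auto simp: axis_def difference_funpow_commute)
  from this[of "sorted_list_of_set UNIV"] show ?thesis
    unfolding differences_difference by (simp add: differences_def)
qed

lemma falling_derivs_0 [simp]: "falling_derivs 0 g = g"
proof -
  have "foldr (\<lambda>j. falling_deriv j 0) js g = g" for js by (induction js) auto
  then show ?thesis by (simp add: falling_derivs_def)
qed

lemma differences_0 [simp]: "differences 0 \<tau> = \<tau>"
proof -
  have "foldr (\<lambda>j. difference j ^^ 0) js \<tau> = \<tau>" for js by (induction js) auto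
  then show ?thesis by (simp add: differences_def)
qed

lemma mi_abs_0 [simp]: "mi_abs 0 = 0"
  by (simp add: mi_abs_def)

lemma smooth_symbol_difference_funpow:
  assumes "smooth_symbol \<sigma>"
  shows "smooth_symbol (\<lambda>k x. (difference i ^^ l) (\<lambda>m. \<sigma> m x) k) \<and>
     symbol_deriv j (\<lambda>k x. (difference i ^^ l) (\<lambda>m. \<sigma> m x) k) = (\<lambda>k x. (difference i ^^ l) (\<lambda>m. symbol_deriv j \<sigma> m x) k)"
proof (induction l)
  case (Suc l)
  have "(\<lambda>k x. (difference i ^^ Suc l) (\<lambda>m. \<sigma> m x) k) = symbol_diff i (\<lambda>k x. (difference i ^^ l) (\<lambda>m. \<sigma> m x) k)"
    for \<sigma> :: "'a lattice_symbol"
    by (intro ext) (simp add: symbol_diff_def difference_def)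
  with Suc show ?case by (simp only: symbol_deriv_diff_commute smooth_symbol_diff)
qed (simp add: assms)

lemma torus_smooth_differences:
  fixes \<sigma> :: "'n::{finite,linorder} lattice_symbol"
  assumes "smooth_symbol \<sigma>"
  shows "torus_smooth (\<lambda>x. differences \<alpha> (\<lambda>m. \<sigma> m x) k)"
    and "partial_deriv j (\<lambda>x. differences \<alpha> (\<lambda>m. \<sigma> m x) k) = (\<lambda>x. differences \<alpha> (\<lambda>m. symbol_deriv j \<sigma> m x) k)"
proof -
  have "smooth_symbol (\<lambda>k x. foldr (\<lambda>j. difference j ^^ (\<alpha> $ j)) js (\<lambda>m. \<sigma> m x) k) \<and>
    symbol_deriv j (\<lambda>k x. foldr (\<lambda>j. difference j ^^ (\<alpha> $ j)) js (\<lambda>m. \<sigma> m x) k)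
      = (\<lambda>k x. foldr (\<lambda>j. difference j ^^ (\<alpha> $ j)) js (\<lambda>m. symbol_deriv j \<sigma> m x) k)" for js
  proof (induction js)
    case (Cons i js)
    then show ?case
      using smooth_symbol_difference_funpow[OF conjunct1[OF Cons], of "\<alpha> $ i" i j] by simp
  qed (simp add: assms)
  from this[of "sorted_list_of_set UNIV"]
  have "smooth_symbol (\<lambda>k x. differences \<alpha> (\<lambda>m. \<sigma> m x) k)"
    "symbol_deriv j (\<lambda>k x. differences \<alpha> (\<lambda>m. \<sigma> m x) k) = (\<lambda>k x. differences \<alpha> (\<lambda>m. symbol_deriv j \<sigma> m x) k)"
    by (simp_all add: differences_def)
  then show "torus_smooth (\<lambda>x. differences \<alpha> (\<lambda>m. \<sigma> m x) k)"
    "partial_deriv j (\<lambda>x. differences \<alpha> (\<lambda>m. \<sigma> m x) k) = (\<lambda>x. differences \<alpha> (\<lambda>m. symbol_deriv j \<sigma> m x) k)"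
    by (auto simp: smooth_symbol_def symbol_deriv_def fun_eq_iff)
qed

text \<open>One inclusion iterates the one-step bounds. For the other, \<open>symbol_class\<close>
  itself is the coinduction invariant: a further difference raises \<alpha>, and a further
  derivative is a falling derivative of the next degree plus a multiple of the present one, whose
  order is lower by \<delta>.\<close>

theorem (in symbol_orders) symbol_class_eq_sym:
  "symbol_class \<rho> \<delta> m = (symb m :: 'n::{finite,linorder} lattice_symbol set)"
proof (intro equalityI subsetI)
  fix \<sigma> :: "'n lattice_symbol" assume \<sigma>: "\<sigma> \<in> symb m"
  have "\<exists>C>0. \<forall>k x. norm (falling_derivs \<beta> (\<lambda>y. differences \<alpha> (\<lambda>m. \<sigma> m y) k) x)
      \<le> C * bracket k powr (m - \<rho> * real (mi_abs \<alpha>) + \<delta> * real (mi_abs \<beta>))" for \<alpha> \<beta>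
    using sym_bound[OF sym_falling_derivs[OF sym_differences[OF \<sigma>]]] .
  then show "\<sigma> \<in> symbol_class \<rho> \<delta> m"
    using sym_smooth[OF \<sigma>] by (simp add: symbol_class_def smooth_symbol_def)
next
  fix \<sigma> :: "'n lattice_symbol" assume \<sigma>: "\<sigma> \<in> symbol_class \<rho> \<delta> m"
  show "\<sigma> \<in> symb m"
  proof (rule sym_coinduct[of "\<lambda>m \<sigma>. \<sigma> \<in> symbol_class \<rho> \<delta> m", OF \<sigma>])
    fix m and \<sigma> :: "'n lattice_symbol" assume \<sigma>: "\<sigma> \<in> symbol_class \<rho> \<delta> m"
    show sm: "smooth_symbol \<sigma>" using \<sigma> by (simp add: symbol_class_def smooth_symbol_def)
    have bd: "\<exists>C>0. \<forall>k x. norm (falling_derivs \<beta> (\<lambda>y. differences \<alpha> (\<lambda>m. \<sigma> m y) k) x)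
      \<le> C * bracket k powr (m - \<rho> * real (mi_abs \<alpha>) + \<delta> * real (mi_abs \<beta>))" for \<alpha> \<beta>
      using \<sigma> unfolding symbol_class_def by blast
    show "\<exists>C. \<forall>k x. norm (\<sigma> k x) \<le> C * bracket k powr m"
      using bd[of 0 0] by auto
    fix j
    have "\<exists>C>0. \<forall>k x. norm (falling_derivs \<beta> (\<lambda>y. differences \<alpha> (\<lambda>m. symbol_diff j \<sigma> m y) k) x)
      \<le> C * bracket k powr (m - \<rho> - \<rho> * real (mi_abs \<alpha>) + \<delta> * real (mi_abs \<beta>))" for \<alpha> \<beta>
    proof -
      have "(\<lambda>m. symbol_diff j \<sigma> m y) = difference j (\<lambda>m. \<sigma> m y)" for y
        by (rule ext) (simp add: symbol_diff_def difference_def)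
      then show ?thesis
        using bd[of \<beta> "\<alpha> + axis j 1"] by (simp add: differences_add_axis mi_abs_add_axis algebra_simps del: One_nat_def)
    qed
    then show "symbol_diff j \<sigma> \<in> symbol_class \<rho> \<delta> (m - \<rho>)"
      using smooth_symbol_diff[OF sm] by (simp add: symbol_class_def smooth_symbol_def)
    have "\<exists>C>0. \<forall>k x. norm (falling_derivs \<beta> (\<lambda>y. differences \<alpha> (\<lambda>m. symbol_deriv j \<sigma> m y) k) x)
      \<le> C * bracket k powr (m + \<delta> - \<rho> * real (mi_abs \<alpha>) + \<delta> * real (mi_abs \<beta>))" for \<alpha> \<beta>
    proof -
      let ?g = "\<lambda>k y. differences \<alpha> (\<lambda>m. \<sigma> m y) k"
      let ?o = "m + \<delta> - \<rho> * real (mi_abs \<alpha>) + \<delta> * real (mi_abs \<beta>)"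
      obtain C where C: "C > 0" "\<And>k x. norm (falling_derivs (\<beta> + axis j 1) (?g k) x) \<le> C * bracket k powr ?o"
        using bd[of "\<beta> + axis j 1" \<alpha>] by (auto simp: mi_abs_add_axis algebra_simps simp del: One_nat_def)
      obtain D where D: "D > 0" "\<And>k x. norm (falling_derivs \<beta> (?g k) x) \<le> D * bracket k powr (?o - \<delta>)"
        using bd[of \<beta> \<alpha>] by (auto simp: algebra_simps)
      have "norm (falling_derivs \<beta> (\<lambda>y. differences \<alpha> (\<lambda>m. symbol_deriv j \<sigma> m y) k) x)
        \<le> (2 * pi * C + 2 * pi * real (\<beta> $ j) * D) * bracket k powr ?o" for k x
      proof -
        have "falling_derivs \<beta> (\<lambda>y. differences \<alpha> (\<lambda>m. symbol_deriv j \<sigma> m y) k) x = falling_derivs \<beta> (partial_deriv j (?g k)) x"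
          by (simp add: torus_smooth_differences(2)[OF sm])
        also have "norm \<dots> \<le> 2 * pi * norm (falling_derivs (\<beta> + axis j 1) (?g k) x)
            + 2 * pi * real (\<beta> $ j) * norm (falling_derivs \<beta> (?g k) x)"
          unfolding partial_deriv_falling_derivs[OF torus_smooth_differences(1)[OF sm]]
          by (rule order_trans[OF norm_triangle_ineq]) (simp add: norm_mult)
        also have "\<dots> \<le> 2 * pi * (C * bracket k powr ?o) + 2 * pi * real (\<beta> $ j) * (D * bracket k powr ?o)"
          using D(1) delta_nonneg
          by (intro add_mono mult_left_mono C order_trans[OF D(2)] bracket_powr_mono) auto
        finally show ?thesis by (simp add: algebra_simps)
      qed
      then show ?thesis
        using C(1) D(1) by (intro exI[of _ "2 * pi * C + 2 * pi * real (\<beta> $ j) * D"]) (auto intro!: add_pos_nonneg)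
    qed
    then show "symbol_deriv j \<sigma> \<in> symbol_class \<rho> \<delta> (m + \<delta>)"
      using smooth_symbol_deriv[OF sm] by (simp add: symbol_class_def smooth_symbol_def)
  qed
qed

section \<open>Asymptotic sums\<close>

context symbol_orders begin

text \<open>Only x-derivatives are counted, but with one explicit constant for all of them: infinite
  sums need control of the constants, and a sum whose range depends on \<open>k\<close> can be
  differentiated in \<open>x\<close> term by term but not differenced in \<open>k\<close>.\<close>

primrec x_bound :: "nat \<Rightarrow> real \<Rightarrow> real \<Rightarrow> 'n::finite lattice_symbol \<Rightarrow> bool" where
  "x_bound 0 K m \<sigma> \<longleftrightarrow> (\<forall>k x. norm (\<sigma> k x) \<le> K * bracket k powr m)"
| "x_bound (Suc n) K m \<sigma> \<longleftrightarrow> x_bound n K m \<sigma> \<and> (\<forall>j. x_bound n K (m + \<delta>) (symbol_deriv j \<sigma>))"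

lemma x_bound_mono: "x_bound n K m \<sigma> \<Longrightarrow> K \<le> K' \<Longrightarrow> 0 \<le> K' \<Longrightarrow> m \<le> m' \<Longrightarrow> x_bound n K' m' \<sigma>"
proof (induction n arbitrary: m m' \<sigma>)
  case 0
  have "norm (\<sigma> k x) \<le> K' * bracket k powr m'" for k x
  proof -
    have "norm (\<sigma> k x) \<le> K * bracket k powr m" using 0 by simp
    also have "\<dots> \<le> K' * bracket k powr m'" using 0 by (intro mult_mono bracket_powr_mono) auto
    finally show ?thesis .
  qed
  then show ?case by simp
next
  case (Suc n)
  have "m + \<delta> \<le> m' + \<delta>" using Suc.prems by simp
  from Suc.IH[OF _ Suc.prems(2,3) this] Suc.IH[OF _ Suc.prems(2,3,4)] Suc.prems(1) show ?case by simp
qed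

lemma x_bound_le: "x_bound n' K m \<sigma> \<Longrightarrow> n \<le> n' \<Longrightarrow> x_bound n K m \<sigma>"
proof (induction n' arbitrary: n)
  case (Suc n')
  then show ?case by (cases "n = Suc n'") auto
qed simp

definition x_order :: "nat \<Rightarrow> real \<Rightarrow> 'n::finite lattice_symbol \<Rightarrow> bool" where
  "x_order n m \<sigma> \<longleftrightarrow> (\<exists>K\<ge>0. x_bound n K m \<sigma>)"

lemma x_order_0: "x_order 0 m \<sigma> \<longleftrightarrow> (\<exists>K. \<forall>k x. norm (\<sigma> k x) \<le> K * bracket k powr m)"
  unfolding x_order_def
proof
  assume "\<exists>K. \<forall>k x. norm (\<sigma> k x) \<le> K * bracket k powr m"
  then obtain K where "x_bound 0 K m \<sigma>" by auto
  then have "x_bound 0 \<bar>K\<bar> m \<sigma>" by (rule x_bound_mono) auto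
  then show "\<exists>K\<ge>0. x_bound 0 K m \<sigma>" by (metis abs_ge_zero)
qed auto

lemma x_order_Suc:
  "x_order (Suc n) m \<sigma> \<longleftrightarrow> x_order n m \<sigma> \<and> (\<forall>j. x_order n (m + \<delta>) (symbol_deriv j \<sigma>))"
proof
  assume "x_order n m \<sigma> \<and> (\<forall>j. x_order n (m + \<delta>) (symbol_deriv j \<sigma>))"
  then obtain K L where K: "0 \<le> K" "x_bound n K m \<sigma>"
    and L: "\<And>j. 0 \<le> L j" "\<And>j. x_bound n (L j) (m + \<delta>) (symbol_deriv j \<sigma>)"
    unfolding x_order_def by metis
  \<comment> \<open>A single constant must serve the symbol and all of its first derivatives; there
    are only finitely many directions.\<close>
  define B where "B = K + (\<Sum>j\<in>UNIV. L j)"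
  have "K \<le> B" "0 \<le> B" using K L by (auto simp: B_def sum_nonneg)
  moreover have "L j \<le> B" for j
    unfolding B_def using K(1) L(1) by (intro add_increasing member_le_sum) auto
  ultimately have "x_bound (Suc n) B m \<sigma>"
    using K(2) L(2) by (auto intro: x_bound_mono)
  with \<open>0 \<le> B\<close> show "x_order (Suc n) m \<sigma>" unfolding x_order_def by blast
qed (auto simp: x_order_def)

lemma ord_bound_imp_x_order: "ord_bound n m \<sigma> \<Longrightarrow> x_order n m \<sigma>"
  by (induction n arbitrary: m \<sigma>) (auto simp: x_order_0 x_order_Suc)

lemma x_order_add:
  "x_order n m \<sigma> \<Longrightarrow> x_order n m \<tau> \<Longrightarrow> smooth_symbol \<sigma> \<Longrightarrow> smooth_symbol \<tau> \<Longrightarrow>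
    x_order n m (\<lambda>k x. \<sigma> k x + \<tau> k x)"
proof (induction n arbitrary: m \<sigma> \<tau>)
  case 0
  then show ?case unfolding x_order_0
    using ord_bound_add[of 0 m \<sigma> \<tau>] by simp
qed (auto simp: x_order_Suc symbol_deriv_add smooth_symbol_deriv)

lemma x_order_uminus:
  "x_order n m \<sigma> \<Longrightarrow> smooth_symbol \<sigma> \<Longrightarrow> x_order n m (\<lambda>k x. - \<sigma> k x)"
proof (induction n arbitrary: m \<sigma>)
  case (Suc n)
  have "symbol_deriv j (\<lambda>k x. - \<sigma> k x) = (\<lambda>k x. - symbol_deriv j \<sigma> k x)" for j
    using symbol_deriv_minus[OF smooth_symbol_const[of 0] Suc.prems(2), of j] by simp
  with Suc show ?case by (simp add: x_order_Suc smooth_symbol_deriv)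
qed (auto simp: x_order_0)

lemma x_order_shift: "x_order n m \<sigma> \<Longrightarrow> x_order n m (\<lambda>k. \<sigma> (k + axis j 1))"
proof (induction n arbitrary: m \<sigma>)
  case 0
  then show ?case unfolding x_order_0
    using ord_bound_shift[of 0 m \<sigma>] by simp
qed (auto simp: x_order_Suc symbol_deriv_shift)

text \<open>The triangle inequality alone: no gain from the difference is claimed, since the
  remainders to be treated come without difference estimates.\<close>

lemma x_order_diff:
  assumes "x_order n m \<sigma>" "smooth_symbol \<sigma>"
  shows "x_order n m (symbol_diff j \<sigma>)"
proof -
  have "x_order n m (\<lambda>k x. \<sigma> (k + axis j 1) x + - \<sigma> k x)"
    using assms smooth_symbol_minus[OF smooth_symbol_const[of 0] assms(2)]
    by (intro x_order_add x_order_uminus x_order_shift[OF assms(1)] smooth_symbol_shift[OF assms(2)]) auto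
  then show ?thesis by (simp add: symbol_diff_def[abs_def])
qed

text \<open>Differences need not gain: each of at most \<open>n\<close> of them costs at most \<open>\<rho>\<close> in the order.\<close>

lemma x_order_imp_ord_bound:
  "x_order n m \<sigma> \<Longrightarrow> smooth_symbol \<sigma> \<Longrightarrow> ord_bound n (m + \<rho> * real n) \<sigma>"
proof (induction n arbitrary: m \<sigma>)
  case 0
  then show ?case by (simp add: x_order_0)
next
  case (Suc n)
  have "ord_bound n (m + \<rho> * real n) \<sigma>" "ord_bound n (m + \<delta> + \<rho> * real n) (symbol_deriv j \<sigma>)" for j
    using Suc by (auto simp: x_order_Suc smooth_symbol_deriv)
  moreover have "ord_bound n (m + \<rho> * real n) (symbol_diff j \<sigma>)" for j
    using Suc by (auto simp: x_order_Suc smooth_symbol_diff x_order_diff)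
  ultimately have "ord_bound n (m + \<rho> * real (Suc n)) \<sigma>"
      "ord_bound n (m + \<rho> * real (Suc n) + \<delta>) (symbol_deriv j \<sigma>)"
      "ord_bound n (m + \<rho> * real (Suc n) - \<rho>) (symbol_diff j \<sigma>)" for j
    using rho_pos by (auto intro: ord_bound_mono[of n "m + \<rho> * real n"] ord_bound_mono[of n "m + \<delta> + \<rho> * real n"] simp: distrib_left)
  then show ?case by simp
qed

text \<open>
  The remainder \<open>R N\<close> may lose a fixed amount \<open>c\<close> of decay, since \<open>R N\<close> and \<open>R N'\<close> with \<open>N'\<close> large
  differ by symbols of the right order.
\<close>

lemma sym_remainder:
  fixes R :: "nat \<Rightarrow> 'n::finite lattice_symbol"
  assumes sm: "\<And>N. smooth_symbol (R N)"
    and step: "\<And>N. (\<lambda>k x. R N k x - R (Suc N) k x) \<in> symb (m - (\<rho> - \<delta>) * real N)"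
    and crude: "\<And>n N. n \<le> N \<Longrightarrow> x_order n (m - (\<rho> - \<delta>) * real N + c) (R N)"
  shows "R N \<in> symb (m - (\<rho> - \<delta>) * real N)"
proof (rule symI[OF sm])
  fix n
  \<comment> \<open>\<open>d\<close> further steps of size \<open>\<rho> - \<delta>\<close> pay for
    the loss \<open>c\<close> and for the gain that up to \<open>n\<close> differences fail to
    bring; the summand \<open>n\<close> in \<open>N'\<close> meets the condition
    \<open>n \<le> N'\<close> of the crude bound.\<close>
  obtain d :: nat where d: "(c + \<rho> * real n) / (\<rho> - \<delta>) \<le> real d" using real_arch_simple by blast
  define N' where "N' = N + n + d"
  have "ord_bound n ((m - (\<rho> - \<delta>) * real N' + c) + \<rho> * real n) (R N')"
    by (intro x_order_imp_ord_bound crude sm) (simp add: N'_def)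
  moreover have "(m - (\<rho> - \<delta>) * real N' + c) + \<rho> * real n \<le> m - (\<rho> - \<delta>) * real N"
  proof -
    have "c + \<rho> * real n \<le> (\<rho> - \<delta>) * real d"
      using d eps_pos by (simp add: pos_divide_le_eq mult.commute)
    moreover have "0 \<le> (\<rho> - \<delta>) * real n" using eps_pos by simp
    moreover have "(\<rho> - \<delta>) * real N' = (\<rho> - \<delta>) * real N + (\<rho> - \<delta>) * real n + (\<rho> - \<delta>) * real d"
      by (simp add: N'_def distrib_left)
    ultimately show ?thesis by linarith
  qed
  ultimately have 1: "ord_bound n (m - (\<rho> - \<delta>) * real N) (R N')" by (rule ord_bound_mono)
  let ?S = "\<lambda>k x. \<Sum>i\<in>{N..<N'}. R i k x - R (Suc i) k x"
  have 2: "?S \<in> symb (m - (\<rho> - \<delta>) * real N)"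
  proof (rule sym_sum)
    fix i assume "i \<in> {N..<N'}"
    then show "(\<lambda>k x. R i k x - R (Suc i) k x) \<in> symb (m - (\<rho> - \<delta>) * real N)"
      using eps_pos by (intro sym_mono[OF step]) auto
  qed
  have "R N = (\<lambda>k x. R N' k x + ?S k x)"
  proof (intro ext)
    fix k x
    show "R N k x = R N' k x + ?S k x"
      using sum_Suc_diff'[of N N' "\<lambda>i. - R i k x"] by (simp add: N'_def)
  qed
  then show "ord_bound n (m - (\<rho> - \<delta>) * real N) (R N)"
    using ord_bound_add[OF 1 sym_ord_bound[OF 2] sm sym_smooth[OF 2]] by simp
qed

lemma smooth_symbol_if: "smooth_symbol \<sigma> \<Longrightarrow> smooth_symbol (\<lambda>k x. if P k then \<sigma> k x else 0)"
  unfolding smooth_symbol_def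
proof
  fix k assume "\<forall>k. torus_smooth (\<sigma> k)"
  then show "torus_smooth (\<lambda>x. if P k then \<sigma> k x else 0)" by (cases "P k") simp_all
qed

lemma symbol_deriv_if:
  "symbol_deriv j (\<lambda>k x. if P k then \<sigma> k x else 0) = (\<lambda>k x. if P k then symbol_deriv j \<sigma> k x else 0)"
proof
  fix k show "symbol_deriv j (\<lambda>k x. if P k then \<sigma> k x else 0) k = (\<lambda>x. if P k then symbol_deriv j \<sigma> k x else 0)"
    by (cases "P k") (simp_all add: symbol_deriv_def)
qed

text \<open>Where \<open>K \<le> L * bracket k powr e\<close>, the constant \<open>K\<close> may be
  exchanged for \<open>L\<close> at the price of \<open>e\<close> orders. The cutoff depends on
  \<open>k\<close> alone and so commutes with x-derivatives.\<close>

lemma x_bound_cutoff: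
  assumes "\<And>k. P k \<Longrightarrow> K \<le> L * bracket k powr e" "0 \<le> L"
  shows "x_bound n K m \<sigma> \<Longrightarrow> x_bound n L (m + e) (\<lambda>k x. if P k then \<sigma> k x else 0)"
proof (induction n arbitrary: m \<sigma>)
  case 0
  have "norm (\<sigma> k x) \<le> L * bracket k powr (m + e)" if "P k" for k x
  proof -
    have "norm (\<sigma> k x) \<le> K * bracket k powr m" using 0 by simp
    also have "\<dots> \<le> (L * bracket k powr e) * bracket k powr m"
      using assms(1)[OF that] by (intro mult_right_mono) auto
    finally show ?thesis by (simp add: powr_add mult_ac)
  qed
  with assms(2) show ?case by simp
next
  case (Suc n)
  have "x_bound n L (m + e + \<delta>) (\<lambda>k x. if P k then symbol_deriv j \<sigma> k x else 0)" for j
    using Suc.IH[of "m + \<delta>" "symbol_deriv j \<sigma>"] Suc.prems by (simp add: add_ac)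
  with Suc show ?case by (simp add: symbol_deriv_if)
qed

lemma symbol_deriv_local_sum:
  fixes \<sigma> :: "nat \<Rightarrow> 'n::finite lattice_symbol"
  assumes "\<And>j. smooth_symbol (\<sigma> j)"
  shows "symbol_deriv i (\<lambda>k x. \<Sum>j\<in>I k. \<sigma> j k x) = (\<lambda>k x. \<Sum>j\<in>I k. symbol_deriv i (\<sigma> j) k x)"
  using assms by (simp add: symbol_deriv_def[abs_def] partial_deriv_sum smooth_symbol_differentiable)

text \<open>The index set may vary with \<open>k\<close> because for each fixed \<open>k\<close> it
  is just a finite sum of functions of \<open>x\<close>.\<close>

lemma x_bound_local_sum:
  fixes \<sigma> :: "nat \<Rightarrow> 'n::finite lattice_symbol"
  assumes "\<And>k. (\<Sum>j\<in>I k. b j) \<le> B"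
  shows "(\<And>j k. j \<in> I k \<Longrightarrow> x_bound n (b j) m (\<sigma> j)) \<Longrightarrow> (\<And>j. smooth_symbol (\<sigma> j)) \<Longrightarrow>
    x_bound n B m (\<lambda>k x. \<Sum>j\<in>I k. \<sigma> j k x)"
proof (induction n arbitrary: m \<sigma>)
  case 0
  have "norm (\<Sum>j\<in>I k. \<sigma> j k x) \<le> B * bracket k powr m" for k x
  proof -
    have "norm (\<Sum>j\<in>I k. \<sigma> j k x) \<le> (\<Sum>j\<in>I k. b j * bracket k powr m)"
      using 0 by (intro sum_norm_le) auto
    also have "\<dots> \<le> B * bracket k powr m"
      unfolding sum_distrib_right[symmetric] using assms by (intro mult_right_mono) auto
    finally show ?thesis .
  qed
  then show ?case by simp
next
  case (Suc n)
  then show ?case by (simp add: symbol_deriv_local_sum smooth_symbol_deriv)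
qed

text \<open>Borel summation: each term is cut off where its constant has become summably small
  relative to one step \<open>\<rho> - \<delta>\<close> of the order. The tails then lose exactly
  that step, which \<open>sym_remainder\<close> repairs.\<close>

theorem asymptotic_sum_exists:
  fixes \<sigma> :: "nat \<Rightarrow> 'n::finite lattice_symbol"
  assumes \<sigma>: "\<And>j. \<sigma> j \<in> symb (m - (\<rho> - \<delta>) * real j)"
  shows "\<exists>\<tau> \<in> symb m. \<forall>N. (\<lambda>k x. \<tau> k x - (\<Sum>j<N. \<sigma> j k x)) \<in> symb (m - (\<rho> - \<delta>) * real N)"
proof -
  define e where "e = \<rho> - \<delta>"
  have e: "e > 0" using eps_pos by (simp add: e_def)
  have sm: "smooth_symbol (\<sigma> j)" for j using sym_smooth[OF \<sigma>] .
  have "x_order j (m - e * real j) (\<sigma> j)" for j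
    unfolding e_def by (intro ord_bound_imp_x_order sym_ord_bound \<sigma>)
  \<comment> \<open>\<open>K j\<close> controls only the first \<open>j\<close> derivatives of
    \<open>\<sigma> j\<close>. A fixed number \<open>n\<close> of derivatives is thus covered for
    all \<open>j \<ge> n\<close>, that is, in every tail starting at some
    \<open>N \<ge> n\<close>.\<close>
  then obtain K where K: "\<And>j. 0 \<le> K j" "\<And>j. x_bound j (K j) (m - e * real j) (\<sigma> j)"
    unfolding x_order_def by metis
  \<comment> \<open>The first condition permits replacing \<open>K j\<close> by
    \<open>(1/2) ^ j\<close> at the cost of \<open>e\<close> orders; the second leaves finitely many
    terms at each \<open>k\<close>.\<close>
  define P where "P j k \<longleftrightarrow> K j * 2 ^ j \<le> bracket k powr e \<and> real j \<le> bracket k" for j and k :: "int ^ 'n"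
  define \<tau> where "\<tau> j k x = (if P j k then \<sigma> j k x else 0)" for j k x
  \<comment> \<open>Beyond the upper limit \<open>real j \<le> bracket k\<close> fails, so no
    nonzero \<open>\<tau> j k x\<close> is lost.\<close>
  define T where "T N k x = (\<Sum>j\<in>{N..nat \<lfloor>bracket k\<rfloor>}. \<tau> j k x)" for N k x
  have sm\<tau>: "smooth_symbol (\<tau> j)" for j unfolding \<tau>_def[abs_def] by (intro smooth_symbol_if sm)
  have "\<exists>R. \<forall>k. R \<le> norm (rvec k) \<longrightarrow> P j k" for j
  proof (intro exI allI impI)
    fix k :: "int ^ 'n" assume R: "max (real j) ((K j * 2 ^ j) powr (1 / e)) \<le> norm (rvec k)"
    then have "(K j * 2 ^ j) powr (1 / e) \<le> bracket k" by (simp add: bracket_def)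
    then have "((K j * 2 ^ j) powr (1 / e)) powr e \<le> bracket k powr e"
      using e by (intro powr_mono2) auto
    then have "K j * 2 ^ j \<le> bracket k powr e" using e K(1)[of j] by (simp add: powr_powr powr_one)
    with R show "P j k" by (simp add: P_def bracket_def)
  qed
  then obtain R where R: "\<And>j k. R j \<le> norm (rvec k) \<Longrightarrow> P j k" by metis
  have fs: "(\<lambda>k x. \<tau> j k x - \<sigma> j k x) \<in> symb l" for j l
    by (rule sym_finite_support[of _ "R j"]) (intro smooth_symbol_minus sm sm\<tau>, simp add: \<tau>_def R)
  have \<tau>: "\<tau> j \<in> symb (m - e * real j)" for j
    using sym_add[OF fs \<sigma>, of j j] by (simp add: e_def)
  have half: "x_bound j ((1/2) ^ j) (m - e * real j + e) (\<tau> j)" for j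
    unfolding \<tau>_def[abs_def]
  proof (rule x_bound_cutoff[OF _ _ K(2)])
    fix k assume "P j k"
    then show "K j \<le> (1/2) ^ j * bracket k powr e" by (simp add: P_def field_simps)
  qed auto
  have Tsm: "smooth_symbol (T N)" for N
    using sm\<tau> by (simp add: smooth_symbol_def T_def[abs_def] torus_smooth_sum)
  have Tstep: "(\<lambda>k x. T N k x - T (Suc N) k x) = \<tau> N" for N
  proof (intro ext)
    fix k x
    show "T N k x - T (Suc N) k x = \<tau> N k x"
    proof (cases "N \<le> nat \<lfloor>bracket k\<rfloor>")
      case True
      then have "{N..nat \<lfloor>bracket k\<rfloor>} = insert N {Suc N..nat \<lfloor>bracket k\<rfloor>}" by auto
      then show ?thesis by (simp add: T_def)
    next
      case False
      then have "\<not> P N k" by (simp add: P_def) linarith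
      with False show ?thesis by (simp add: T_def \<tau>_def)
    qed
  qed
  have T: "T N \<in> symb (m - e * real N)" for N
    unfolding e_def
  proof (rule sym_remainder[where c = e])
    show "smooth_symbol (T N)" for N by (rule Tsm)
    show "(\<lambda>k x. T N k x - T (Suc N) k x) \<in> symb (m - (\<rho> - \<delta>) * real N)" for N
      unfolding Tstep using \<tau>[of N] by (simp add: e_def)
    fix n N :: nat assume nN: "n \<le> N"
    have "x_bound n 2 (m - e * real N + e) (T N)"
      unfolding T_def[abs_def]
    proof (rule x_bound_local_sum)
      fix k :: "int ^ 'n"
      have "(\<Sum>j\<in>{N..nat \<lfloor>bracket k\<rfloor>}. (1/2) ^ j) \<le> (\<Sum>j. (1/2 :: real) ^ j)"
        by (intro sum_le_suminf) auto
      then show "(\<Sum>j\<in>{N..nat \<lfloor>bracket k\<rfloor>}. (1/2) ^ j) \<le> (2 :: real)"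
        by (simp add: suminf_geometric)
    next
      fix j k assume "j \<in> {N..nat \<lfloor>bracket (k :: int ^ 'n)\<rfloor>}"
      then show "x_bound n ((1/2) ^ j) (m - e * real N + e) (\<tau> j)"
        using nN e by (intro x_bound_mono[OF x_bound_le[OF half]]) auto
    qed (rule sm\<tau>)
    then show "x_order n (m - (\<rho> - \<delta>) * real N + e) (T N)"
      unfolding x_order_def e_def[symmetric] by (intro exI[of _ 2]) simp
  qed
  have "(\<lambda>k x. T 0 k x - (\<Sum>j<N. \<sigma> j k x)) \<in> symb (m - (\<rho> - \<delta>) * real N)" for N
  proof -
    have "T 0 k x - (\<Sum>j<N. \<sigma> j k x) = T N k x + (\<Sum>j<N. \<tau> j k x - \<sigma> j k x)" for k x
    proof -
      have "(\<Sum>j<N. \<tau> j k x) = (\<Sum>j<N. T j k x - T (Suc j) k x)"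
        using fun_cong[OF fun_cong[OF Tstep]] by (intro sum.cong) auto
      also have "\<dots> = T 0 k x - T N k x" by (induction N) simp_all
      finally show ?thesis by (simp add: sum_subtractf)
    qed
    then show ?thesis
      using sym_add[OF T[of N] sym_sum[of "{..<N}" "\<lambda>j k x. \<tau> j k x - \<sigma> j k x", OF fs]] by (simp add: e_def)
  qed
  moreover have "T 0 \<in> symb m" using T[of 0] by simp
  ultimately show ?thesis by blast
qed

end

section \<open>Fourier series and composition of symbols\<close>

context symbol_orders begin

text \<open>Every power of \<open>bracket p\<close> is bought by one integration by parts, hence by
  one x-derivative, which raises the order in \<open>k\<close> by \<delta>.\<close>

lemma fourier_coeff_decay:
  fixes \<sigma> :: "'n::finite lattice_symbol"
  shows "\<sigma> \<in> symb m \<Longrightarrow>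
    \<exists>C\<ge>0. \<forall>k p. norm (fourier_coeff (\<sigma> k) p) * bracket p ^ M \<le> C * bracket k powr (m + \<delta> * real M)"
proof (induction M arbitrary: m \<sigma>)
  case 0
  obtain C where C: "C > 0" "\<And>k x. norm (\<sigma> k x) \<le> C * bracket k powr m"
    using sym_bound[OF 0] by blast
  have "norm (fourier_coeff (\<sigma> k) p) \<le> C * bracket k powr m" for k p
    using smooth_symbolD[OF sym_smooth[OF 0], of k] C(2) by (intro norm_fourier_coeff_le torus_smooth_continuous) auto
  with C(1) show ?case by (intro exI[of _ C]) auto
next
  case (Suc M)
  have e: "m + \<delta> * real (Suc M) = m + \<delta> + \<delta> * real M" by (simp add: algebra_simps)
  obtain C where C: "C \<ge> 0" "\<And>k p. norm (fourier_coeff (\<sigma> k) p) * bracket p ^ M \<le> C * bracket k powr (m + \<delta> * real M)"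
    using Suc.IH[OF Suc.prems] by blast
  have "\<forall>j. \<exists>D\<ge>0. \<forall>k p. norm (fourier_coeff (symbol_deriv j \<sigma> k) p) * bracket p ^ M \<le> D * bracket k powr (m + \<delta> * real (Suc M))"
    unfolding e using Suc.IH[OF sym_deriv[OF Suc.prems]] by blast
  then obtain D where D: "\<And>j. D j \<ge> 0"
    "\<And>j k p. norm (fourier_coeff (symbol_deriv j \<sigma> k) p) * bracket p ^ M \<le> D j * bracket k powr (m + \<delta> * real (Suc M))"
    by metis
  have "norm (fourier_coeff (\<sigma> k) p) * bracket p ^ Suc M \<le> (C + (\<Sum>j\<in>UNIV. D j)) * bracket k powr (m + \<delta> * real (Suc M))" for k p
  proof -
    let ?c = "norm (fourier_coeff (\<sigma> k) p)"
    have d: "\<bar>real_of_int (p $ j)\<bar> * ?c \<le> norm (fourier_coeff (symbol_deriv j \<sigma> k) p)" for j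
    proof -
      have "norm (fourier_coeff (symbol_deriv j \<sigma> k) p) = 2 * pi * (\<bar>real_of_int (p $ j)\<bar> * ?c)"
        using fourier_coeff_partial_deriv[OF smooth_symbolD[OF sym_smooth[OF Suc.prems]]]
        by (simp add: symbol_deriv_def norm_mult)
      moreover have "1 * (\<bar>real_of_int (p $ j)\<bar> * ?c) \<le> 2 * pi * (\<bar>real_of_int (p $ j)\<bar> * ?c)"
        using pi_gt3 by (intro mult_right_mono) auto
      ultimately show ?thesis by simp
    qed
    have "?c * bracket p ^ Suc M = (bracket p * ?c) * bracket p ^ M" by simp
    also have "\<dots> \<le> ((1 + (\<Sum>j\<in>UNIV. \<bar>real_of_int (p $ j)\<bar>)) * ?c) * bracket p ^ M"
      by (intro mult_right_mono bracket_le_sum) auto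
    also have "\<dots> = ?c * bracket p ^ M + (\<Sum>j\<in>UNIV. (\<bar>real_of_int (p $ j)\<bar> * ?c) * bracket p ^ M)"
      by (simp add: distrib_right sum_distrib_right)
    also have "\<dots> \<le> C * bracket k powr (m + \<delta> * real M)
        + (\<Sum>j\<in>UNIV. norm (fourier_coeff (symbol_deriv j \<sigma> k) p) * bracket p ^ M)"
      by (intro add_mono C sum_mono mult_right_mono d) auto
    also have "\<dots> \<le> C * bracket k powr (m + \<delta> * real (Suc M)) + (\<Sum>j\<in>UNIV. D j * bracket k powr (m + \<delta> * real (Suc M)))"
      using delta_nonneg C(1) by (intro add_mono sum_mono D mult_left_mono bracket_powr_mono) (auto simp: algebra_simps)
    finally show ?thesis by (simp add: distrib_right sum_distrib_right)
  qed
  moreover have "0 \<le> C + (\<Sum>j\<in>UNIV. D j)" using C(1) D(1) by (simp add: sum_nonneg)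
  ultimately show ?case by blast
qed

lemma sym_torus_function: "torus_smooth g \<Longrightarrow> (\<lambda>k. g) \<in> symb 0"
proof -
  assume g: "torus_smooth g"
  let ?X = "\<lambda>(m::real) \<sigma>. (\<exists>g. torus_smooth g \<and> \<sigma> = (\<lambda>k. g) \<and> (0 \<le> m \<or> g = (\<lambda>x. 0)))"
  show ?thesis
  proof (rule sym_coinduct[of ?X])
    show "?X 0 (\<lambda>k. g)" using g by auto
    fix m :: real and \<sigma> :: "'a lattice_symbol" assume "?X m \<sigma>"
    then obtain g where g: "torus_smooth g" "\<sigma> = (\<lambda>k. g)" "0 \<le> m \<or> g = (\<lambda>x. 0)" by blast
    then show "smooth_symbol \<sigma>" by (simp add: smooth_symbol_def)
    obtain B where B: "\<And>x. norm (g x) \<le> B" using torus_smooth_bounded[OF g(1)] by blast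
    have B0: "0 \<le> B" using order_trans[OF norm_ge_zero B] .
    have "norm (g x) \<le> B * bracket k powr m" for k :: "int ^ 'a" and x
    proof (cases "0 \<le> m")
      case True
      have "norm (g x) \<le> B * 1" using B by simp
      also have "\<dots> \<le> B * bracket k powr m"
        using True B0 by (intro mult_left_mono ge_one_powr_ge_zero bracket_ge_1)
      finally show ?thesis .
    qed (use g B0 in auto)
    with g show "\<exists>C. \<forall>k x. norm (\<sigma> k x) \<le> C * bracket k powr m" by auto
    show "?X (m + \<delta>) (symbol_deriv j \<sigma>)" for j
      using g delta_nonneg
      by (intro exI[of _ "partial_deriv j g"]) (auto simp: symbol_deriv_def[abs_def] torus_smooth_partial_deriv)
    show "?X (m - \<rho>) (symbol_diff j \<sigma>)" for j
      using g by (intro exI[of _ "\<lambda>x. 0"]) (auto simp: symbol_diff_def[abs_def])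
  qed
qed

end

text \<open>A function on the torus is treated as a symbol constant in \<open>k\<close>, in the
  calculus with \<rho> = 1 and \<delta> = 0; at \<open>k = 0\<close> the bracket is 1.\<close>

lemma fourier_coeff_rapid:
  fixes g :: "real ^ 'n::finite \<Rightarrow> complex"
  assumes "torus_smooth g"
  shows "\<exists>C\<ge>0. \<forall>p. norm (fourier_coeff g p) \<le> C / bracket p ^ M"
proof -
  interpret symbol_orders 1 0 by unfold_locales auto
  obtain C where "C \<ge> 0" "\<And>k p. norm (fourier_coeff g p) * bracket p ^ M \<le> C * bracket (k :: int ^ 'n) powr (0 + 0 * real M)"
    using fourier_coeff_decay[OF sym_torus_function[OF assms]] by blast
  from this(1) this(2)[of _ 0] show ?thesis by (auto simp: pos_le_divide_eq)
qed

lemma summable_on_const_bracket: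
  "(\<lambda>p :: int ^ 'n::finite. C / bracket p ^ (2 * CARD('n))) summable_on UNIV"
  using summable_on_cmult_right[OF summable_on_bracket, of C] by simp

lemma continuous_on_infsum:
  fixes u :: "'i \<Rightarrow> 'a::topological_space \<Rightarrow> 'b::banach"
  assumes cont: "\<And>i. continuous_on S (u i)"
    and le: "\<And>i x. x \<in> S \<Longrightarrow> norm (u i x) \<le> M i" and M: "M summable_on UNIV"
  shows "continuous_on S (\<lambda>x. \<Sum>\<^sub>\<infinity>i. u i x)"
  by (rule uniform_limit_theorem[OF _ Weierstrass_m_test_general[OF le M]])
     (auto intro!: always_eventually continuous_intros cont)

lemma infsum_single:
  fixes f :: "'i \<Rightarrow> complex"
  assumes "\<And>i. i \<noteq> a \<Longrightarrow> f i = 0"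
  shows "(\<Sum>\<^sub>\<infinity>i. f i) = f a"
proof -
  have "infsum f UNIV = infsum f {a}" by (rule infsum_cong_neutral) (use assms in auto)
  then show ?thesis by simp
qed

text \<open>The coefficients decay fast enough for the series to converge uniformly. Its sum is
  continuous, periodic and has the coefficients of \<open>g\<close>, so uniqueness identifies the
  two.\<close>

theorem fourier_inversion:
  fixes g :: "real ^ 'n::finite \<Rightarrow> complex"
  assumes g: "torus_smooth g"
  shows "((\<lambda>p. fourier_coeff g p * torus_char p x) has_sum g x) UNIV"
proof -
  obtain C where C: "\<And>p. norm (fourier_coeff g p) \<le> C / bracket p ^ (2 * CARD('n))"
    using fourier_coeff_rapid[OF g] by blast
  define h where "h x = (\<Sum>\<^sub>\<infinity>p. fourier_coeff g p * torus_char p x)" for x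
  note sb = summable_on_const_bracket[of C]
  have conth: "continuous_on S h" for S
    unfolding h_def by (rule continuous_on_infsum[OF _ _ sb]) (auto intro!: continuous_intros simp: norm_mult C)
  have contg: "continuous_on S g" for S using g by (rule torus_smooth_continuous)
  have perh: "torus_periodic h"
    by (simp add: torus_periodic_def h_def torus_char_periodic[unfolded torus_periodic_def, rule_format])
  have "fourier_coeff h q = fourier_coeff g q" for q
  proof -
    have "fourier_coeff h q = integral (cbox 0 1) (\<lambda>x. \<Sum>\<^sub>\<infinity>p. fourier_coeff g p * (torus_char (- q) x * torus_char p x))"
      unfolding fourier_coeff_def[of h] h_def by (simp add: infsum_cmult_right'[symmetric] mult_ac)
    also have "\<dots> = (\<Sum>\<^sub>\<infinity>p. integral (cbox 0 1) (\<lambda>x. fourier_coeff g p * (torus_char (- q) x * torus_char p x)))"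
      by (rule integral_infsum_dominated[OF _ _ sb]) (auto intro!: continuous_intros simp: norm_mult C)
    also have "\<dots> = (\<Sum>\<^sub>\<infinity>p. fourier_coeff g p * fourier_coeff (torus_char p) q)"
      by (simp add: fourier_coeff_def[of "torus_char _"])
    also have "\<dots> = fourier_coeff g q"
      by (subst infsum_single[of q]) (auto simp: fourier_coeff_torus_char)
    finally show ?thesis .
  qed
  then have "h x - g x = 0"
    using perh torus_smooth_periodic[OF g] conth contg
    by (intro fourier_coeff_unique_0[of "\<lambda>x. h x - g x"])
       (auto intro!: continuous_intros simp: fourier_coeff_diff torus_periodic_def)
  moreover have "(\<lambda>p. fourier_coeff g p * torus_char p x) summable_on UNIV"
    by (rule summable_on_dominated[OF sb]) (simp add: norm_mult C)
  then have "((\<lambda>p. fourier_coeff g p * torus_char p x) has_sum h x) UNIV"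
    by (simp add: h_def has_sum_infsum)
  ultimately show ?thesis by simp
qed

section \<open>The symbol of a product of operators\<close>

definition compose_symbol :: "'n::finite lattice_symbol \<Rightarrow> 'n lattice_symbol \<Rightarrow> 'n lattice_symbol" where
  "compose_symbol a b k x = (\<Sum>\<^sub>\<infinity>q. fourier_coeff (a k) q * torus_char q x * b (k + q) x)"

context symbol_orders begin

text \<open>For each fixed \<open>k\<close>, with a constant depending on it; this serves
  convergence and termwise differentiation of the series, while orders in \<open>k\<close> are
  estimated later through the remainders.\<close>

lemma compose_term_bound:
  fixes a b :: "'n::finite lattice_symbol"
  assumes a: "a \<in> symb m" and b: "b \<in> symb m'"
  shows "\<exists>C\<ge>0. \<forall>q x. norm (fourier_coeff (a k) q * torus_char q x * b (k + q) x) \<le> C / bracket q ^ (2 * CARD('n))"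
proof -
  \<comment> \<open>Peetre's inequality bounds the growth of \<open>b (k + q)\<close> in
    \<open>q\<close> by the power \<open>\<bar>m'\<bar>\<close>; additional decay of the
    coefficients absorbs it.\<close>
  define N where "N = nat \<lceil>\<bar>m'\<bar>\<rceil>"
  obtain C where C: "C \<ge> 0" "\<And>q. norm (fourier_coeff (a k) q) \<le> C / bracket q ^ (2 * CARD('n) + N)"
    using fourier_coeff_rapid[OF smooth_symbolD[OF sym_smooth[OF a]]] by blast
  obtain D where D: "D > 0" "\<And>k x. norm (b k x) \<le> D * bracket k powr m'"
    using sym_bound[OF b] by blast
  have "norm (fourier_coeff (a k) q * torus_char q x * b (k + q) x) \<le> (C * (D * bracket k powr m')) / bracket q ^ (2 * CARD('n))" for q x
  proof -
    have "norm (b (k + q) x) \<le> D * bracket (k + q) powr m'" by (rule D)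
    also have "\<dots> \<le> D * (bracket k powr m' * bracket q powr \<bar>m'\<bar>)"
      using D(1) by (intro mult_left_mono bracket_powr_shift) auto
    also have "\<dots> \<le> D * (bracket k powr m' * bracket q powr real N)"
      using D(1) by (intro mult_left_mono bracket_powr_mono) (auto simp: N_def) 
    finally have "norm (b (k + q) x) \<le> D * (bracket k powr m' * bracket q ^ N)"
      by (simp add: powr_realpow)
    then have "norm (fourier_coeff (a k) q) * norm (b (k + q) x) \<le>
        (C / bracket q ^ (2 * CARD('n) + N)) * (D * (bracket k powr m' * bracket q ^ N))"
      by (intro mult_mono' C) auto
    also have "\<dots> = (C * (D * bracket k powr m')) / bracket q ^ (2 * CARD('n))"
      by (simp add: power_add)
    finally show ?thesis by (simp add: norm_mult)
  qed
  moreover have "0 \<le> C * (D * bracket k powr m')" using C(1) D(1) by simp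
  ultimately show ?thesis by blast
qed

lemma compose_summable:
  assumes "a \<in> symb m" "b \<in> symb m'"
  shows "(\<lambda>q. fourier_coeff (a k) q * torus_char q x * b (k + q) x) summable_on UNIV"
proof -
  obtain C where "\<And>q x. norm (fourier_coeff (a k) q * torus_char q x * b (k + q) x) \<le> C / bracket q ^ (2 * CARD('a))"
    using compose_term_bound[OF assms] by blast
  then show ?thesis by (intro summable_on_dominated[OF summable_on_const_bracket])
qed

text \<open>Leibniz rule for the symbol product: differentiating the character multiplies the
  coefficient of \<open>a k\<close> by 2 pi i q_j, which gives the coefficient of the derivative of
  \<open>a\<close>.\<close>

lemma
  fixes a b :: "'n::finite lattice_symbol"
  assumes a: "a \<in> symb m" and b: "b \<in> symb m'"
  shows compose_symbol_differentiable: "compose_symbol a b k differentiable_on UNIV"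
    and symbol_deriv_compose: "symbol_deriv j (compose_symbol a b) =
      (\<lambda>k x. compose_symbol (symbol_deriv j a) b k x + compose_symbol a (symbol_deriv j b) k x)"
proof -
  define u where "u k q x = fourier_coeff (a k) q * torus_char q x * b (k + q) x" for k q x
  have sm: "smooth_symbol a" "smooth_symbol b" using a b by (auto intro: sym_smooth)
  have usm: "u k q differentiable_on UNIV" for k q
    unfolding u_def using smooth_symbolD[OF sm(2)]
    by (intro torus_smooth_differentiable torus_smooth_mult torus_smooth_cmult torus_smooth_torus_char)
  have du: "partial_deriv j (u k q) = (\<lambda>x. fourier_coeff (symbol_deriv j a k) q * torus_char q x * b (k + q) x
      + fourier_coeff (a k) q * torus_char q x * symbol_deriv j b (k + q) x)" for j k q
  proof -
    have "torus_smooth (\<lambda>x. fourier_coeff (a k) q * torus_char q x)" "torus_smooth (b (k + q))"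
      using smooth_symbolD[OF sm(2)] by (auto intro: torus_smooth_cmult)
    then have "partial_deriv j (u k q) = (\<lambda>x. partial_deriv j (\<lambda>x. fourier_coeff (a k) q * torus_char q x) x * b (k + q) x
      + fourier_coeff (a k) q * torus_char q x * partial_deriv j (b (k + q)) x)"
      unfolding u_def by (intro partial_deriv_mult torus_smooth_differentiable)
    also have "partial_deriv j (\<lambda>x. fourier_coeff (a k) q * torus_char q x)
        = (\<lambda>x. fourier_coeff (symbol_deriv j a k) q * torus_char q x)"
      by (subst partial_deriv_cmult[OF torus_char_differentiable])
         (simp add: partial_deriv_torus_char symbol_deriv_def fourier_coeff_partial_deriv smooth_symbolD[OF sm(1)] mult_ac)
    finally show ?thesis by (simp add: symbol_deriv_def)
  qed
  note ab = sym_deriv[OF a] sym_deriv[OF b]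
  have "\<exists>C. (\<forall>q x. norm (u k q x) \<le> C / bracket q ^ (2 * CARD('n))) \<and>
      (\<forall>j q x. norm (partial_deriv j (u k q) x) \<le> C / bracket q ^ (2 * CARD('n)))" for k
  proof -
    obtain C where C: "C \<ge> 0" "\<And>q x. norm (u k q x) \<le> C / bracket q ^ (2 * CARD('n))"
      unfolding u_def using compose_term_bound[OF a b] by blast
    have "\<forall>j. \<exists>D\<ge>0. \<forall>q x. norm (fourier_coeff (symbol_deriv j a k) q * torus_char q x * b (k + q) x) \<le> D / bracket q ^ (2 * CARD('n))"
      using compose_term_bound[OF ab(1) b] by blast
    then obtain D where D: "\<And>j. D j \<ge> 0"
      "\<And>j q x. norm (fourier_coeff (symbol_deriv j a k) q * torus_char q x * b (k + q) x) \<le> D j / bracket q ^ (2 * CARD('n))"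
      by metis
    have "\<forall>j. \<exists>D\<ge>0. \<forall>q x. norm (fourier_coeff (a k) q * torus_char q x * symbol_deriv j b (k + q) x) \<le> D / bracket q ^ (2 * CARD('n))"
      using compose_term_bound[OF a ab(2)] by blast
    then obtain E where E: "\<And>j. E j \<ge> 0"
      "\<And>j q x. norm (fourier_coeff (a k) q * torus_char q x * symbol_deriv j b (k + q) x) \<le> E j / bracket q ^ (2 * CARD('n))"
      by metis
    define B where "B = C + (\<Sum>j\<in>UNIV. D j + E j)"
    have "C \<le> B" using D(1) E(1) by (auto simp: B_def intro!: sum_nonneg)
    have DE: "D j + E j \<le> B" for j
      unfolding B_def using C(1) D(1) E(1)
      by (intro add_increasing member_le_sum[of j UNIV "\<lambda>j. D j + E j"]) auto
    have "norm (u k q x) \<le> B / bracket q ^ (2 * CARD('n))" for q x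
      using \<open>C \<le> B\<close> by (intro order_trans[OF C(2)] divide_right_mono) auto
    moreover have "norm (partial_deriv j (u k q) x) \<le> B / bracket q ^ (2 * CARD('n))" for j q x
    proof -
      have "norm (partial_deriv j (u k q) x) \<le> D j / bracket q ^ (2 * CARD('n)) + E j / bracket q ^ (2 * CARD('n))"
        unfolding du by (intro norm_triangle_mono D E)
      also have "\<dots> \<le> B / bracket q ^ (2 * CARD('n))"
        unfolding add_divide_distrib[symmetric] using DE by (intro divide_right_mono) auto
      finally show ?thesis .
    qed
    ultimately show ?thesis by blast
  qed
  then obtain C where C: "\<And>k q x. norm (u k q x) \<le> C k / bracket q ^ (2 * CARD('n))"
      "\<And>k j q x. norm (partial_deriv j (u k q) x) \<le> C k / bracket q ^ (2 * CARD('n))" by metis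
  note ipd = infsum_partial_deriv[OF usm C summable_on_const_bracket]
  show "compose_symbol a b k differentiable_on UNIV"
    using ipd(1)[of k] by (simp add: compose_symbol_def[abs_def] u_def)
  show "symbol_deriv j (compose_symbol a b) =
      (\<lambda>k x. compose_symbol (symbol_deriv j a) b k x + compose_symbol a (symbol_deriv j b) k x)"
  proof (intro ext)
    fix k x
    have "symbol_deriv j (compose_symbol a b) k x = (\<Sum>\<^sub>\<infinity>q. partial_deriv j (u k q) x)"
      using ipd(2)[of j k] by (simp add: compose_symbol_def[abs_def] u_def symbol_deriv_def)
    also have "\<dots> = compose_symbol (symbol_deriv j a) b k x + compose_symbol a (symbol_deriv j b) k x"
      unfolding du compose_symbol_def by (intro infsum_add compose_summable[OF ab(1) b] compose_summable[OF a ab(2)])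
    finally show "symbol_deriv j (compose_symbol a b) k x =
      compose_symbol (symbol_deriv j a) b k x + compose_symbol a (symbol_deriv j b) k x" .
  qed
qed

lemma compose_symbol_periodic:
  assumes "smooth_symbol b" shows "torus_periodic (compose_symbol a b k)"
proof -
  have "b k (x + rvec m) = b k x" for k x m
    using torus_smooth_periodic[OF smooth_symbolD[OF assms]] by (simp add: torus_periodic_def)
  then show ?thesis
    by (simp add: torus_periodic_def compose_symbol_def torus_char_periodic[unfolded torus_periodic_def, rule_format])
qed

text \<open>By the Leibniz rule derivatives are again sums of composed symbols, so the induction
  runs over all factors and orders simultaneously.\<close>

lemma smooth_compose_symbol:
  assumes "a \<in> symb m" "b \<in> symb m'"
  shows "smooth_symbol (compose_symbol a b)"
proof -
  have "torus_Cn n (compose_symbol a b k)" if "a \<in> symb m" "b \<in> symb m'" for n m m' k and a b :: "'a lattice_symbol"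
    using that
  proof (induction n arbitrary: a b m m')
    case 0
    then show ?case by (simp add: compose_symbol_periodic sym_smooth[OF 0(2)])
  next
    case (Suc n)
    have "torus_Cn n (\<lambda>x. compose_symbol (symbol_deriv j a) b k x + compose_symbol a (symbol_deriv j b) k x)" for j
      by (intro torus_Cn_add Suc.IH[OF sym_deriv[OF Suc.prems(1)] Suc.prems(2)] Suc.IH[OF Suc.prems(1) sym_deriv[OF Suc.prems(2)]])
    moreover have "partial_deriv j (compose_symbol a b k)
        = (\<lambda>x. compose_symbol (symbol_deriv j a) b k x + compose_symbol a (symbol_deriv j b) k x)" for j
      using fun_cong[OF symbol_deriv_compose[OF Suc.prems, of j], of k] by (simp add: symbol_deriv_def)
    ultimately show ?case
      using compose_symbol_differentiable[OF Suc.prems] compose_symbol_periodic[OF sym_smooth[OF Suc.prems(2)]] by simp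
  qed
  with assms show ?thesis by (auto simp: smooth_symbol_def torus_smooth_iff_Cn)
qed

end

section \<open>Operators\<close>

lemma rapidly_decreasing_bound:
  assumes "f \<in> rapidly_decreasing"
  shows "\<exists>C\<ge>0. \<forall>k. norm (f k) \<le> C / bracket k ^ N"
proof -
  obtain C where C: "\<And>k. norm (f k) * bracket k ^ N \<le> C"
    using assms unfolding rapidly_decreasing_def by blast
  moreover have "0 \<le> C" using order_trans[OF _ C[of 0]] by simp
  ultimately show ?thesis by (auto simp: pos_le_divide_eq)
qed

lemma
  fixes f :: "int ^ 'n::finite \<Rightarrow> complex"
  assumes "f \<in> rapidly_decreasing"
  shows continuous_lattice_fourier: "continuous_on S (lattice_fourier f)"
    and lattice_fourier_bounded: "\<exists>B\<ge>0. \<forall>x. norm (lattice_fourier f x) \<le> B"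
proof -
  obtain C where C: "\<And>k. norm (f k) \<le> C / bracket k ^ (2 * CARD('n))"
    using rapidly_decreasing_bound[OF assms] by blast
  show "continuous_on S (lattice_fourier f)"
    unfolding lattice_fourier_def[abs_def]
    by (rule continuous_on_infsum[OF _ _ summable_on_const_bracket[of C]]) (auto intro!: continuous_intros simp: norm_mult C)
  have "norm (lattice_fourier f x) \<le> (\<Sum>\<^sub>\<infinity>k :: int ^ 'n. C / bracket k ^ (2 * CARD('n)))" for x
    unfolding lattice_fourier_def
    by (rule norm_infsum_le[OF has_sum_infsum has_sum_infsum])
       (auto intro!: summable_on_const_bracket summable_on_dominated[OF summable_on_const_bracket[of C]] simp: norm_mult C)
  then show "\<exists>B\<ge>0. \<forall>x. norm (lattice_fourier f x) \<le> B"
    using order_trans[OF norm_ge_zero] by blast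
qed

text \<open>The operator as an infinite matrix with entries
  \<open>fourier_coeff (\<sigma> k) (m - k)\<close>. Point masses read off single entries, and
  products become matrix products.\<close>

lemma Op_eq_infsum:
  fixes f :: "int ^ 'n::finite \<Rightarrow> complex"
  assumes \<sigma>: "torus_smooth (\<sigma> k)" and f: "f \<in> rapidly_decreasing"
  shows "Op \<sigma> f k = (\<Sum>\<^sub>\<infinity>m. f m * fourier_coeff (\<sigma> k) (m - k))"
proof -
  obtain C where C: "C \<ge> 0" "\<And>k. norm (f k) \<le> C / bracket k ^ (2 * CARD('n))"
    using rapidly_decreasing_bound[OF f] by blast
  obtain B where B: "\<And>x. norm (\<sigma> k x) \<le> B" using torus_smooth_bounded[OF \<sigma>] by blast
  have char: "torus_char k x * torus_char (- m) x = torus_char (- (m - k)) x" for m x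
    by (simp add: torus_char_add[symmetric])
  have "Op \<sigma> f k = integral (cbox 0 1) (\<lambda>x. \<Sum>\<^sub>\<infinity>m. f m * (torus_char (- (m - k)) x * \<sigma> k x))"
    unfolding Op_def lattice_fourier_def char[symmetric]
    by (simp add: infsum_cmult_right'[symmetric] mult_ac)
  also have "\<dots> = (\<Sum>\<^sub>\<infinity>m. integral (cbox 0 1) (\<lambda>x. f m * (torus_char (- (m - k)) x * \<sigma> k x)))"
  proof (rule integral_infsum_dominated[OF _ _ summable_on_const_bracket[of "C * B"]])
    show "continuous_on (cbox 0 1) (\<lambda>x. f m * (torus_char (- (m - k)) x * \<sigma> k x))" for m
      by (intro continuous_intros torus_smooth_continuous[OF \<sigma>])
    show "norm (f m * (torus_char (- (m - k)) x * \<sigma> k x)) \<le> C * B / bracket m ^ (2 * CARD('n))" for m x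
      using mult_mono'[OF C(2) B norm_ge_zero norm_ge_zero, of m x] by (simp add: norm_mult)
  qed
  finally show ?thesis by (simp add: fourier_coeff_def)
qed

lemma Op_one: "f \<in> rapidly_decreasing \<Longrightarrow> Op (\<lambda>k x. 1) f = f"
proof
  fix k assume f: "f \<in> rapidly_decreasing"
  have "fourier_coeff (\<lambda>x. 1) p = (if p = 0 then 1 else 0)" for p :: "int ^ 'a"
    using integral_torus_char[of "- p"] by (simp add: fourier_coeff_def)
  then show "Op (\<lambda>k x. 1) f k = f k"
    by (subst Op_eq_infsum[OF _ f]) (auto intro: trans[OF infsum_single[of k]])
qed

lemma Op_diff:
  assumes "smooth_symbol \<sigma>" "smooth_symbol \<tau>" "f \<in> rapidly_decreasing"
  shows "Op (\<lambda>k x. \<sigma> k x - \<tau> k x) f k = Op \<sigma> f k - Op \<tau> f k"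
  unfolding Op_def right_diff_distrib left_diff_distrib
  by (intro integral_diff integrable_continuous continuous_intros continuous_lattice_fourier assms
      torus_smooth_continuous smooth_symbolD)

lemma point_mass_rapidly_decreasing: "(\<lambda>k. if k = m then 1 else 0) \<in> rapidly_decreasing"
  unfolding rapidly_decreasing_def
  by (auto intro!: exI[of _ "bracket m ^ N" for N])

text \<open>Applied to the point mass at \<open>k + p\<close> and evaluated at \<open>k\<close>, the
  operator returns the Fourier coefficient of \<open>\<sigma> k\<close> at \<open>p\<close>.\<close>

lemma Op_inject:
  assumes "smooth_symbol \<sigma>" "smooth_symbol \<tau>" "\<And>f. f \<in> rapidly_decreasing \<Longrightarrow> Op \<sigma> f = Op \<tau> f"
  shows "\<sigma> = \<tau>"
proof
  fix k
  show "\<sigma> k = \<tau> k"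
  proof (rule fourier_coeff_unique)
    fix p
    let ?f = "\<lambda>m. if m = k + p then 1 else 0 :: complex"
    have "Op \<sigma> ?f k = fourier_coeff (\<sigma> k) p" if "smooth_symbol \<sigma>" for \<sigma>
      by (subst Op_eq_infsum[OF smooth_symbolD[OF that] point_mass_rapidly_decreasing])
         (auto intro: trans[OF infsum_single[of "k + p"]])
    with assms show "fourier_coeff (\<sigma> k) p = fourier_coeff (\<tau> k) p"
      by (metis point_mass_rapidly_decreasing)
  qed (use assms in \<open>auto intro: smooth_symbolD\<close>)
qed

lemma has_symbol_iff: "has_symbol A \<sigma> \<longleftrightarrow> smooth_symbol \<sigma> \<and> (\<forall>f\<in>rapidly_decreasing. A f = Op \<sigma> f)"
  by (simp add: has_symbol_def smooth_symbol_def)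

lemma has_symbol_unique: "has_symbol A \<sigma> \<Longrightarrow> has_symbol A \<tau> \<Longrightarrow> \<sigma> = \<tau>"
  by (auto simp: has_symbol_iff intro: Op_inject)

lemma symbol_of_eq: "has_symbol A \<sigma> \<Longrightarrow> symbol_of A = \<sigma>"
  unfolding symbol_of_def using has_symbol_unique by blast

context symbol_orders begin

text \<open>Decay in \<open>k\<close> comes from the factors \<open>f l\<close> and the coefficient
  at \<open>l - k\<close> together: \<open>bracket k\<close> is at most
  \<open>bracket l * bracket (l - k)\<close>.\<close>

lemma Op_rapidly_decreasing:
  fixes \<sigma> :: "'n::finite lattice_symbol"
  assumes \<sigma>: "\<sigma> \<in> symb m" and f: "f \<in> rapidly_decreasing"
  shows "Op \<sigma> f \<in> rapidly_decreasing"
  unfolding rapidly_decreasing_def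
proof (intro CollectI allI)
  fix N :: nat
  \<comment> \<open>\<open>M\<close> powers of decay in \<open>l - k\<close> cost \<delta> M orders
    in \<open>k\<close>; as \<delta> < 1, the net gain \<open>(1 - \<delta>) * real M\<close>
    eventually covers the order \<open>m\<close> and the required decay \<open>N\<close>.\<close>
  obtain M :: nat where M: "(m + real N) / (1 - \<delta>) \<le> real M" using real_arch_simple by blast
  then have M': "m + \<delta> * real M + real N \<le> real M"
    using delta_less_1 by (simp add: pos_divide_le_eq algebra_simps)
  obtain C where C: "C \<ge> 0" "\<And>k p. norm (fourier_coeff (\<sigma> k) p) * bracket p ^ M \<le> C * bracket k powr (m + \<delta> * real M)"
    using fourier_coeff_decay[OF \<sigma>] by blast
  obtain D where D: "D \<ge> 0" "\<And>k. norm (f k) \<le> D / bracket k ^ (M + 2 * CARD('n))"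
    using rapidly_decreasing_bound[OF f] by blast
  let ?s = "\<lambda>l :: int ^ 'n. C * D / bracket l ^ (2 * CARD('n))"
  have "norm (Op \<sigma> f k) * bracket k ^ N \<le> infsum ?s UNIV" for k
  proof -
    have le: "norm (f l * fourier_coeff (\<sigma> k) (l - k) * bracket k ^ N) \<le> ?s l" for l
    proof -
      have "bracket k \<le> bracket l * bracket (l - k)"
        using bracket_add[of l "k - l"] bracket_uminus[of "k - l"] by simp
      then have 1: "bracket k ^ M \<le> bracket l ^ M * bracket (l - k) ^ M"
        by (simp add: power_mult_distrib[symmetric] power_mono)
      have 2: "norm (fourier_coeff (\<sigma> k) (l - k)) \<le> C * bracket k powr (m + \<delta> * real M) / bracket (l - k) ^ M"
        using C(2) by (simp add: pos_le_divide_eq)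
      have 3: "bracket k powr (m + \<delta> * real M) * bracket k ^ N \<le> bracket k ^ M"
        using bracket_powr_mono[OF M', of k] by (simp add: powr_add powr_realpow)
      have "norm (f l * fourier_coeff (\<sigma> k) (l - k) * bracket k ^ N) = norm (f l) * norm (fourier_coeff (\<sigma> k) (l - k)) * bracket k ^ N"
        by (simp add: norm_mult norm_power)
      also have "\<dots> \<le> (D / bracket l ^ (M + 2 * CARD('n))) * (C * bracket k powr (m + \<delta> * real M) / bracket (l - k) ^ M) * bracket k ^ N"
        using D(1) by (intro mult_right_mono mult_mono D 2) auto
      also have "\<dots> = ?s l * ((bracket k powr (m + \<delta> * real M) * bracket k ^ N) / (bracket l ^ M * bracket (l - k) ^ M))"
        by (simp add: power_add field_simps)
      also have "\<dots> \<le> ?s l * 1"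
        using C(1) D(1) order_trans[OF 3 1] by (intro mult_left_mono) auto
      finally show ?thesis by simp
    qed
    have "norm (Op \<sigma> f k) * bracket k ^ N = norm (\<Sum>\<^sub>\<infinity>l. f l * fourier_coeff (\<sigma> k) (l - k) * bracket k ^ N)"
      unfolding Op_eq_infsum[OF smooth_symbolD[OF sym_smooth[OF \<sigma>]] f]
      by (simp add: infsum_cmult_left' norm_mult norm_power)
    also have "\<dots> \<le> infsum ?s UNIV"
      by (rule norm_infsum_le[OF has_sum_infsum[OF summable_on_dominated[OF summable_on_const_bracket[of "C * D"] le]]
            has_sum_infsum[OF summable_on_const_bracket] le])
    finally show ?thesis .
  qed
  then show "\<exists>C. \<forall>k. norm (Op \<sigma> f k) * bracket k ^ N \<le> C" by blast
qed

text \<open>The outer operator is used in matrix form and the inner one as an integral;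
  \<open>torus_char (k + q)\<close> splits off \<open>torus_char q\<close>, and exchanging sum and
  integral leaves the series of \<open>compose_symbol\<close> under the integral.\<close>

theorem Op_compose:
  fixes a b :: "'n::finite lattice_symbol"
  assumes a: "a \<in> symb m" and b: "b \<in> symb m'" and f: "f \<in> rapidly_decreasing"
  shows "Op a (Op b f) = Op (compose_symbol a b) f"
proof
  fix k
  obtain C where C: "C \<ge> 0" "\<And>q x. norm (fourier_coeff (a k) q * torus_char q x * b (k + q) x) \<le> C / bracket q ^ (2 * CARD('n))"
    using compose_term_bound[OF a b] by blast
  obtain B where B: "\<And>x. norm (lattice_fourier f x) \<le> B" "0 \<le> B"
    using lattice_fourier_bounded[OF f] by blast
  have "bij (\<lambda>q. k + q)" by (rule bij_betwI[where g = "\<lambda>q. q - k"]) auto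
  then have "(\<Sum>\<^sub>\<infinity>l. Op b f l * fourier_coeff (a k) (l - k)) = (\<Sum>\<^sub>\<infinity>q. Op b f (k + q) * fourier_coeff (a k) q)"
    using infsum_reindex_bij_betw[of "\<lambda>q. k + q" UNIV UNIV "\<lambda>l. Op b f l * fourier_coeff (a k) (l - k)"] by simp
  then have "Op a (Op b f) k = (\<Sum>\<^sub>\<infinity>q. Op b f (k + q) * fourier_coeff (a k) q)"
    using Op_eq_infsum[OF smooth_symbolD[OF sym_smooth[OF a]] Op_rapidly_decreasing[OF b f]] by simp
  also have "\<dots> = (\<Sum>\<^sub>\<infinity>q. integral (cbox 0 1) (\<lambda>x. torus_char k x * (fourier_coeff (a k) q * torus_char q x * b (k + q) x) * lattice_fourier f x))"
  proof (intro infsum_cong)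
    fix q
    have "(\<lambda>x. torus_char k x * (fourier_coeff (a k) q * torus_char q x * b (k + q) x) * lattice_fourier f x)
      = (\<lambda>x. fourier_coeff (a k) q * (torus_char (k + q) x * b (k + q) x * lattice_fourier f x))"
      by (simp add: torus_char_add mult_ac)
    then show "Op b f (k + q) * fourier_coeff (a k) q =
      integral (cbox 0 1) (\<lambda>x. torus_char k x * (fourier_coeff (a k) q * torus_char q x * b (k + q) x) * lattice_fourier f x)"
      by (simp add: Op_def)
  qed
  also have "\<dots> = integral (cbox 0 1) (\<lambda>x. \<Sum>\<^sub>\<infinity>q. torus_char k x * (fourier_coeff (a k) q * torus_char q x * b (k + q) x) * lattice_fourier f x)"
  proof (rule integral_infsum_dominated[symmetric, OF _ _ summable_on_const_bracket[of "C * B"]])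
    show "continuous_on (cbox 0 1) (\<lambda>x. torus_char k x * (fourier_coeff (a k) q * torus_char q x * b (k + q) x) * lattice_fourier f x)" for q
      by (intro continuous_intros continuous_lattice_fourier f torus_smooth_continuous smooth_symbolD[OF sym_smooth[OF b]])
    show "norm (torus_char k x * (fourier_coeff (a k) q * torus_char q x * b (k + q) x) * lattice_fourier f x) \<le> C * B / bracket q ^ (2 * CARD('n))" for q x
      using mult_mono'[OF C(2) B(1) norm_ge_zero norm_ge_zero, of q x x] by (simp add: norm_mult mult_ac)
  qed
  also have "\<dots> = Op (compose_symbol a b) f k"
    unfolding Op_def compose_symbol_def by (simp add: infsum_cmult_left' infsum_cmult_right')
  finally show "Op a (Op b f) k = Op (compose_symbol a b) f k" .
qed

end

section \<open>Newton expansion on the lattice\<close>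

lemma finite_mi_abs_less: "finite {\<gamma> :: nat ^ 'n::finite. mi_abs \<gamma> < N}"
proof -
  have inj: "inj_on (\<lambda>\<gamma>::nat ^ 'n. ($) \<gamma>) {\<gamma>. mi_abs \<gamma> < N}"
    by (auto simp: inj_on_def vec_eq_iff)
  have sub: "(\<lambda>\<gamma>::nat ^ 'n. ($) \<gamma>) ` {\<gamma>. mi_abs \<gamma> < N} \<subseteq> PiE UNIV (\<lambda>_. {..<N})"
  proof (clarsimp simp: PiE_def)
    fix \<gamma> :: "nat ^ 'n" and i assume "mi_abs \<gamma> < N"
    moreover have "\<gamma> $ i \<le> mi_abs \<gamma>" unfolding mi_abs_def by (rule member_le_sum) auto
    ultimately show "\<gamma> $ i < N" by linarith
  qed
  have "finite (PiE (UNIV :: 'n set) (\<lambda>_. {..<N}))"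
    by (intro finite_PiE) auto
  from finite_imageD[OF finite_subset[OF sub this] inj] show ?thesis .
qed

lemma finite_mi_abs_eq: "finite {\<gamma> :: nat ^ 'n::finite. mi_abs \<gamma> = N}"
  by (rule finite_subset[OF _ finite_mi_abs_less[of "Suc N"]]) auto

lemma sum_mi_abs_less:
  "(\<Sum>\<gamma> | mi_abs \<gamma> < N. f \<gamma>) = (\<Sum>i<N. \<Sum>\<gamma> :: nat ^ 'n::finite | mi_abs \<gamma> = i. f \<gamma>)"
proof (induction N)
  case (Suc N)
  have "{\<gamma> :: nat ^ 'n. mi_abs \<gamma> < Suc N} = {\<gamma>. mi_abs \<gamma> < N} \<union> {\<gamma>. mi_abs \<gamma> = N}" by auto
  then have "(\<Sum>\<gamma> :: nat ^ 'n | mi_abs \<gamma> < Suc N. f \<gamma>) = (\<Sum>\<gamma> | mi_abs \<gamma> < N. f \<gamma>) + (\<Sum>\<gamma> | mi_abs \<gamma> = N. f \<gamma>)"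
    by (simp only:) (intro sum.union_disjoint finite_mi_abs_less finite_mi_abs_eq, auto)
  with Suc show ?case by simp
qed simp

text \<open>The multi-index binomial coefficient of \<open>p\<close> over \<gamma>; the generalized
  binomial is used because the entries of \<open>p\<close> may be negative.\<close>

definition newton_coeff :: "int ^ 'n::finite \<Rightarrow> nat ^ 'n \<Rightarrow> complex" where
  "newton_coeff p \<gamma> = (\<Prod>j\<in>UNIV. of_int (p $ j) gchoose (\<gamma> $ j))"

lemma falling_power_gbinomial: "falling_power m l = (of_int m gchoose l) * fact l"
proof -
  have "falling_power m l = (\<Prod>i<l. of_int m - of_nat i)"
    by (induction l) (auto simp: mult_ac)
  then show ?thesis by (simp add: gbinomial_prod_rev atLeast0LessThan)
qed

lemma falling_power_newton_coeff:
  "(\<Prod>j\<in>UNIV. falling_power (p $ j) (\<gamma> $ j)) = of_nat (mi_fact \<gamma>) * newton_coeff p \<gamma>"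
  by (simp add: falling_power_gbinomial newton_coeff_def mi_fact_def prod.distrib mult.commute)

lemma newton_coeff_0: "newton_coeff 0 \<gamma> = (if \<gamma> = 0 then 1 else 0)"
proof (cases "\<gamma> = 0")
  case False
  then obtain j where "\<gamma> $ j \<noteq> 0" by (auto simp: vec_eq_iff)
  then have "of_int ((0 :: int ^ 'a) $ j) gchoose (\<gamma> $ j) = (0 :: complex)"
    by (cases "\<gamma> $ j") auto
  with False show ?thesis unfolding newton_coeff_def by (auto intro!: prod_zero)
qed (simp add: newton_coeff_def)

text \<open>Pascal's rule in coordinate \<open>j\<close>. The case \<open>\<gamma> $ j = 0\<close>
  is separate because subtraction on natural numbers would leave \<gamma> unchanged there.\<close>

lemma newton_coeff_pascal:
  "newton_coeff (p + axis j 1) \<gamma> - newton_coeff p \<gamma> =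
    (if \<gamma> $ j = 0 then 0 else newton_coeff p (\<gamma> - axis j 1))"
proof -
  let ?P = "\<Prod>i\<in>UNIV - {j}. of_int (p $ i) gchoose (\<gamma> $ i) :: complex"
  have split: "newton_coeff q \<beta> = (of_int (q $ j) gchoose (\<beta> $ j)) * (\<Prod>i\<in>UNIV - {j}. of_int (q $ i) gchoose (\<beta> $ i))" for q \<beta>
    unfolding newton_coeff_def by (subst prod.remove[of UNIV j]) auto
  have 1: "newton_coeff (p + axis j 1) \<gamma> = (of_int (p $ j) + 1 gchoose (\<gamma> $ j)) * ?P"
    unfolding split[of "p + axis j 1"] by (auto simp: axis_def intro!: arg_cong2[where f = "(*)"] prod.cong)
  have 2: "newton_coeff p (\<gamma> - axis j 1) = (of_int (p $ j) gchoose (\<gamma> $ j - 1)) * ?P"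
    unfolding split[of p "\<gamma> - axis j 1"] by (auto simp: axis_def intro!: arg_cong2[where f = "(*)"] prod.cong)
  show ?thesis
    unfolding 1 2 split[of p \<gamma>]
    by (cases "\<gamma> $ j") (auto simp: gbinomial_Suc_Suc distrib_right)
qed

definition newton_rem :: "nat \<Rightarrow> (int ^ 'n::{finite,linorder} \<Rightarrow> complex)
    \<Rightarrow> int ^ 'n::{finite,linorder} \<Rightarrow> int ^ 'n::{finite,linorder} \<Rightarrow> complex" where
  "newton_rem N \<tau> p k = \<tau> (k + p) - (\<Sum>\<gamma> | mi_abs \<gamma> < N. newton_coeff p \<gamma> * differences \<gamma> \<tau> k)"

text \<open>The discrete counterpart of differentiating a Taylor remainder: a unit step in
  \<open>p\<close> yields the remainder of degree lower by one for the differenced function.\<close>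

lemma newton_rem_step:
  fixes \<tau> :: "int ^ 'n::{finite,linorder} \<Rightarrow> complex"
  shows "newton_rem (Suc N) \<tau> (p + axis j 1) k - newton_rem (Suc N) \<tau> p k = newton_rem N (difference j \<tau>) p k"
proof -
  \<comment> \<open>By Pascal's rule the terms with \<open>\<gamma> $ j = 0\<close> cancel; all
    others arise from a lower multi-index by raising its entry \<open>j\<close>.\<close>
  have "(\<Sum>\<gamma> | mi_abs \<gamma> < Suc N. (newton_coeff (p + axis j 1) \<gamma> - newton_coeff p \<gamma>) * differences \<gamma> \<tau> k)
      = (\<Sum>\<gamma> \<in> (\<lambda>\<gamma>. \<gamma> + axis j 1) ` {\<gamma>. mi_abs \<gamma> < N}. (newton_coeff (p + axis j 1) \<gamma> - newton_coeff p \<gamma>) * differences \<gamma> \<tau> k)"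
  proof (rule sum.mono_neutral_right[OF finite_mi_abs_less])
    show "(\<lambda>\<gamma>. \<gamma> + axis j 1) ` {\<gamma>. mi_abs \<gamma> < N} \<subseteq> {\<gamma>. mi_abs \<gamma> < Suc N}"
      by (auto simp: mi_abs_add_axis simp del: One_nat_def)
    show "\<forall>\<gamma>\<in>{\<gamma>. mi_abs \<gamma> < Suc N} - (\<lambda>\<gamma>. \<gamma> + axis j 1) ` {\<gamma>. mi_abs \<gamma> < N}.
        (newton_coeff (p + axis j 1) \<gamma> - newton_coeff p \<gamma>) * differences \<gamma> \<tau> k = 0"
    proof
      fix \<gamma> :: "nat ^ 'n::{finite,linorder}"
      assume \<gamma>: "\<gamma> \<in> {\<gamma>. mi_abs \<gamma> < Suc N} - (\<lambda>\<gamma>. \<gamma> + axis j 1) ` {\<gamma>. mi_abs \<gamma> < N}"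
      have "\<gamma> $ j = 0"
      proof (rule ccontr)
        assume "\<gamma> $ j \<noteq> 0"
        then have eq: "\<gamma> = (\<gamma> - axis j 1) + axis j 1"
          by (auto simp: vec_eq_iff axis_def)
        then have "mi_abs (\<gamma> - axis j 1) < N"
          using \<gamma> mi_abs_add_axis[of "\<gamma> - axis j 1" j] by (metis DiffD1 Suc_less_eq mem_Collect_eq)
        with eq \<gamma> show False by blast
      qed
      then show "(newton_coeff (p + axis j 1) \<gamma> - newton_coeff p \<gamma>) * differences \<gamma> \<tau> k = 0"
        by (simp add: newton_coeff_pascal del: One_nat_def)
    qed
  qed
  also have "\<dots> = (\<Sum>\<gamma> | mi_abs \<gamma> < N. newton_coeff p \<gamma> * differences \<gamma> (difference j \<tau>) k)"
  proof (subst sum.reindex)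
    show "inj_on (\<lambda>\<gamma>. \<gamma> + axis j 1) {\<gamma>. mi_abs \<gamma> < N}" by (auto simp: inj_on_def)
    have *: "\<gamma> + axis j 1 - axis j 1 = \<gamma>" "(\<gamma> + axis j 1) $ j \<noteq> 0" for \<gamma> :: "nat ^ 'n::{finite,linorder}"
      by (auto simp: vec_eq_iff axis_def)
    show "sum ((\<lambda>\<gamma>. (newton_coeff (p + axis j 1) \<gamma> - newton_coeff p \<gamma>) * differences \<gamma> \<tau> k) \<circ> (\<lambda>\<gamma>. \<gamma> + axis j 1)) {\<gamma>. mi_abs \<gamma> < N}
        = (\<Sum>\<gamma> | mi_abs \<gamma> < N. newton_coeff p \<gamma> * differences \<gamma> (difference j \<tau>) k)"
      by (simp only: newton_coeff_pascal differences_add_axis o_def * if_False)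
  qed
  finally have "(\<Sum>\<gamma> | mi_abs \<gamma> < Suc N. newton_coeff (p + axis j 1) \<gamma> * differences \<gamma> \<tau> k)
      = (\<Sum>\<gamma> | mi_abs \<gamma> < N. newton_coeff p \<gamma> * differences \<gamma> (difference j \<tau>) k)
        + (\<Sum>\<gamma> | mi_abs \<gamma> < Suc N. newton_coeff p \<gamma> * differences \<gamma> \<tau> k)"
    by (simp only: left_diff_distrib sum_subtractf diff_eq_eq)
  then show ?thesis
    by (simp add: newton_rem_def difference_def[of j \<tau> "k + p"] add.assoc)
qed

lemma newton_rem_0: "newton_rem 0 \<tau> p k = \<tau> (k + p)"
  by (simp add: newton_rem_def)

lemma newton_rem_Suc_0: "newton_rem (Suc N) \<tau> 0 k = 0"
proof -
  have "(\<Sum>\<gamma> | mi_abs \<gamma> < Suc N. newton_coeff 0 \<gamma> * differences \<gamma> \<tau> k) = (\<Sum>\<gamma> \<in> {0}. newton_coeff 0 \<gamma> * differences \<gamma> \<tau> k)"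
    by (rule sum.mono_neutral_right[OF finite_mi_abs_less]) (auto simp: newton_coeff_0)
  then show ?thesis by (simp add: newton_rem_def newton_coeff_0)
qed

text \<open>The length of a shortest lattice path from the origin to \<open>p\<close>, as a natural
  number for induction along such a path.\<close>

definition l1_norm :: "int ^ 'n::finite \<Rightarrow> nat" where
  "l1_norm p = (\<Sum>j\<in>UNIV. nat \<bar>p $ j\<bar>)"

lemma l1_norm_eq_0_iff: "l1_norm p = 0 \<longleftrightarrow> p = 0"
  by (auto simp: l1_norm_def vec_eq_iff)

lemma l1_norm_step:
  assumes "p $ j < 0" shows "l1_norm p = Suc (l1_norm (p + axis j 1))"
proof -
  have "l1_norm q = nat \<bar>q $ j\<bar> + (\<Sum>i\<in>UNIV - {j}. nat \<bar>q $ i\<bar>)" for q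
    unfolding l1_norm_def by (rule sum.remove) auto
  moreover have "(\<Sum>i\<in>UNIV - {j}. nat \<bar>(p + axis j 1) $ i\<bar>) = (\<Sum>i\<in>UNIV - {j}. nat \<bar>p $ i\<bar>)"
    by (intro sum.cong) (auto simp: axis_def)
  moreover have "nat \<bar>p $ j\<bar> = Suc (nat \<bar>(p + axis j 1) $ j\<bar>)"
    using assms by (simp add: axis_def)
  ultimately show ?thesis by simp
qed

lemma l1_norm_uminus: "l1_norm (- p) = l1_norm p"
  by (simp add: l1_norm_def)

lemma l1_norm_step':
  assumes "0 < p $ j" shows "l1_norm p = Suc (l1_norm (p - axis j 1))"
proof -
  have "l1_norm (- p) = Suc (l1_norm (- (p - axis j 1)))"
    using l1_norm_step[of "- p" j] assms by simp
  then show ?thesis by (simp only: l1_norm_uminus)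
qed

text \<open>The remainder is summed up along a lattice path from the origin to \<open>p\<close>.\<close>

lemma norm_newton_rem_le:
  fixes \<tau> :: "int ^ 'n::{finite,linorder} \<Rightarrow> complex"
  assumes "0 \<le> W"
  shows "(\<And>\<gamma> q. mi_abs \<gamma> = N \<Longrightarrow> l1_norm q \<le> l1_norm p \<Longrightarrow> norm (differences \<gamma> \<tau> (k + q)) \<le> W) \<Longrightarrow>
    norm (newton_rem N \<tau> p k) \<le> real (l1_norm p) ^ N * W"
proof (induction N arbitrary: \<tau> p)
  case 0
  then show ?case using 0[of 0 p] by (simp add: newton_rem_0)
next
  case (Suc N)
  have le: "norm (newton_rem N (difference j \<tau>) q k) \<le> real (l1_norm p) ^ N * W" if q: "l1_norm q \<le> l1_norm p" for q j
  proof -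
    have "norm (newton_rem N (difference j \<tau>) q k) \<le> real (l1_norm q) ^ N * W"
    proof (rule Suc.IH)
      fix \<gamma> :: "nat ^ 'n::{finite,linorder}" and q' :: "int ^ 'n::{finite,linorder}"
      assume "mi_abs \<gamma> = N" "l1_norm q' \<le> l1_norm q"
      then show "norm (differences \<gamma> (difference j \<tau>) (k + q')) \<le> W"
        using Suc.prems[of "\<gamma> + axis j 1" q'] q by (simp add: differences_add_axis mi_abs_add_axis del: One_nat_def)
    qed
    also have "\<dots> \<le> real (l1_norm p) ^ N * W"
      using q assms by (intro mult_right_mono power_mono) auto
    finally show ?thesis .
  qed
  \<comment> \<open>The length of \<open>p\<close> stays fixed as a bound for every point
    \<open>q\<close> on the path, so that each step costs the same amount and only the number of
    steps varies in the induction.\<close>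
  have "norm (newton_rem (Suc N) \<tau> q k) \<le> real (l1_norm q) * (real (l1_norm p) ^ N * W)" if "l1_norm q \<le> l1_norm p" for q
    using that
  proof (induction "l1_norm q" arbitrary: q)
    case 0
    then have "q = 0" using l1_norm_eq_0_iff[of q] by simp
    then show ?case using assms by (simp add: newton_rem_Suc_0)
  next
    case (Suc r)
    then have "q \<noteq> 0" using l1_norm_eq_0_iff[of q] by auto
    then obtain j where "q $ j \<noteq> 0" by (auto simp: vec_eq_iff)
    then consider "q $ j < 0" | "0 < q $ j" by linarith
    then show ?case
    proof cases
      \<comment> \<open>In either case the step leads towards the origin. The remainder picked up on
        the way is taken at the lower end of the step, here \<open>q\<close> itself and below
        \<open>q - axis j 1\<close>, both no longer than \<open>p\<close>.\<close>
      case 1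
      let ?q = "q + axis j 1"
      have r: "l1_norm q = Suc (l1_norm ?q)" using l1_norm_step[OF 1] .
      then have "norm (newton_rem (Suc N) \<tau> ?q k) \<le> real (l1_norm ?q) * (real (l1_norm p) ^ N * W)"
        using Suc by (intro Suc.hyps(1)) auto
      moreover have "newton_rem (Suc N) \<tau> q k = newton_rem (Suc N) \<tau> ?q k - newton_rem N (difference j \<tau>) q k"
        using newton_rem_step[of N \<tau> q j k] by (simp add: algebra_simps)
      ultimately show ?thesis
        using norm_triangle_ineq4[of "newton_rem (Suc N) \<tau> ?q k" "newton_rem N (difference j \<tau>) q k"] le[OF Suc.prems, of j]
        unfolding r by (simp add: distrib_right)
    next
      case 2
      let ?q = "q - axis j 1"
      have r: "l1_norm q = Suc (l1_norm ?q)" using l1_norm_step'[OF 2] .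
      then have "norm (newton_rem (Suc N) \<tau> ?q k) \<le> real (l1_norm ?q) * (real (l1_norm p) ^ N * W)"
        using Suc by (intro Suc.hyps(1)) auto
      moreover have "newton_rem (Suc N) \<tau> q k = newton_rem (Suc N) \<tau> ?q k + newton_rem N (difference j \<tau>) ?q k"
        using newton_rem_step[of N \<tau> ?q j k] by (simp add: algebra_simps)
      moreover have "norm (newton_rem N (difference j \<tau>) ?q k) \<le> real (l1_norm p) ^ N * W"
        using Suc.prems r by (intro le) simp
      ultimately show ?thesis
        using norm_triangle_ineq[of "newton_rem (Suc N) \<tau> ?q k" "newton_rem N (difference j \<tau>) ?q k"]
        unfolding r by (simp add: distrib_right)
    qed
  qed
  from this[of p] show ?case by (simp add: mult.assoc)
qed

lemma bracket_le_l1_norm: "bracket p \<le> 1 + real (l1_norm p)"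
  using bracket_le_sum[of p] by (simp add: l1_norm_def)

lemma l1_norm_le_bracket:
  fixes p :: "int ^ 'n::finite" shows "real (l1_norm p) \<le> real CARD('n) * bracket p"
proof -
  have "real (l1_norm p) \<le> (\<Sum>j\<in>(UNIV :: 'n set). bracket p)"
    unfolding l1_norm_def of_nat_sum
  proof (rule sum_mono)
    fix i
    have "real (nat \<bar>p $ i\<bar>) = \<bar>real_of_int (p $ i)\<bar>" by simp
    with abs_component_le_bracket[of p i] show "real (nat \<bar>p $ i\<bar>) \<le> bracket p" by linarith
  qed
  then show ?thesis by simp
qed

section \<open>The composition formula\<close>

definition composition_term :: "nat \<Rightarrow> 'n::{finite,linorder} lattice_symbol \<Rightarrow> 'n lattice_symbol \<Rightarrow> 'n lattice_symbol" where
  "composition_term i a b k x = (\<Sum>\<gamma> | mi_abs \<gamma> = i.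
     1 / of_nat (mi_fact \<gamma>) * falling_derivs \<gamma> (a k) x * differences \<gamma> (\<lambda>m. b m x) k)"

definition composition_rem :: "nat \<Rightarrow> 'n::{finite,linorder} lattice_symbol \<Rightarrow> 'n lattice_symbol \<Rightarrow> 'n lattice_symbol" where
  "composition_rem N a b k x = compose_symbol a b k x - (\<Sum>i<N. composition_term i a b k x)"

lemma mi_fact_nonzero [simp]: "mi_fact \<gamma> \<noteq> 0"
  by (simp add: mi_fact_def)

context symbol_orders begin

lemma composition_term_sym:
  fixes a b :: "'n::{finite,linorder} lattice_symbol"
  assumes "a \<in> symb m" "b \<in> symb m'"
  shows "composition_term i a b \<in> symb (m + m' - (\<rho> - \<delta>) * real i)"
  unfolding composition_term_def[abs_def]
proof (rule sym_sum)
  fix \<gamma> :: "nat ^ 'n::{finite,linorder}" assume \<gamma>: "\<gamma> \<in> {\<gamma>. mi_abs \<gamma> = i}"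
  have "(\<lambda>k x. 1 / of_nat (mi_fact \<gamma>) * falling_derivs \<gamma> (a k) x * differences \<gamma> (\<lambda>m. b m x) k)
      \<in> symb ((m + \<delta> * real (mi_abs \<gamma>)) + (m' - \<rho> * real (mi_abs \<gamma>)))"
    by (intro sym_mult sym_cmult sym_falling_derivs sym_differences assms)
  also have "(m + \<delta> * real (mi_abs \<gamma>)) + (m' - \<rho> * real (mi_abs \<gamma>)) = m + m' - (\<rho> - \<delta>) * real i"
    using \<gamma> by (simp add: algebra_simps)
  finally show "(\<lambda>k x. 1 / of_nat (mi_fact \<gamma>) * falling_derivs \<gamma> (a k) x * differences \<gamma> (\<lambda>m. b m x) k)
      \<in> symb (m + m' - (\<rho> - \<delta>) * real i)" .
qed

lemma composition_term_deriv:
  fixes a b :: "'n::{finite,linorder} lattice_symbol"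
  assumes a: "smooth_symbol a" and b: "smooth_symbol b"
  shows "smooth_symbol (composition_term i a b)"
    and "symbol_deriv j (composition_term i a b) =
      (\<lambda>k x. composition_term i (symbol_deriv j a) b k x + composition_term i a (symbol_deriv j b) k x)"
proof -
  let ?f = "\<lambda>\<gamma> k x. 1 / of_nat (mi_fact \<gamma>) * falling_derivs \<gamma> (a k) x"
  let ?g = "\<lambda>\<gamma> k x. differences \<gamma> (\<lambda>m. b m x) k"
  have f: "torus_smooth (?f \<gamma> k)" for \<gamma> k
    by (intro torus_smooth_cmult torus_smooth_falling_derivs smooth_symbolD[OF a])
  have g: "torus_smooth (?g \<gamma> k)" for \<gamma> k
    by (intro torus_smooth_differences b)
  show "smooth_symbol (composition_term i a b)"
    unfolding composition_term_def[abs_def] smooth_symbol_def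
    by (intro allI torus_smooth_sum torus_smooth_mult f g)
  show "symbol_deriv j (composition_term i a b) =
      (\<lambda>k x. composition_term i (symbol_deriv j a) b k x + composition_term i a (symbol_deriv j b) k x)"
  proof (intro ext)
    fix k x
    have df: "partial_deriv j (?f \<gamma> k) = (\<lambda>x. 1 / of_nat (mi_fact \<gamma>) * falling_derivs \<gamma> (symbol_deriv j a k) x)" for \<gamma>
      unfolding symbol_deriv_def falling_derivs_partial_deriv[OF smooth_symbolD[OF a]]
      by (intro partial_deriv_cmult torus_smooth_differentiable torus_smooth_falling_derivs smooth_symbolD[OF a])
    have "symbol_deriv j (composition_term i a b) k x = (\<Sum>\<gamma> | mi_abs \<gamma> = i. partial_deriv j (\<lambda>x. ?f \<gamma> k x * ?g \<gamma> k x) x)"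
      unfolding symbol_deriv_def composition_term_def[abs_def]
      by (subst partial_deriv_sum) (intro torus_smooth_differentiable torus_smooth_mult f g, rule refl)
    also have "\<dots> = composition_term i (symbol_deriv j a) b k x + composition_term i a (symbol_deriv j b) k x"
      unfolding composition_term_def sum.distrib[symmetric]
      by (intro sum.cong refl, subst partial_deriv_mult)
         (intro torus_smooth_differentiable f g, intro torus_smooth_differentiable f g,
          simp only: df torus_smooth_differences(2)[OF b])
    finally show "symbol_deriv j (composition_term i a b) k x =
        composition_term i (symbol_deriv j a) b k x + composition_term i a (symbol_deriv j b) k x" .
  qed
qed

text \<open>The product and every term of its expansion obey the same Leibniz rule, so the remainder
  does too; bounds for its derivatives thus reduce to bounds without derivatives.\<close>

lemma composition_rem_deriv:
  fixes a b :: "'n::{finite,linorder} lattice_symbol"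
  assumes a: "a \<in> symb m" and b: "b \<in> symb m'"
  shows "smooth_symbol (composition_rem N a b)"
    and "symbol_deriv j (composition_rem N a b) =
      (\<lambda>k x. composition_rem N (symbol_deriv j a) b k x + composition_rem N a (symbol_deriv j b) k x)"
proof -
  note sm = sym_smooth[OF a] sym_smooth[OF b]
  note ct = composition_term_deriv[OF sm]
  show "smooth_symbol (composition_rem N a b)"
    unfolding composition_rem_def[abs_def]
    by (intro smooth_symbol_minus smooth_symbol_sum smooth_compose_symbol[OF a b] ct)
  show "symbol_deriv j (composition_rem N a b) =
      (\<lambda>k x. composition_rem N (symbol_deriv j a) b k x + composition_rem N a (symbol_deriv j b) k x)"
    unfolding composition_rem_def[abs_def]
    by (simp add: symbol_deriv_minus symbol_deriv_sum smooth_symbol_sum smooth_compose_symbol[OF a b] ct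
        symbol_deriv_compose[OF a b] sum.distrib algebra_simps)
qed

lemma has_sum_finite_sum:
  fixes f :: "'i \<Rightarrow> 'j \<Rightarrow> complex"
  assumes "finite I" "\<And>i. (f i has_sum s i) A"
  shows "((\<lambda>x. \<Sum>i\<in>I. f i x) has_sum (\<Sum>i\<in>I. s i)) A"
  using assms(1) by (induction I) (auto intro!: has_sum_add assms(2))

text \<open>\<open>falling_derivs \<gamma>\<close> has the multiplier \<gamma>! times
  \<open>newton_coeff\<close>, so the factor 1/\<gamma>! and Fourier inversion turn the Newton
  terms, summed over \<open>q\<close>, into the terms of the composition formula. What is left under
  the sum is the Newton remainder.\<close>

lemma composition_rem_has_sum:
  fixes a b :: "'n::{finite,linorder} lattice_symbol"
  assumes a: "a \<in> symb m" and b: "b \<in> symb m'"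
  shows "((\<lambda>q. fourier_coeff (a k) q * torus_char q x * newton_rem N (\<lambda>l. b l x) q k) has_sum composition_rem N a b k x) UNIV"
proof -
  have ak: "torus_smooth (a k)" using smooth_symbolD[OF sym_smooth[OF a]] .
  have 1: "((\<lambda>q. fourier_coeff (a k) q * torus_char q x * b (k + q) x) has_sum compose_symbol a b k x) UNIV"
    unfolding compose_symbol_def by (intro has_sum_infsum compose_summable[OF a b])
  let ?d = "\<lambda>\<gamma>. differences \<gamma> (\<lambda>l. b l x) k"
  have 2: "((\<lambda>q. fourier_coeff (a k) q * torus_char q x * (newton_coeff q \<gamma> * ?d \<gamma>))
      has_sum (1 / of_nat (mi_fact \<gamma>) * falling_derivs \<gamma> (a k) x * ?d \<gamma>)) UNIV" for \<gamma>
  proof -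
    have "((\<lambda>q. (1 / of_nat (mi_fact \<gamma>) * ?d \<gamma>) * (fourier_coeff (falling_derivs \<gamma> (a k)) q * torus_char q x))
      has_sum ((1 / of_nat (mi_fact \<gamma>) * ?d \<gamma>) * falling_derivs \<gamma> (a k) x)) UNIV"
      by (intro has_sum_cmult_right fourier_inversion torus_smooth_falling_derivs ak)
    then show ?thesis
      by (simp add: fourier_coeff_falling_derivs[OF ak] falling_power_newton_coeff mult_ac)
  qed
  have "((\<lambda>q. \<Sum>\<gamma> | mi_abs \<gamma> < N. fourier_coeff (a k) q * torus_char q x * (newton_coeff q \<gamma> * ?d \<gamma>))
      has_sum (\<Sum>\<gamma> | mi_abs \<gamma> < N. 1 / of_nat (mi_fact \<gamma>) * falling_derivs \<gamma> (a k) x * ?d \<gamma>)) UNIV"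
    by (intro has_sum_finite_sum finite_mi_abs_less 2)
  from has_sum_add[OF 1 has_sum_uminusI[OF this]] show ?thesis
    by (simp add: newton_rem_def composition_rem_def composition_term_def sum_mi_abs_less right_diff_distrib sum_distrib_left)
qed

text \<open>The first summand is the expected size when \<open>q\<close> is small against
  \<open>k\<close>; the second covers the other \<open>q\<close>, where decay in \<open>k\<close>,
  in any amount \<open>J\<close>, is bought by growth in \<open>q\<close>.\<close>

lemma newton_rem_symbol_bound:
  fixes b :: "'n::{finite,linorder} lattice_symbol" and N J :: nat
  assumes b: "b \<in> symb m"
  defines "s \<equiv> m - \<rho> * real N"
  defines "S \<equiv> nat \<lceil>\<bar>s\<bar>\<rceil>"
  shows "\<exists>C\<ge>0. \<forall>k q x. norm (newton_rem N (\<lambda>l. b l x) q k) \<le>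
    C * (bracket q ^ N * bracket k powr s + bracket q ^ (N + S + J) * bracket k powr (s - real J))"
proof -
  define n where "n = real CARD('n)"
  have n: "n \<ge> 1" by (simp add: n_def Suc_le_eq)
  have "\<forall>\<gamma>. \<exists>D>0. mi_abs \<gamma> = N \<longrightarrow> (\<forall>k x. norm (differences \<gamma> (\<lambda>l. b l x) k) \<le> D * bracket k powr s)"
    using sym_bound[OF sym_differences[OF b]] unfolding s_def by (metis zero_less_one)
  then obtain D where D: "\<And>\<gamma>. D \<gamma> > 0" "\<And>\<gamma> k x. mi_abs \<gamma> = N \<Longrightarrow> norm (differences \<gamma> (\<lambda>l. b l x) k) \<le> D \<gamma> * bracket k powr s"
    by metis
  define E where "E = (\<Sum>\<gamma> :: nat ^ 'n::{finite,linorder} | mi_abs \<gamma> = N. D \<gamma>)"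
  have E0: "0 \<le> E" unfolding E_def using D(1) by (intro sum_nonneg) (auto intro: less_imp_le)
  have E: "norm (differences \<gamma> (\<lambda>l. b l x) k) \<le> E * bracket k powr s" if "mi_abs \<gamma> = N" for \<gamma> k x
  proof -
    have "D \<gamma> \<le> E" unfolding E_def using that D(1)
      by (intro member_le_sum finite_mi_abs_eq) (auto intro: less_imp_le)
    then show ?thesis using order_trans[OF D(2)[OF that] mult_right_mono[of "D \<gamma>" E]] by simp
  qed
  define C where "C = n ^ N * (E * 2 powr \<bar>s\<bar>) + n ^ N * (E * (2 * n) ^ S * (3 * n) ^ J)"
  have C0: "0 \<le> C" using n E0 by (simp add: C_def)
  have "norm (newton_rem N (\<lambda>l. b l x) q k) \<le>
    C * (bracket q ^ N * bracket k powr s + bracket q ^ (N + S + J) * bracket k powr (s - real J))" for k q x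
  proof -
    have l1: "real (l1_norm q) \<le> n * bracket q" unfolding n_def by (rule l1_norm_le_bracket)
    then have l1N: "real (l1_norm q) ^ N \<le> n ^ N * bracket q ^ N"
      by (simp add: power_mult_distrib[symmetric] power_mono)
    have nq: "1 \<le> n * bracket q" using n bracket_ge_1[of q] by (metis mult_mono' mult_1 zero_le_one)
    show ?thesis
    proof (cases "real (l1_norm q) \<le> norm (rvec k) / 2")
      \<comment> \<open>All points of the path stay within half the distance of \<open>k\<close>
        from the origin, so their brackets differ from \<open>bracket k\<close> by a factor of at
        most 2.\<close>
      case True
      have "norm (newton_rem N (\<lambda>l. b l x) q k) \<le> real (l1_norm q) ^ N * (E * (2 powr \<bar>s\<bar> * bracket k powr s))"
      proof (rule norm_newton_rem_le)
        fix \<gamma> :: "nat ^ 'n::{finite,linorder}" and q' :: "int ^ 'n::{finite,linorder}"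
          assume \<gamma>: "mi_abs \<gamma> = N" and q': "l1_norm q' \<le> l1_norm q"
        have "norm (rvec q') \<le> norm (rvec k) / 2"
          using bracket_le_l1_norm[of q'] q' True by (simp add: bracket_def)
        then have br: "bracket k \<le> 2 * bracket (k + q')" "bracket (k + q') \<le> 2 * bracket k"
          using norm_triangle_ineq4[of "rvec (k + q')" "rvec q'"] norm_triangle_ineq[of "rvec k" "rvec q'"]
          by (simp_all add: bracket_def rvec_add)
        have "bracket (k + q') powr s \<le> 2 powr \<bar>s\<bar> * bracket k powr s"
        proof (cases "s \<ge> 0")
          case True
          then have "bracket (k + q') powr s \<le> (2 * bracket k) powr s" using br by (intro powr_mono2) auto
          with True show ?thesis by (simp add: powr_mult)
        next
          case False
          then have "bracket (k + q') powr s \<le> (bracket k / 2) powr s" using br by (intro powr_mono2') auto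
          with False show ?thesis by (simp add: powr_divide powr_minus field_simps)
        qed
        then show "norm (differences \<gamma> (\<lambda>l. b l x) (k + q')) \<le> E * (2 powr \<bar>s\<bar> * bracket k powr s)"
          using order_trans[OF E[OF \<gamma>] mult_left_mono[OF _ E0]] by blast
      qed (use E0 in auto)
      also have "\<dots> \<le> n ^ N * bracket q ^ N * (E * (2 powr \<bar>s\<bar> * bracket k powr s))"
        using E0 by (intro mult_right_mono l1N) auto
      also have "\<dots> = n ^ N * (E * 2 powr \<bar>s\<bar>) * (bracket q ^ N * bracket k powr s)" by simp
      also have "\<dots> \<le> C * (bracket q ^ N * bracket k powr s + bracket q ^ (N + S + J) * bracket k powr (s - real J))"
        using n E0 C0 by (intro mult_mono) (auto simp: C_def)
      finally show ?thesis .
    next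
      \<comment> \<open>The path may pass the origin, so Peetre's inequality is used, with the
        integer \<open>S\<close> in place of \<open>\<bar>s\<bar>\<close>. Since now
        \<open>bracket k \<le> 3 * n * bracket q\<close>, \<open>J\<close> powers of
        \<open>bracket k\<close> may be exchanged for powers of \<open>bracket q\<close>.\<close>
      case False
      have "norm (newton_rem N (\<lambda>l. b l x) q k) \<le> real (l1_norm q) ^ N * (E * (bracket k powr s * (2 * n * bracket q) ^ S))"
      proof (rule norm_newton_rem_le)
        fix \<gamma> :: "nat ^ 'n::{finite,linorder}" and q' :: "int ^ 'n::{finite,linorder}"
          assume \<gamma>: "mi_abs \<gamma> = N" and q': "l1_norm q' \<le> l1_norm q"
        have "bracket q' \<le> 2 * n * bracket q"
          using bracket_le_l1_norm[of q'] q' l1 nq by simp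
        then have "bracket q' powr \<bar>s\<bar> \<le> (2 * n * bracket q) powr real S"
          using nq by (intro order_trans[OF powr_mono2 powr_mono]) (auto simp: S_def)
        then have "bracket q' powr \<bar>s\<bar> \<le> (2 * n * bracket q) ^ S"
          using nq by (subst (asm) powr_realpow) auto
        then have "bracket (k + q') powr s \<le> bracket k powr s * (2 * n * bracket q) ^ S"
          by (intro order_trans[OF bracket_powr_shift mult_left_mono]) auto
        then show "norm (differences \<gamma> (\<lambda>l. b l x) (k + q')) \<le> E * (bracket k powr s * (2 * n * bracket q) ^ S)"
          using order_trans[OF E[OF \<gamma>] mult_left_mono[OF _ E0]] by blast
      qed (use E0 n in auto)
      also have "\<dots> \<le> n ^ N * bracket q ^ N * (E * (bracket k powr s * (2 * n * bracket q) ^ S))"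
        using E0 n by (intro mult_right_mono l1N) auto
      also have "\<dots> \<le> n ^ N * bracket q ^ N * (E * ((bracket k powr (s - real J) * (3 * n * bracket q) ^ J) * (2 * n * bracket q) ^ S))"
      proof -
        have "bracket k \<le> 3 * n * bracket q"
          using False l1 nq by (simp add: bracket_def)
        then have "bracket k ^ J \<le> (3 * n * bracket q) ^ J" by (intro power_mono) auto
        moreover have "bracket k powr s = bracket k powr (s - real J) * bracket k ^ J"
          by (simp add: powr_realpow[symmetric] powr_add[symmetric])
        ultimately have "bracket k powr s \<le> bracket k powr (s - real J) * (3 * n * bracket q) ^ J"
          by (simp add: mult_left_mono)
        then show ?thesis using E0 n by (intro mult_left_mono mult_right_mono) auto
      qed
      also have "\<dots> = n ^ N * (E * (2 * n) ^ S * (3 * n) ^ J) * (bracket q ^ (N + S + J) * bracket k powr (s - real J))"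
        by (simp add: power_mult_distrib power_add mult_ac)
      also have "\<dots> \<le> C * (bracket q ^ N * bracket k powr s + bracket q ^ (N + S + J) * bracket k powr (s - real J))"
        using n E0 C0 by (intro mult_mono) (auto simp: C_def)
      finally show ?thesis .
    qed
  qed
  with C0 show ?thesis by blast
qed

text \<open>For small \<open>q\<close> the coefficients must supply \<open>N + 2 * n\<close> powers
  of decay, which costs \<delta> times that number against the gain \<rho> N. For large
  \<open>q\<close> they supply \<open>S + J\<close> more, and \<open>J\<close> orders are gained in
  return.\<close>

lemma composition_rem_x_order_0:
  fixes a b :: "'n::{finite,linorder} lattice_symbol"
  assumes a: "a \<in> symb m" and b: "b \<in> symb m'"
  shows "x_order 0 (m + m' - (\<rho> - \<delta>) * real N + 2 * real CARD('n) * \<delta>) (composition_rem N a b)"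
proof -
  define n where "n = CARD('n)"
  define s where "s = m' - \<rho> * real N"
  define S where "S = nat \<lceil>\<bar>s\<bar>\<rceil>"
  define o' where "o' = m + m' - (\<rho> - \<delta>) * real N + 2 * real n * \<delta>"
  \<comment> \<open>Chosen so that the gain \<open>J\<close> outweighs the cost \<delta> (S + J) of
    the far region; possible as \<delta> < 1.\<close>
  obtain J :: nat where J: "\<delta> * real S / (1 - \<delta>) \<le> real J" using real_arch_simple by blast
  then have J': "\<delta> * real S + \<delta> * real J \<le> real J"
    using delta_less_1 by (simp add: pos_divide_le_eq algebra_simps)
  obtain C where C: "C \<ge> 0" "\<And>k q x. norm (newton_rem N (\<lambda>l. b l x) q k) \<le>
    C * (bracket q ^ N * bracket k powr s + bracket q ^ (N + S + J) * bracket k powr (s - real J))"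
    unfolding s_def S_def using newton_rem_symbol_bound[OF b] by blast
  obtain D where D: "D \<ge> 0" "\<And>k p. norm (fourier_coeff (a k) p) * bracket p ^ (N + 2 * n) \<le> D * bracket k powr (m + \<delta> * real (N + 2 * n))"
    using fourier_coeff_decay[OF a] by blast
  obtain E where E: "E \<ge> 0" "\<And>k p. norm (fourier_coeff (a k) p) * bracket p ^ (N + S + J + 2 * n) \<le> E * bracket k powr (m + \<delta> * real (N + S + J + 2 * n))"
    using fourier_coeff_decay[OF a] by blast
  let ?s = "\<lambda>q :: int ^ 'n::{finite,linorder}. 1 / bracket q ^ (2 * n)"
  have le: "norm (fourier_coeff (a k) q * torus_char q x * newton_rem N (\<lambda>l. b l x) q k)
      \<le> C * (D + E) * bracket k powr o' / bracket q ^ (2 * n)" for k q x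
  proof -
    let ?c = "norm (fourier_coeff (a k) q)"
    have "?c * norm (newton_rem N (\<lambda>l. b l x) q k) * bracket q ^ (2 * n) \<le>
       ?c * (C * (bracket q ^ N * bracket k powr s + bracket q ^ (N + S + J) * bracket k powr (s - real J))) * bracket q ^ (2 * n)"
      by (intro mult_right_mono mult_left_mono C) auto
    also have "\<dots> = C * ((?c * bracket q ^ (N + 2 * n)) * bracket k powr s + (?c * bracket q ^ (N + S + J + 2 * n)) * bracket k powr (s - real J))"
      by (simp add: power_add algebra_simps)
    also have "\<dots> \<le> C * ((D * bracket k powr (m + \<delta> * real (N + 2 * n))) * bracket k powr s
        + (E * bracket k powr (m + \<delta> * real (N + S + J + 2 * n))) * bracket k powr (s - real J))"
      using C(1) by (intro mult_left_mono add_mono mult_right_mono D E) auto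
    also have "\<dots> = C * (D * bracket k powr (m + \<delta> * real (N + 2 * n) + s) + E * bracket k powr (m + \<delta> * real (N + S + J + 2 * n) + (s - real J)))"
      by (simp only: powr_add mult.assoc)
    also have "\<dots> \<le> C * (D * bracket k powr o' + E * bracket k powr o')"
      using C(1) D(1) E(1) J'
      by (intro mult_left_mono add_mono bracket_powr_mono) (auto simp: o'_def s_def algebra_simps)
    finally show ?thesis
      by (subst pos_le_divide_eq) (auto simp: norm_mult algebra_simps)
  qed
  have "norm (composition_rem N a b k x) \<le> (C * (D + E) * infsum ?s UNIV) * bracket k powr o'" for k x
  proof -
    have "(?s has_sum infsum ?s UNIV) UNIV" unfolding n_def by (intro has_sum_infsum summable_on_bracket)
    from has_sum_cmult_right[OF this, of "C * (D + E) * bracket k powr o'"]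
    have "((\<lambda>q :: int ^ 'n::{finite,linorder}. C * (D + E) * bracket k powr o' / bracket q ^ (2 * n)) has_sum (C * (D + E) * bracket k powr o' * infsum ?s UNIV)) UNIV"
      by simp
    from norm_infsum_le[OF composition_rem_has_sum[OF a b] this le] show ?thesis
      by (simp add: mult_ac)
  qed
  then show ?thesis unfolding x_order_0 o'_def n_def by blast
qed

text \<open>Each derivative falls on one of the two factors and raises its order by \<delta>, as the
  definition of \<open>x_order\<close> allows, so the loss does not grow with
  \<open>n\<close>.\<close>

lemma composition_rem_x_order:
  fixes a b :: "'n::{finite,linorder} lattice_symbol"
  shows "a \<in> symb m \<Longrightarrow> b \<in> symb m' \<Longrightarrow>
    x_order n (m + m' - (\<rho> - \<delta>) * real N + 2 * real CARD('n) * \<delta>) (composition_rem N a b)"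
proof (induction n arbitrary: a b m m')
  case 0
  then show ?case by (rule composition_rem_x_order_0)
next
  case (Suc n)
  let ?o = "m + m' - (\<rho> - \<delta>) * real N + 2 * real CARD('n) * \<delta>"
  have "x_order n (?o + \<delta>) (symbol_deriv j (composition_rem N a b))" for j
  proof -
    have "x_order n ((m + \<delta>) + m' - (\<rho> - \<delta>) * real N + 2 * real CARD('n) * \<delta>) (composition_rem N (symbol_deriv j a) b)"
      "x_order n (m + (m' + \<delta>) - (\<rho> - \<delta>) * real N + 2 * real CARD('n) * \<delta>) (composition_rem N a (symbol_deriv j b))"
      by (rule Suc.IH[OF sym_deriv[OF Suc.prems(1)] Suc.prems(2)], rule Suc.IH[OF Suc.prems(1) sym_deriv[OF Suc.prems(2)]])
    moreover have "(m + \<delta>) + m' - (\<rho> - \<delta>) * real N + 2 * real CARD('n) * \<delta> = ?o + \<delta>"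
      "m + (m' + \<delta>) - (\<rho> - \<delta>) * real N + 2 * real CARD('n) * \<delta> = ?o + \<delta>" by simp_all
    ultimately show ?thesis
      unfolding composition_rem_deriv(2)[OF Suc.prems]
      by (simp only: x_order_add composition_rem_deriv(1)[OF sym_deriv[OF Suc.prems(1)] Suc.prems(2)]
          composition_rem_deriv(1)[OF Suc.prems(1) sym_deriv[OF Suc.prems(2)]])
  qed
  with Suc.IH[OF Suc.prems] show ?case by (simp add: x_order_Suc)
qed

theorem composition_expansion:
  fixes a b :: "'n::{finite,linorder} lattice_symbol"
  assumes a: "a \<in> symb m" and b: "b \<in> symb m'"
  shows "composition_rem N a b \<in> symb (m + m' - (\<rho> - \<delta>) * real N)"
proof (rule sym_remainder[where R = "\<lambda>N. composition_rem N a b" and c = "2 * real CARD('n) * \<delta>"])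
  show "smooth_symbol (composition_rem N a b)" for N by (rule composition_rem_deriv(1)[OF a b])
  show "(\<lambda>k x. composition_rem N a b k x - composition_rem (Suc N) a b k x) \<in> symb (m + m' - (\<rho> - \<delta>) * real N)" for N
    using composition_term_sym[OF a b, of N] by (simp add: composition_rem_def)
  show "x_order n (m + m' - (\<rho> - \<delta>) * real N + 2 * real CARD('n) * \<delta>) (composition_rem N a b)" for n N
    by (rule composition_rem_x_order[OF a b])
qed

lemma compose_sym:
  fixes a b :: "'n::{finite,linorder} lattice_symbol"
  assumes "a \<in> symb m" "b \<in> symb m'"
  shows "compose_symbol a b \<in> symb (m + m')"
  using composition_expansion[OF assms, of 0] by (simp add: composition_rem_def[abs_def])

end

section \<open>Parametrices of symbols\<close>

context symbol_orders begin

lemma compose_has_sum: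
  assumes "a \<in> symb m" "b \<in> symb m'"
  shows "((\<lambda>q. fourier_coeff (a k) q * torus_char q x * b (k + q) x) has_sum compose_symbol a b k x) UNIV"
  unfolding compose_symbol_def by (intro has_sum_infsum compose_summable[OF assms])

lemma compose_diff_right:
  assumes a: "a \<in> symb m" and b: "b \<in> symb m'" "b' \<in> symb m'"
  shows "compose_symbol a (\<lambda>k x. b k x - b' k x) = (\<lambda>k x. compose_symbol a b k x - compose_symbol a b' k x)"
proof (intro ext)
  fix k x
  have "((\<lambda>q. fourier_coeff (a k) q * torus_char q x * b (k + q) x + - (fourier_coeff (a k) q * torus_char q x * b' (k + q) x))
      has_sum compose_symbol a b k x + - compose_symbol a b' k x) UNIV"
    by (intro has_sum_add has_sum_uminusI compose_has_sum[OF a b(1)] compose_has_sum[OF a b(2)])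
  then show "compose_symbol a (\<lambda>k x. b k x - b' k x) k x = compose_symbol a b k x - compose_symbol a b' k x"
    using infsumI unfolding compose_symbol_def[of a "\<lambda>k x. b k x - b' k x"] by (simp add: right_diff_distrib)
qed

lemma compose_diff_left:
  assumes a: "a \<in> symb m" "a' \<in> symb m" and b: "b \<in> symb m'"
  shows "compose_symbol (\<lambda>k x. a k x - a' k x) b = (\<lambda>k x. compose_symbol a b k x - compose_symbol a' b k x)"
proof (intro ext)
  fix k x
  have "((\<lambda>q. fourier_coeff (a k) q * torus_char q x * b (k + q) x + - (fourier_coeff (a' k) q * torus_char q x * b (k + q) x))
      has_sum compose_symbol a b k x + - compose_symbol a' b k x) UNIV"
    by (intro has_sum_add has_sum_uminusI compose_has_sum[OF a(1) b] compose_has_sum[OF a(2) b])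
  moreover have "fourier_coeff (\<lambda>x. a k x - a' k x) q = fourier_coeff (a k) q - fourier_coeff (a' k) q" for q
    using a by (intro fourier_coeff_diff torus_smooth_continuous smooth_symbolD sym_smooth)
  ultimately show "compose_symbol (\<lambda>k x. a k x - a' k x) b k x = compose_symbol a b k x - compose_symbol a' b k x"
    using infsumI unfolding compose_symbol_def[of "\<lambda>k x. a k x - a' k x"] by (simp add: left_diff_distrib)
qed

lemma compose_add_right:
  assumes a: "a \<in> symb m" and b: "b \<in> symb m'" "b' \<in> symb m'"
  shows "compose_symbol a (\<lambda>k x. b k x + b' k x) = (\<lambda>k x. compose_symbol a b k x + compose_symbol a b' k x)"
  using compose_diff_right[OF a sym_add[OF b] b(2)] by (simp add: fun_eq_iff algebra_simps)

lemma compose_add_left: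
  assumes a: "a \<in> symb m" "a' \<in> symb m" and b: "b \<in> symb m'"
  shows "compose_symbol (\<lambda>k x. a k x + a' k x) b = (\<lambda>k x. compose_symbol a b k x + compose_symbol a' b k x)"
  using compose_diff_left[OF sym_add[OF a] a(2) b] by (simp add: fun_eq_iff algebra_simps)

lemma compose_0_right: "a \<in> symb m \<Longrightarrow> compose_symbol a (\<lambda>k x. 0) = (\<lambda>k x. 0)"
  by (simp add: compose_symbol_def[abs_def])

lemma compose_0_left: "b \<in> symb m \<Longrightarrow> compose_symbol (\<lambda>k x. 0) b = (\<lambda>k x. 0)"
  by (simp add: compose_symbol_def[abs_def] fourier_coeff_def)

lemma compose_sum_right:
  assumes a: "a \<in> symb m" and b: "\<And>i. i \<in> I \<Longrightarrow> b i \<in> symb m'"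
  shows "compose_symbol a (\<lambda>k x. \<Sum>i\<in>I. b i k x) = (\<lambda>k x. \<Sum>i\<in>I. compose_symbol a (b i) k x)"
  using b
proof (induction I rule: infinite_finite_induct)
  case (insert i I)
  have "compose_symbol a (\<lambda>k x. b i k x + (\<Sum>i\<in>I. b i k x))
      = (\<lambda>k x. compose_symbol a (b i) k x + compose_symbol a (\<lambda>k x. \<Sum>i\<in>I. b i k x) k x)"
    by (rule compose_add_right[OF a]) (auto intro: insert.prems sym_sum)
  with insert show ?case by simp
qed (simp_all add: compose_0_right[OF a])

lemma compose_sum_left:
  assumes a: "\<And>i. i \<in> I \<Longrightarrow> a i \<in> symb m" and b: "b \<in> symb m'"
  shows "compose_symbol (\<lambda>k x. \<Sum>i\<in>I. a i k x) b = (\<lambda>k x. \<Sum>i\<in>I. compose_symbol (a i) b k x)"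
  using a
proof (induction I rule: infinite_finite_induct)
  case (insert i I)
  have "compose_symbol (\<lambda>k x. a i k x + (\<Sum>i\<in>I. a i k x)) b
      = (\<lambda>k x. compose_symbol (a i) b k x + compose_symbol (\<lambda>k x. \<Sum>i\<in>I. a i k x) b k x)"
    by (rule compose_add_left[OF _ _ b]) (auto intro: insert.prems sym_sum)
  with insert show ?case by simp
qed (simp_all add: compose_0_left[OF b])

text \<open>Composition of operators is associative and a symbol is determined by its operator; the
  double series are never rearranged.\<close>

lemma compose_assoc:
  fixes a b c :: "'n::{finite,linorder} lattice_symbol"
  assumes a: "a \<in> symb m" and b: "b \<in> symb m'" and c: "c \<in> symb m''"
  shows "compose_symbol (compose_symbol a b) c = compose_symbol a (compose_symbol b c)"
proof (rule Op_inject)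
  note ab = compose_sym[OF a b] and bc = compose_sym[OF b c]
  show "smooth_symbol (compose_symbol (compose_symbol a b) c)" "smooth_symbol (compose_symbol a (compose_symbol b c))"
    by (rule smooth_compose_symbol[OF ab c], rule smooth_compose_symbol[OF a bc])
  fix f :: "int ^ 'n::{finite,linorder} \<Rightarrow> complex" assume f: "f \<in> rapidly_decreasing"
  show "Op (compose_symbol (compose_symbol a b) c) f = Op (compose_symbol a (compose_symbol b c)) f"
    by (simp only: Op_compose[OF ab c f, symmetric] Op_compose[OF a bc f, symmetric] Op_compose[OF b c f, symmetric]
        Op_compose[OF a b Op_rapidly_decreasing[OF c f], symmetric])
qed

lemma compose_1_left:
  assumes b: "b \<in> symb m" shows "compose_symbol (\<lambda>k x. 1) b = b"
proof (rule Op_inject)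
  fix f :: "int ^ 'a \<Rightarrow> complex" assume f: "f \<in> rapidly_decreasing"
  show "Op (compose_symbol (\<lambda>k x. 1) b) f = Op b f"
    by (simp only: Op_compose[OF sym_const b f, symmetric] Op_one[OF Op_rapidly_decreasing[OF b f]])
qed (rule smooth_compose_symbol[OF sym_const b], rule sym_smooth[OF b])

lemma compose_1_right:
  assumes a: "a \<in> symb m" shows "compose_symbol a (\<lambda>k x. 1) = a"
proof (rule Op_inject)
  fix f :: "int ^ 'a \<Rightarrow> complex" assume f: "f \<in> rapidly_decreasing"
  show "Op (compose_symbol a (\<lambda>k x. 1)) f = Op a f"
    by (simp only: Op_compose[OF a sym_const f, symmetric] Op_one[OF f])
qed (rule smooth_compose_symbol[OF a sym_const], rule sym_smooth[OF a])

definition smoothing :: "'n::finite lattice_symbol \<Rightarrow> bool" where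
  "smoothing \<sigma> \<longleftrightarrow> (\<forall>m. \<sigma> \<in> symb m)"

lemma smoothingI:
  assumes "\<And>N. \<sigma> \<in> symb (m - (\<rho> - \<delta>) * real N)"
  shows "smoothing \<sigma>"
  unfolding smoothing_def
proof
  fix l
  obtain N :: nat where "(m - l) / (\<rho> - \<delta>) \<le> real N" using real_arch_simple by blast
  then have "m - (\<rho> - \<delta>) * real N \<le> l" using eps_pos by (simp add: pos_divide_le_eq mult.commute)
  then show "\<sigma> \<in> symb l" by (rule sym_mono[OF assms])
qed

lemma smoothing_add: "smoothing \<sigma> \<Longrightarrow> smoothing \<tau> \<Longrightarrow> smoothing (\<lambda>k x. \<sigma> k x + \<tau> k x)"
  by (simp add: smoothing_def sym_add)

lemma smoothing_diff: "smoothing \<sigma> \<Longrightarrow> smoothing \<tau> \<Longrightarrow> smoothing (\<lambda>k x. \<sigma> k x - \<tau> k x)"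
  by (simp add: smoothing_def sym_minus)

lemma smoothing_compose_right:
  fixes a :: "'n::{finite,linorder} lattice_symbol"
  assumes "a \<in> symb m" "smoothing \<sigma>" shows "smoothing (compose_symbol a \<sigma>)"
  unfolding smoothing_def
proof
  fix l
  have "\<sigma> \<in> symb (l - m)" using assms(2) by (simp add: smoothing_def)
  from compose_sym[OF assms(1) this] show "compose_symbol a \<sigma> \<in> symb l" by simp
qed

lemma smoothing_compose_left:
  fixes a :: "'n::{finite,linorder} lattice_symbol"
  assumes "a \<in> symb m" "smoothing \<sigma>" shows "smoothing (compose_symbol \<sigma> a)"
  unfolding smoothing_def
proof
  fix l
  have "\<sigma> \<in> symb (l - m)" using assms(2) by (simp add: smoothing_def)
  from compose_sym[OF this assms(1)] show "compose_symbol \<sigma> a \<in> symb l" by simp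
qed

lemma composition_term_0: "composition_term 0 a b k x = a k x * b k x"
proof -
  have "{\<gamma> :: nat ^ 'a::{finite,linorder}. mi_abs \<gamma> = 0} = {0}"
    by (auto simp: mi_abs_def vec_eq_iff)
  then show ?thesis by (simp add: composition_term_def mi_fact_def)
qed

lemma compose_minus_mult_sym:
  fixes a b :: "'n::{finite,linorder} lattice_symbol"
  assumes "a \<in> symb m" "b \<in> symb m'"
  shows "(\<lambda>k x. compose_symbol a b k x - a k x * b k x) \<in> symb (m + m' - (\<rho> - \<delta>))"
  using composition_expansion[OF assms, of 1]
  by (simp add: composition_rem_def[abs_def] composition_term_0)

primrec compose_power :: "'n::finite lattice_symbol \<Rightarrow> nat \<Rightarrow> 'n lattice_symbol" where
  "compose_power r 0 = (\<lambda>k x. 1)"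
| "compose_power r (Suc j) = compose_symbol (compose_power r j) r"

text \<open>The candidate \<open>s\<close> is the asymptotic sum of the powers of \<open>r\<close>.
  A partial sum composed with \<open>1 - r\<close> telescopes to 1 minus the power \<open>N\<close>
  of \<open>r\<close>; that power and the difference of \<open>s\<close> and the partial sum both
  have order -(\<rho> - \<delta>) N.\<close>

lemma neumann_series:
  fixes r :: "'n::{finite,linorder} lattice_symbol"
  assumes r: "r \<in> symb (- (\<rho> - \<delta>))"
  shows "\<exists>s \<in> symb 0. smoothing (\<lambda>k x. compose_symbol s (\<lambda>k x. 1 - r k x) k x - 1) \<and>
    smoothing (\<lambda>k x. compose_symbol (\<lambda>k x. 1 - r k x) s k x - 1)"
proof -
  let ?q = "\<lambda>k x. 1 - r k x"
  let ?p = "compose_power r"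
  have r0: "r \<in> symb 0" using r eps_pos by (auto intro: sym_mono)
  have q: "?q \<in> symb 0" by (intro sym_minus sym_const r0)
  have p: "?p j \<in> symb (0 - (\<rho> - \<delta>) * real j)" for j
  proof (induction j)
    case (Suc j)
    from compose_sym[OF this r] show ?case by (simp add: algebra_simps)
  qed (simp add: sym_const)
  have p0: "?p j \<in> symb 0" for j
    using eps_pos by (intro sym_mono[OF p]) simp
  \<comment> \<open>Powers are built by multiplication from the right; the telescoping for the
    inverse on the other side needs a factor \<open>r\<close> on the left.\<close>
  have comm: "compose_symbol r (?p j) = ?p (Suc j)" for j
  proof (induction j)
    case 0
    show ?case using compose_1_left[OF r] compose_1_right[OF r] by simp
  next
    case (Suc j)
    have "compose_symbol r (?p (Suc j)) = compose_symbol (compose_symbol r (?p j)) r"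
      using compose_assoc[OF r p r, of j] by simp
    with Suc show ?case by simp
  qed
  obtain s where s: "s \<in> symb 0"
    "\<And>N. (\<lambda>k x. s k x - (\<Sum>j<N. ?p j k x)) \<in> symb (0 - (\<rho> - \<delta>) * real N)"
    using asymptotic_sum_exists[of ?p 0, OF p] by blast
  let ?S = "\<lambda>N k x. \<Sum>j<N. ?p j k x"
  have S: "?S N \<in> symb 0" for N by (intro sym_sum p0)
  have left: "compose_symbol (?S N) ?q = (\<lambda>k x. 1 - ?p N k x)" for N
  proof -
    have "compose_symbol (?p j) ?q = (\<lambda>k x. ?p j k x - ?p (Suc j) k x)" for j
      using compose_diff_right[OF p0 sym_const r0] by (simp add: compose_1_right[OF p0])
    then have "compose_symbol (?S N) ?q = (\<lambda>k x. \<Sum>j<N. ?p j k x - ?p (Suc j) k x)"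
      using compose_sum_left[of "{..<N}" ?p, OF p0 q] by simp
    moreover have "(\<Sum>j<N. ?p j k x - ?p (Suc j) k x) = 1 - ?p N k x" for k x
      by (induction N) simp_all
    ultimately show ?thesis by presburger
  qed
  have right: "compose_symbol ?q (?S N) = (\<lambda>k x. 1 - ?p N k x)" for N
  proof -
    have "compose_symbol ?q (?p j) = (\<lambda>k x. ?p j k x - ?p (Suc j) k x)" for j
      using compose_diff_left[OF sym_const r0 p0] by (simp only: compose_1_left[OF p0] comm)
    then have "compose_symbol ?q (?S N) = (\<lambda>k x. \<Sum>j<N. ?p j k x - ?p (Suc j) k x)"
      using compose_sum_right[OF q, of "{..<N}" ?p, OF p0] by simp
    moreover have "(\<Sum>j<N. ?p j k x - ?p (Suc j) k x) = 1 - ?p N k x" for k x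
      by (induction N) simp_all
    ultimately show ?thesis by presburger
  qed
  have "smoothing (\<lambda>k x. compose_symbol s ?q k x - 1)"
  proof (rule smoothingI)
    fix N
    let ?t = "\<lambda>k x. s k x - ?S N k x"
    have "compose_symbol ?t ?q = (\<lambda>k x. compose_symbol s ?q k x - (1 - ?p N k x))"
      using compose_diff_left[OF s(1) S q] left by simp
    then have "(\<lambda>k x. compose_symbol s ?q k x - 1) = (\<lambda>k x. compose_symbol ?t ?q k x - ?p N k x)"
      by (simp add: fun_eq_iff)
    also have "\<dots> \<in> symb (0 - (\<rho> - \<delta>) * real N)"
      using compose_sym[OF s(2) q, of N] by (intro sym_minus p) simp
    finally show "(\<lambda>k x. compose_symbol s ?q k x - 1) \<in> symb (0 - (\<rho> - \<delta>) * real N)" .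
  qed
  moreover have "smoothing (\<lambda>k x. compose_symbol ?q s k x - 1)"
  proof (rule smoothingI)
    fix N
    let ?t = "\<lambda>k x. s k x - ?S N k x"
    have "compose_symbol ?q ?t = (\<lambda>k x. compose_symbol ?q s k x - (1 - ?p N k x))"
      using compose_diff_right[OF q s(1) S] right by simp
    then have "(\<lambda>k x. compose_symbol ?q s k x - 1) = (\<lambda>k x. compose_symbol ?q ?t k x - ?p N k x)"
      by (simp add: fun_eq_iff)
    also have "\<dots> \<in> symb (0 - (\<rho> - \<delta>) * real N)"
      using compose_sym[OF q s(2), of N] by (intro sym_minus p) simp
    finally show "(\<lambda>k x. compose_symbol ?q s k x - 1) \<in> symb (0 - (\<rho> - \<delta>) * real N)" .
  qed
  ultimately show ?thesis using s(1) by blast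
qed

text \<open>A left and a right parametrix differ by a smoothing symbol, so the left one is also a right one.\<close>

lemma parametrix_from_approximate_inverse:
  fixes a b :: "'n::{finite,linorder} lattice_symbol"
  assumes a: "a \<in> symb \<mu>" and b: "b \<in> symb (- \<mu>)"
    and ba: "(\<lambda>k x. 1 - compose_symbol b a k x) \<in> symb (- (\<rho> - \<delta>))"
    and ab: "(\<lambda>k x. 1 - compose_symbol a b k x) \<in> symb (- (\<rho> - \<delta>))"
  shows "\<exists>c \<in> symb (- \<mu>). smoothing (\<lambda>k x. compose_symbol c a k x - 1) \<and> smoothing (\<lambda>k x. compose_symbol a c k x - 1)"
proof -
  obtain s where s: "s \<in> symb 0" "smoothing (\<lambda>k x. compose_symbol s (compose_symbol b a) k x - 1)"
    using neumann_series[OF ba] by auto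
  obtain t where t: "t \<in> symb 0" "smoothing (\<lambda>k x. compose_symbol (compose_symbol a b) t k x - 1)"
    using neumann_series[OF ab] by auto
  define l where "l = compose_symbol s b"
  define r where "r = compose_symbol b t"
  have l: "l \<in> symb (- \<mu>)" using compose_sym[OF s(1) b] by (simp add: l_def)
  have r: "r \<in> symb (- \<mu>)" using compose_sym[OF b t(1)] by (simp add: r_def)
  define e where "e = (\<lambda>k x. compose_symbol l a k x - 1)"
  define f where "f = (\<lambda>k x. compose_symbol a r k x - 1)"
  have e: "smoothing e" using s(2) compose_assoc[OF s(1) b a] by (simp add: e_def l_def)
  have f: "smoothing f" using t(2) compose_assoc[OF a b t(1)] by (simp add: f_def r_def)
  have la: "compose_symbol l a \<in> symb 0" using compose_sym[OF l a] by simp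
  have ar: "compose_symbol a r \<in> symb 0" using compose_sym[OF a r] by simp
  have er: "smoothing (compose_symbol e r)" by (rule smoothing_compose_left[OF r e])
  have lf: "smoothing (compose_symbol l f)" by (rule smoothing_compose_right[OF l f])
  have "compose_symbol e r = (\<lambda>k x. compose_symbol (compose_symbol l a) r k x - r k x)"
    unfolding e_def using compose_diff_left[OF la sym_const r] by (simp add: compose_1_left[OF r])
  moreover have "compose_symbol l f = (\<lambda>k x. compose_symbol l (compose_symbol a r) k x - l k x)"
    unfolding f_def using compose_diff_right[OF l ar sym_const] by (simp add: compose_1_right[OF l])
  \<comment> \<open>Evaluating l a r in two ways, as (1 + e) r and as l (1 + f), gives l - r = e r -
    l f.\<close>
  ultimately have lr: "(\<lambda>k x. l k x - r k x) = (\<lambda>k x. compose_symbol e r k x - compose_symbol l f k x)"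
    using compose_assoc[OF l a r] by (simp add: fun_eq_iff)
  have "smoothing (compose_symbol a (\<lambda>k x. l k x - r k x))"
    unfolding lr by (intro smoothing_compose_right[OF a] smoothing_diff er lf)
  then have "smoothing (\<lambda>k x. compose_symbol a l k x - compose_symbol a r k x)"
    by (simp add: compose_diff_right[OF a l r])
  from smoothing_add[OF this f] have "smoothing (\<lambda>k x. compose_symbol a l k x - 1)"
    by (simp add: f_def)
  with l e show ?thesis unfolding e_def by blast
qed

lemma elliptic_symbol_reciprocal:
  assumes a: "a \<in> symb \<mu>" and el: "elliptic_symbol \<rho> \<delta> \<mu> a"
    and nz: "\<And>k x. M \<le> norm (rvec k) \<Longrightarrow> a k x \<noteq> 0"
  shows "(\<lambda>k x. if M \<le> norm (rvec k) then 1 / a k x else 0) \<in> symb (- \<mu>)"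
proof -
  obtain C M' where C: "C > 0" "\<And>k x. M' \<le> norm (rvec k) \<Longrightarrow> C * bracket k powr \<mu> \<le> norm (a k x)"
    using el unfolding elliptic_symbol_def by blast
  show ?thesis by (rule sym_reciprocal[OF a _ C]) (rule nz)
qed

lemma elliptic_symbol_nonzero:
  assumes "elliptic_symbol \<rho> \<delta> \<mu> a"
  shows "\<exists>M>0. \<forall>k x. M \<le> norm (rvec k) \<longrightarrow> a k x \<noteq> 0"
proof -
  obtain C M where "C > 0" "M > 0" "\<And>k x. M \<le> norm (rvec k) \<Longrightarrow> C * bracket k powr \<mu> \<le> norm (a k x)"
    using assms unfolding elliptic_symbol_def by blast
  then show ?thesis
    by (intro exI[of _ M]) (metis bracket_powr_pos mult_pos_pos norm_zero not_less)
qed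

text \<open>Pointwise multiplication is commutative, so one cut-off reciprocal is an approximate
  inverse on both sides: either symbol product differs from the pointwise one by an order lower by
  \<open>\<rho> - \<delta>\<close>.\<close>

lemma elliptic_imp_parametrix:
  fixes a :: "'n::{finite,linorder} lattice_symbol"
  assumes a: "a \<in> symb \<mu>" and el: "elliptic_symbol \<rho> \<delta> \<mu> a"
  shows "\<exists>c \<in> symb (- \<mu>). smoothing (\<lambda>k x. compose_symbol c a k x - 1) \<and> smoothing (\<lambda>k x. compose_symbol a c k x - 1)"
proof -
  obtain M where M: "\<And>k x. M \<le> norm (rvec k) \<Longrightarrow> a k x \<noteq> 0"
    using elliptic_symbol_nonzero[OF el] by blast
  define b where "b = (\<lambda>k x. if M \<le> norm (rvec k) then 1 / a k x else 0)"
  have b: "b \<in> symb (- \<mu>)" unfolding b_def by (rule elliptic_symbol_reciprocal[OF a el M])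
  have ba: "(\<lambda>k x. 1 - b k x * a k x) \<in> symb m" for m
  proof (rule sym_finite_support[of _ M])
    show "smooth_symbol (\<lambda>k x. 1 - b k x * a k x)"
      by (intro smooth_symbol_minus smooth_symbol_mult smooth_symbol_const sym_smooth[OF a] sym_smooth[OF b])
  qed (simp add: b_def M)
  show ?thesis
  proof (rule parametrix_from_approximate_inverse[OF a b])
    show "(\<lambda>k x. 1 - compose_symbol b a k x) \<in> symb (- (\<rho> - \<delta>))"
      using sym_minus[OF ba compose_minus_mult_sym[OF b a]] by simp
    show "(\<lambda>k x. 1 - compose_symbol a b k x) \<in> symb (- (\<rho> - \<delta>))"
      using sym_minus[OF ba compose_minus_mult_sym[OF a b]] by (simp add: mult.commute)
  qed
qed

lemma eventually_small:
  assumes "\<sigma> \<in> symb (m - (\<rho> - \<delta>))" "c > 0"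
  shows "\<exists>M>0. \<forall>k x. M \<le> norm (rvec k) \<longrightarrow> norm (\<sigma> k x) \<le> c * bracket k powr m"
proof -
  obtain K where K: "K > 0" "\<And>k x. norm (\<sigma> k x) \<le> K * bracket k powr (m - (\<rho> - \<delta>))"
    using sym_bound[OF assms(1)] by blast
  \<comment> \<open>The radius at which \<open>K * bracket k powr (- (\<rho> - \<delta>))\<close>
    has dropped to \<open>c\<close>.\<close>
  define M where "M = (K / c) powr (1 / (\<rho> - \<delta>))"
  have "M > 0" using K(1) assms(2) by (simp add: M_def)
  moreover have "norm (\<sigma> k x) \<le> c * bracket k powr m" if "M \<le> norm (rvec k)" for k x
  proof -
    have "M powr (\<rho> - \<delta>) \<le> bracket k powr (\<rho> - \<delta>)"
      using that \<open>M > 0\<close> eps_pos by (intro powr_mono2) (auto simp: bracket_def)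
    moreover have "M powr (\<rho> - \<delta>) = K / c"
      using K(1) assms(2) eps_pos by (simp add: M_def powr_powr powr_one)
    ultimately have "K \<le> c * bracket k powr (\<rho> - \<delta>)"
      using assms(2) by (simp add: pos_divide_le_eq mult.commute)
    then have "K * bracket k powr (m - (\<rho> - \<delta>)) \<le> c * bracket k powr (\<rho> - \<delta>) * bracket k powr (m - (\<rho> - \<delta>))"
      by (intro mult_right_mono) auto
    also have "\<dots> = c * bracket k powr m"
      by (simp add: mult.assoc powr_add[symmetric])
    finally show ?thesis using order_trans[OF K(2)] by blast
  qed
  ultimately show ?thesis by blast
qed

text \<open>Far out the product \<open>b k x * a k x\<close> is within 1/2 of 1, and
  \<open>b\<close> is at most \<open>B\<close> times the power of order -\<mu>; dividing gives the
  lower bound for \<open>a\<close> with constant \<open>1 / (2 * B)\<close>.\<close>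

lemma left_parametrix_imp_elliptic:
  fixes a b :: "'n::{finite,linorder} lattice_symbol"
  assumes a: "a \<in> symb \<mu>" and b: "b \<in> symb (- \<mu>)" and ba: "smoothing (\<lambda>k x. compose_symbol b a k x - 1)"
  shows "elliptic_symbol \<rho> \<delta> \<mu> a"
proof -
  have "(\<lambda>k x. (compose_symbol b a k x - 1) - (compose_symbol b a k x - b k x * a k x)) \<in> symb (0 - (\<rho> - \<delta>))"
    using ba compose_minus_mult_sym[OF b a] by (intro sym_minus[of "\<lambda>k x. compose_symbol b a k x - 1"]) (auto simp: smoothing_def)
  then have "(\<lambda>k x. b k x * a k x - 1) \<in> symb (0 - (\<rho> - \<delta>))" by simp
  from eventually_small[OF this, of "1/2"]
  obtain M where M: "M > 0" "\<And>k x. M \<le> norm (rvec k) \<Longrightarrow> norm (b k x * a k x - 1) \<le> 1/2"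
    by auto
  obtain B where B: "B > 0" "\<And>k x. norm (b k x) \<le> B * bracket k powr (- \<mu>)"
    using sym_bound[OF b] by blast
  have "1 / (2 * B) * bracket k powr \<mu> \<le> norm (a k x)" if "M \<le> norm (rvec k)" for k x
  proof -
    have "1/2 \<le> norm (b k x * a k x)"
      using M(2)[OF that, of x] norm_triangle_ineq3[of "b k x * a k x" 1] by simp
    also have "\<dots> \<le> B * bracket k powr (- \<mu>) * norm (a k x)"
      unfolding norm_mult by (intro mult_right_mono B) auto
    finally have "1/2 * bracket k powr \<mu> \<le> B * bracket k powr (- \<mu>) * norm (a k x) * bracket k powr \<mu>"
      by (intro mult_right_mono) auto
    also have "\<dots> = B * norm (a k x)"
      by (simp add: powr_minus)
    finally show ?thesis using B(1) by (simp add: field_simps)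
  qed
  then show ?thesis
    unfolding elliptic_symbol_def symbol_class_eq_sym using a M(1) B(1)
    by (intro conjI a exI[of _ "1 / (2 * B)"] exI[of _ M]) auto
qed

text \<open>The recursion divides by the leading symbol, not by the symbol of \<open>A\<close>. They
  differ by lower order, so far out half of the ellipticity constant survives.\<close>

lemma elliptic_leading_symbol:
  fixes a a0 :: "'n::{finite,linorder} lattice_symbol"
  assumes el: "elliptic_symbol \<rho> \<delta> \<mu> a" and a0: "a0 \<in> symb \<mu>"
    and diff: "(\<lambda>k x. a k x - a0 k x) \<in> symb (\<mu> - (\<rho> - \<delta>))"
  shows "elliptic_symbol \<rho> \<delta> \<mu> a0"
proof -
  obtain C M where C: "C > 0" "M > 0" "\<And>k x. M \<le> norm (rvec k) \<Longrightarrow> C * bracket k powr \<mu> \<le> norm (a k x)"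
    using el unfolding elliptic_symbol_def by blast
  obtain M' where M': "M' > 0" "\<And>k x. M' \<le> norm (rvec k) \<Longrightarrow> norm (a k x - a0 k x) \<le> C / 2 * bracket k powr \<mu>"
    using eventually_small[OF diff, of "C / 2"] C(1) by auto
  have "C / 2 * bracket k powr \<mu> \<le> norm (a0 k x)" if "max M M' \<le> norm (rvec k)" for k x
  proof -
    have "C * bracket k powr \<mu> \<le> norm (a k x)"
      by (rule C(3)) (use that in simp)
    moreover have "norm (a k x - a0 k x) \<le> C / 2 * bracket k powr \<mu>"
      by (rule M'(2)) (use that in simp)
    ultimately show ?thesis using norm_triangle_ineq2[of "a k x" "a0 k x"] by simp
  qed
  then show ?thesis
    unfolding elliptic_symbol_def symbol_class_eq_sym using a0 C M'
    by (intro conjI exI[of _ "C / 2"] exI[of _ "max M M'"]) auto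
qed

section \<open>The recursion for the parametrix\<close>

text \<open>The cutoff at \<open>M\<close> is sharp; only finitely many \<open>k\<close> are affected.\<close>

function parametrix_symbol :: "real \<Rightarrow> (nat \<Rightarrow> 'n::{finite,linorder} lattice_symbol) \<Rightarrow> nat \<Rightarrow> 'n lattice_symbol" where
  "parametrix_symbol M a N = (\<lambda>k x. if M \<le> norm (rvec k) then
     (if N = 0 then 1 / a 0 k x
      else parametrix_term a (\<lambda>j. if j < N then parametrix_symbol M a j else (\<lambda>k x. 0)) N k x) else 0)"
  by auto
termination by (relation "Wellfounded.measure (\<lambda>(M, a, N). N)") auto

declare parametrix_symbol.simps [simp del]

text \<open>The sum over \<gamma> is a term of the composition formula of degree
  \<open>N - j - l\<close>; the condition \<open>j + l \<le> N\<close> guards the truncated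
  subtraction.\<close>

lemma parametrix_term_eq:
  "parametrix_term a b N k x = - 1 / a 0 k x *
    (\<Sum>j<N. \<Sum>l\<le>N. if j + l \<le> N then composition_term (N - j - l) (b j) (a l) k x else 0)"
proof -
  have "(\<Sum>\<gamma> | mi_abs \<gamma> + j + l = N. 1 / of_nat (mi_fact \<gamma>) * falling_derivs \<gamma> (b j k) x * differences \<gamma> (\<lambda>m. a l m x) k)
      = (if j + l \<le> N then composition_term (N - j - l) (b j) (a l) k x else 0)" for j l
  proof (cases "j + l \<le> N")
    case True
    then have "mi_abs \<gamma> + j + l = N \<longleftrightarrow> mi_abs \<gamma> = N - j - l" for \<gamma> :: "nat ^ 'a::{finite,linorder}" by auto
    with True show ?thesis by (simp add: composition_term_def)
  next
    case False
    then have "{\<gamma> :: nat ^ 'a::{finite,linorder}. mi_abs \<gamma> + j + l = N} = {}" by auto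
    with False show ?thesis by simp
  qed
  then show ?thesis by (simp add: parametrix_term_def)
qed

lemma parametrix_symbol_0:
  "parametrix_symbol M a 0 = (\<lambda>k x. if M \<le> norm (rvec k) then 1 / a 0 k x else 0)"
  by (subst parametrix_symbol.simps) (simp cong: if_cong)

text \<open>The restriction to \<open>j < N\<close> in the definition of
  \<open>parametrix_symbol\<close> makes the recursion terminate and leaves no trace, because
  \<open>parametrix_term\<close> evaluates its argument only at such \<open>j\<close>.\<close>

lemma parametrix_symbol_recursion:
  assumes "0 < N" "M \<le> norm (rvec k)"
  shows "parametrix_symbol M a N k x = parametrix_term a (parametrix_symbol M a) N k x"
proof -
  have "parametrix_term a (\<lambda>j. if j < N then parametrix_symbol M a j else (\<lambda>k x. 0)) N k x
      = parametrix_term a (parametrix_symbol M a) N k x"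
    unfolding parametrix_term_eq by (intro arg_cong2[where f = "(*)"] refl sum.cong) simp
  with assms show ?thesis by (subst parametrix_symbol.simps) simp
qed

text \<open>The cutoff sits entirely in the factor \<open>parametrix_symbol M a 0\<close>, so the
  recursion becomes an identity of symbols valid at all \<open>k\<close>, to which the calculus
  applies.\<close>

lemma parametrix_symbol_pos:
  assumes "0 < N"
  shows "parametrix_symbol M a N = (\<lambda>k x. (- 1) * (parametrix_symbol M a 0 k x *
    (\<Sum>j<N. \<Sum>l\<le>N. if j + l \<le> N then composition_term (N - j - l) (parametrix_symbol M a j) (a l) k x else 0)))"
proof (intro ext)
  fix k x
  show "parametrix_symbol M a N k x = (- 1) * (parametrix_symbol M a 0 k x *
    (\<Sum>j<N. \<Sum>l\<le>N. if j + l \<le> N then composition_term (N - j - l) (parametrix_symbol M a j) (a l) k x else 0))"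
  proof (cases "M \<le> norm (rvec k)")
    case True
    then show ?thesis
      by (simp only: parametrix_symbol_recursion[OF assms True] parametrix_term_eq parametrix_symbol_0 if_True) simp
  next
    case False
    then show ?thesis using assms by (simp add: parametrix_symbol_0) (simp add: parametrix_symbol.simps)
  qed
qed

context
  fixes a :: "'n::{finite,linorder} lattice_symbol" and as :: "nat \<Rightarrow> 'n lattice_symbol" and \<mu> M :: real
  assumes as: "\<And>l. as l \<in> symb (\<mu> - (\<rho> - \<delta>) * real l)"
    and elliptic: "elliptic_symbol \<rho> \<delta> \<mu> (as 0)"
    and nonzero: "\<And>k x. M \<le> norm (rvec k) \<Longrightarrow> as 0 k x \<noteq> 0"
begin

text \<open>In each summand the lowering of the order by \<open>j\<close> steps from the earlier
  term, \<open>l\<close> from the expansion of \<open>A\<close> and \<open>N - j - l\<close> from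
  the composition formula adds up to \<open>N\<close> steps.\<close>

lemma parametrix_symbol_sym: "parametrix_symbol M as N \<in> symb (- \<mu> - (\<rho> - \<delta>) * real N)"
proof (induction N rule: less_induct)
  case (less N)
  have 0: "parametrix_symbol M as 0 \<in> symb (- \<mu>)"
    unfolding parametrix_symbol_0 using as[of 0] by (intro elliptic_symbol_reciprocal elliptic nonzero) auto
  show ?case
  proof (cases "N = 0")
    case False
    then have N: "0 < N" by simp
    let ?c = "\<lambda>j l k x. if j + l \<le> N then composition_term (N - j - l) (parametrix_symbol M as j) (as l) k x else 0"
    have c: "?c j l \<in> symb (- (\<rho> - \<delta>) * real N)" if j: "j < N" for j l
    proof (cases "j + l \<le> N")
      case True
      have "composition_term (N - j - l) (parametrix_symbol M as j) (as l)
          \<in> symb ((- \<mu> - (\<rho> - \<delta>) * real j) + (\<mu> - (\<rho> - \<delta>) * real l) - (\<rho> - \<delta>) * real (N - j - l))"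
        by (intro composition_term_sym less.IH as j)
      also have "(- \<mu> - (\<rho> - \<delta>) * real j) + (\<mu> - (\<rho> - \<delta>) * real l) - (\<rho> - \<delta>) * real (N - j - l) = - (\<rho> - \<delta>) * real N"
        using True by (simp add: of_nat_diff algebra_simps)
      finally show ?thesis using True by (simp add: if_distrib)
    qed (simp add: sym_0)
    have "(\<lambda>k x. (- 1) * (parametrix_symbol M as 0 k x * (\<Sum>j<N. \<Sum>l\<le>N. ?c j l k x))) \<in> symb (- \<mu> + - (\<rho> - \<delta>) * real N)"
      by (intro sym_cmult sym_mult 0 sym_sum c) simp
    also have "- \<mu> + - (\<rho> - \<delta>) * real N = - \<mu> - (\<rho> - \<delta>) * real N" by (simp add: algebra_simps)
    finally show ?thesis unfolding parametrix_symbol_pos[OF N] .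
  qed (use 0 in simp)
qed

text \<open>The recursion is made for this: among the terms of total degree \<open>s\<close>, the
  one with \<open>j = s\<close> is \<open>parametrix_symbol M as s\<close> times
  \<open>as 0\<close>, which by construction cancels all others.\<close>

lemma composition_term_collect:
  assumes "M \<le> norm (rvec k)"
  shows "(\<Sum>j\<le>s. \<Sum>l\<le>s. if j + l \<le> s then composition_term (s - j - l) (parametrix_symbol M as j) (as l) k x else 0)
    = (if s = 0 then 1 else 0)"
proof (cases "s = 0")
  case True
  then show ?thesis using assms nonzero[OF assms, of x] by (simp add: composition_term_0 parametrix_symbol_0)
next
  case False
  then have s: "0 < s" by simp
  let ?c = "\<lambda>j l. if j + l \<le> s then composition_term (s - j - l) (parametrix_symbol M as j) (as l) k x else 0"
  have "(\<Sum>j\<le>s. \<Sum>l\<le>s. ?c j l) = (\<Sum>j<s. \<Sum>l\<le>s. ?c j l) + (\<Sum>l\<le>s. ?c s l)"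
    by (simp add: lessThan_Suc_atMost[symmetric])
  also have "(\<Sum>l\<le>s. ?c s l) = (\<Sum>l\<in>{0}. ?c s l)"
    by (rule sum.mono_neutral_right) auto
  also have "\<dots> = parametrix_symbol M as s k x * as 0 k x"
    by (simp add: composition_term_0)
  also have "\<dots> = - (\<Sum>j<s. \<Sum>l\<le>s. ?c j l)"
    unfolding parametrix_symbol_pos[OF s] using assms nonzero[OF assms, of x] by (simp add: parametrix_symbol_0)
  finally show ?thesis using False by simp
qed

text \<open>Grouping by the total degree \<open>s = i + j + l\<close> leaves the contribution 1 from
  \<open>s = 0\<close> only.\<close>

lemma composition_terms_sum:
  assumes k: "M \<le> norm (rvec k)" and N: "0 < N"
  shows "(\<Sum>j<N. \<Sum>l<N. \<Sum>i<N. if i + j + l < N then composition_term i (parametrix_symbol M as j) (as l) k x else 0) = 1"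
proof -
  let ?f = "\<lambda>i j l. composition_term i (parametrix_symbol M as j) (as l) k x"
  have "(\<Sum>j<N. \<Sum>l<N. \<Sum>i<N. if i + j + l < N then ?f i j l else 0)
      = (\<Sum>j<N. \<Sum>l<N. \<Sum>i<N. \<Sum>s<N. if s = i + j + l then ?f i j l else 0)"
    by (intro sum.cong refl) (subst sum.delta, auto)
  also have "\<dots> = (\<Sum>j<N. \<Sum>l<N. \<Sum>s<N. \<Sum>i<N. if s = i + j + l then ?f i j l else 0)"
    by (rule sum.cong[OF refl], rule sum.cong[OF refl], rule sum.swap)
  also have "\<dots> = (\<Sum>j<N. \<Sum>s<N. \<Sum>l<N. \<Sum>i<N. if s = i + j + l then ?f i j l else 0)"
    by (rule sum.cong[OF refl], rule sum.swap)
  also have "\<dots> = (\<Sum>s<N. \<Sum>j<N. \<Sum>l<N. \<Sum>i<N. if s = i + j + l then ?f i j l else 0)"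
    by (rule sum.swap)
  also have "\<dots> = (\<Sum>s<N. if s = 0 then 1 else 0)"
  proof (intro sum.cong refl)
    fix s assume "s \<in> {..<N}"
    then have s: "s < N" by simp
    have "(\<Sum>i<N. if s = i + j + l then ?f i j l else 0) = (if j + l \<le> s then ?f (s - j - l) j l else 0)" for j l
    proof (cases "j + l \<le> s")
      case True
      then have "s = i + j + l \<longleftrightarrow> i = s - j - l" for i by auto
      then have "(\<Sum>i<N. if s = i + j + l then ?f i j l else 0) = (\<Sum>i<N. if i = s - j - l then ?f i j l else 0)"
        by simp
      with s True show ?thesis by (subst (asm) sum.delta) auto
    qed (auto intro!: sum.neutral)
    then have "(\<Sum>j<N. \<Sum>l<N. \<Sum>i<N. if s = i + j + l then ?f i j l else 0)
        = (\<Sum>j<N. \<Sum>l<N. if j + l \<le> s then ?f (s - j - l) j l else 0)" by simp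
    also have "\<dots> = (\<Sum>j<N. \<Sum>l\<le>s. if j + l \<le> s then ?f (s - j - l) j l else 0)"
      using s by (intro sum.cong refl sum.mono_neutral_right) auto
    also have "\<dots> = (\<Sum>j\<le>s. \<Sum>l\<le>s. if j + l \<le> s then ?f (s - j - l) j l else 0)"
      using s by (intro sum.mono_neutral_right) (auto intro!: sum.neutral)
    finally show "(\<Sum>j<N. \<Sum>l<N. \<Sum>i<N. if s = i + j + l then ?f i j l else 0) = (if s = 0 then 1 else 0)"
      by (simp only: composition_term_collect[OF k])
  qed
  also have "\<dots> = 1" using N by simp
  finally show ?thesis .
qed

text \<open>Four errors, all of order -(\<rho> - \<delta>) N: the tail of the expansion of
  \<open>a\<close>, the remainders of the composition formula, the composition terms of total degree
  at least \<open>N\<close>, and the terms of lower total degree, whose sum differs from 1 at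
  finitely many \<open>k\<close> only.\<close>

lemma parametrix_symbol_left_inverse:
  assumes a: "a \<in> symb \<mu>" and N: "0 < N"
    and expansion: "(\<lambda>k x. a k x - (\<Sum>l<N. as l k x)) \<in> symb (\<mu> - (\<rho> - \<delta>) * real N)"
  shows "(\<lambda>k x. compose_symbol (\<lambda>k x. \<Sum>j<N. parametrix_symbol M as j k x) a k x - 1) \<in> symb (- (\<rho> - \<delta>) * real N)"
proof -
  define e where "e = \<rho> - \<delta>"
  have e: "0 \<le> e" using eps_pos by (simp add: e_def)
  let ?b = "parametrix_symbol M as"
  let ?r = "\<lambda>k x. a k x - (\<Sum>l<N. as l k x)"
  let ?c = "\<lambda>i j l. composition_term i (?b j) (as l)"
  note b = parametrix_symbol_sym[folded e_def]
  note as' = as[folded e_def]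
  have b0: "?b j \<in> symb (- \<mu>)" for j using e by (intro sym_mono[OF b]) simp
  have as0: "as l \<in> symb \<mu>" for l using e by (intro sym_mono[OF as']) simp
  have r: "?r \<in> symb (\<mu> - e * real N)" using expansion by (simp add: e_def)
  have r0: "?r \<in> symb \<mu>" using e by (intro sym_mono[OF r]) simp
  have 1: "(\<lambda>k x. \<Sum>j<N. compose_symbol (?b j) ?r k x) \<in> symb (- e * real N)"
    using compose_sym[OF b0 r] by (intro sym_sum) simp
  have 2: "(\<lambda>k x. \<Sum>j<N. \<Sum>l<N. composition_rem N (?b j) (as l) k x) \<in> symb (- e * real N)"
    using composition_expansion[OF b0 as0, of N, folded e_def] by (intro sym_sum) simp
  have cs: "?c i j l \<in> symb (- e * real (i + j + l))" for i j l
    using composition_term_sym[OF b as', of i j l] by (simp add: e_def algebra_simps)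
  have 3: "(\<lambda>k x. \<Sum>j<N. \<Sum>l<N. \<Sum>i<N. if i + j + l < N then 0 else ?c i j l k x) \<in> symb (- e * real N)"
  proof (intro sym_sum)
    fix i j l
    show "(\<lambda>k x. if i + j + l < N then 0 else ?c i j l k x) \<in> symb (- e * real N)"
    proof (cases "i + j + l < N")
      case False
      then have "- e * real (i + j + l) \<le> - e * real N"
        using e by (simp add: mult_left_mono del: of_nat_add)
      from sym_mono[OF cs this] False show ?thesis by simp
    qed (simp add: sym_0)
  qed
  define P where "P k x = (\<Sum>j<N. \<Sum>l<N. \<Sum>i<N. if i + j + l < N then ?c i j l k x else 0)" for k x
  have Psm: "smooth_symbol P"
  proof -
    have "(\<lambda>k x. if i + j + l < N then ?c i j l k x else 0) \<in> symb 0" for i j l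
      using sym_mono[OF cs[of i j l], of 0] e by (cases "i + j + l < N") (auto simp: sym_0)
    then have "P \<in> symb 0" unfolding P_def[abs_def] by (intro sym_sum)
    then show ?thesis by (rule sym_smooth)
  qed
  have 4: "(\<lambda>k x. P k x - 1) \<in> symb (- e * real N)"
    by (rule sym_finite_support[of _ M])
       (intro smooth_symbol_minus Psm smooth_symbol_const, simp add: P_def composition_terms_sum[OF _ N])
  have eq: "compose_symbol (\<lambda>k x. \<Sum>j<N. ?b j k x) a k x - 1 =
      (\<Sum>j<N. compose_symbol (?b j) ?r k x) + (\<Sum>j<N. \<Sum>l<N. composition_rem N (?b j) (as l) k x)
      + (\<Sum>j<N. \<Sum>l<N. \<Sum>i<N. if i + j + l < N then 0 else ?c i j l k x) + (P k x - 1)" for k x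
  proof -
    have "compose_symbol (\<lambda>k x. \<Sum>j<N. ?b j k x) a k x = (\<Sum>j<N. compose_symbol (?b j) a k x)"
      using compose_sum_left[of "{..<N}" ?b, OF b0 a] by simp
    also have "\<dots> = (\<Sum>j<N. compose_symbol (?b j) ?r k x + (\<Sum>l<N. compose_symbol (?b j) (as l) k x))"
    proof (intro sum.cong refl)
      fix j
      have "compose_symbol (?b j) ?r k x = compose_symbol (?b j) a k x - (\<Sum>l<N. compose_symbol (?b j) (as l) k x)"
        using compose_diff_right[OF b0 a sym_sum[of "{..<N}" as, OF as0]] compose_sum_right[OF b0, of "{..<N}" as, OF as0]
        by simp
      then show "compose_symbol (?b j) a k x = compose_symbol (?b j) ?r k x + (\<Sum>l<N. compose_symbol (?b j) (as l) k x)"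
        by simp
    qed
    also have "\<dots> = (\<Sum>j<N. compose_symbol (?b j) ?r k x) + (\<Sum>j<N. \<Sum>l<N. composition_rem N (?b j) (as l) k x + (\<Sum>i<N. ?c i j l k x))"
      by (simp add: sum.distrib composition_rem_def)
    also have "\<dots> = (\<Sum>j<N. compose_symbol (?b j) ?r k x) + (\<Sum>j<N. \<Sum>l<N. composition_rem N (?b j) (as l) k x)
        + (\<Sum>j<N. \<Sum>l<N. \<Sum>i<N. ?c i j l k x)"
      by (simp add: sum.distrib)
    also have "(\<Sum>j<N. \<Sum>l<N. \<Sum>i<N. ?c i j l k x) = (\<Sum>j<N. \<Sum>l<N. \<Sum>i<N. if i + j + l < N then 0 else ?c i j l k x) + P k x"
      unfolding P_def sum.distrib[symmetric] by (intro sum.cong refl) simp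
    finally show ?thesis by simp
  qed
  show ?thesis
    unfolding e_def[symmetric] eq by (rule sym_add[OF sym_add[OF sym_add[OF 1 2] 3] 4])
qed

text \<open>Evaluating B a b in two ways, with e the error of B a and f that of a b, gives b - B = B
  f - e b. Here B f is smoothing and e b has the required order.\<close>

lemma parametrix_symbol_expansion:
  assumes a: "a \<in> symb \<mu>" and b: "b \<in> symb (- \<mu>)" and ab: "smoothing (\<lambda>k x. compose_symbol a b k x - 1)"
    and expansion: "\<And>N. (\<lambda>k x. a k x - (\<Sum>l<N. as l k x)) \<in> symb (\<mu> - (\<rho> - \<delta>) * real N)"
  shows "(\<lambda>k x. b k x - (\<Sum>j<N. parametrix_symbol M as j k x)) \<in> symb (- \<mu> - (\<rho> - \<delta>) * real N)"
proof (cases "N = 0")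
  case False
  let ?B = "\<lambda>k x. \<Sum>j<N. parametrix_symbol M as j k x"
  let ?e = "\<lambda>k x. compose_symbol ?B a k x - 1" and ?f = "\<lambda>k x. compose_symbol a b k x - 1"
  have B: "?B \<in> symb (- \<mu>)"
    using eps_pos by (intro sym_sum sym_mono[OF parametrix_symbol_sym]) simp
  have e: "?e \<in> symb (- (\<rho> - \<delta>) * real N)"
    using False by (intro parametrix_symbol_left_inverse a expansion) simp
  have Ba: "compose_symbol ?B a \<in> symb 0" using compose_sym[OF B a] by simp
  have ab0: "compose_symbol a b \<in> symb 0" using compose_sym[OF a b] by simp
  have "compose_symbol ?e b = (\<lambda>k x. compose_symbol (compose_symbol ?B a) b k x - b k x)"
    using compose_diff_left[OF Ba sym_const b] by (simp add: compose_1_left[OF b])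
  moreover have "compose_symbol ?B ?f = (\<lambda>k x. compose_symbol ?B (compose_symbol a b) k x - ?B k x)"
    using compose_diff_right[OF B ab0 sym_const] by (simp add: compose_1_right[OF B])
  ultimately have "(\<lambda>k x. b k x - ?B k x) = (\<lambda>k x. compose_symbol ?B ?f k x - compose_symbol ?e b k x)"
    using compose_assoc[OF B a b] by (simp add: fun_eq_iff)
  also have "\<dots> \<in> symb (- \<mu> - (\<rho> - \<delta>) * real N)"
  proof (rule sym_minus)
    show "compose_symbol ?B ?f \<in> symb (- \<mu> - (\<rho> - \<delta>) * real N)"
      using smoothing_compose_right[OF B ab] by (simp add: smoothing_def)
    show "compose_symbol ?e b \<in> symb (- \<mu> - (\<rho> - \<delta>) * real N)"
      using compose_sym[OF e b] by (simp add: algebra_simps)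
  qed
  finally show ?thesis .
qed (use b in simp)

end

section \<open>Parametrices of operators\<close>

lemma op_class_symbol:
  fixes A :: "'n::{finite,linorder} lattice_operator"
  assumes "A \<in> op_class (symbol_class \<rho> \<delta> m)"
  shows "has_symbol A (symbol_of A)" "symbol_of A \<in> symb m"
  using assms symbol_of_eq unfolding op_class_def symbol_class_eq_sym by blast+

lemma Op_in_op_class:
  fixes \<sigma> :: "'n::{finite,linorder} lattice_symbol"
  assumes "\<sigma> \<in> symb m" shows "Op \<sigma> \<in> op_class (symbol_class \<rho> \<delta> m)" "symbol_of (Op \<sigma>) = \<sigma>"
proof -
  have "has_symbol (Op \<sigma>) \<sigma>" using sym_smooth[OF assms] by (simp add: has_symbol_iff)
  then show "Op \<sigma> \<in> op_class (symbol_class \<rho> \<delta> m)" "symbol_of (Op \<sigma>) = \<sigma>"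
    using assms symbol_of_eq unfolding op_class_def symbol_class_eq_sym by blast+
qed

text \<open>Uniqueness of symbols turns the statement about operators into one about the symbol
  \<open>1 - compose_symbol b a\<close>; the change of sign is harmless.\<close>

lemma equiv_mod_smoothing_iff:
  fixes A B :: "'n::{finite,linorder} lattice_operator"
  assumes A: "has_symbol A a" "a \<in> symb m" and B: "has_symbol B b" "b \<in> symb m'"
  shows "equiv_mod_smoothing \<rho> \<delta> id (B \<circ> A) \<longleftrightarrow> smoothing (\<lambda>k x. compose_symbol b a k x - 1)"
proof -
  let ?\<sigma> = "\<lambda>k x. 1 - compose_symbol b a k x"
  have sm: "smooth_symbol (compose_symbol b a)" by (rule smooth_compose_symbol[OF B(2) A(2)])
  have "has_symbol (\<lambda>f k. id f k - (B \<circ> A) f k) ?\<sigma>"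
    unfolding has_symbol_iff
  proof (intro conjI ballI)
    show "smooth_symbol ?\<sigma>" by (intro smooth_symbol_minus smooth_symbol_const sm)
    fix f :: "int ^ 'n::{finite,linorder} \<Rightarrow> complex" assume f: "f \<in> rapidly_decreasing"
    have "(B \<circ> A) f = Op (compose_symbol b a) f"
      using A(1) B(1) f Op_rapidly_decreasing[OF A(2) f] Op_compose[OF B(2) A(2) f]
      by (simp add: has_symbol_iff)
    then show "(\<lambda>k. id f k - (B \<circ> A) f k) = Op ?\<sigma> f"
      using Op_diff[OF smooth_symbol_const[of 1] sm f] Op_one[OF f] by (simp add: fun_eq_iff)
  qed
  then have "equiv_mod_smoothing \<rho> \<delta> id (B \<circ> A) \<longleftrightarrow> ?\<sigma> \<in> smoothing_class \<rho> \<delta>"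
    unfolding equiv_mod_smoothing_def op_class_def using has_symbol_unique by blast
  also have "\<dots> \<longleftrightarrow> (\<forall>m. ?\<sigma> \<in> symb m)"
    unfolding smoothing_class_def symbol_class_eq_sym by blast
  also have "\<dots> \<longleftrightarrow> smoothing (\<lambda>k x. compose_symbol b a k x - 1)"
    unfolding smoothing_def using sym_uminus[of ?\<sigma>] sym_uminus[of "\<lambda>k x. compose_symbol b a k x - 1"] by auto
  finally show ?thesis .
qed

lemma parametrix_iff:
  fixes A B :: "'n::{finite,linorder} lattice_operator"
  assumes "has_symbol A a" "a \<in> symb m" "has_symbol B b" "b \<in> symb m'"
  shows "parametrix \<rho> \<delta> A B \<longleftrightarrow>
    smoothing (\<lambda>k x. compose_symbol b a k x - 1) \<and> smoothing (\<lambda>k x. compose_symbol a b k x - 1)"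
  unfolding parametrix_def by (simp only: equiv_mod_smoothing_iff[OF assms] equiv_mod_smoothing_iff[OF assms(3,4,1,2)])

lemma elliptic_operator_iff_parametrix:
  fixes A :: "'n::{finite,linorder} lattice_operator"
  assumes A: "A \<in> op_class (symbol_class \<rho> \<delta> \<mu>)"
  shows "elliptic_operator \<rho> \<delta> \<mu> A \<longleftrightarrow> (\<exists>B \<in> op_class (symbol_class \<rho> \<delta> (- \<mu>)). parametrix \<rho> \<delta> A B)"
proof
  note a = op_class_symbol[OF A]
  assume "elliptic_operator \<rho> \<delta> \<mu> A"
  then obtain c where c: "c \<in> symb (- \<mu>)" "smoothing (\<lambda>k x. compose_symbol c (symbol_of A) k x - 1)"
      "smoothing (\<lambda>k x. compose_symbol (symbol_of A) c k x - 1)"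
    using elliptic_imp_parametrix[OF a(2)] unfolding elliptic_operator_def by blast
  have "has_symbol (Op c) c" using sym_smooth[OF c(1)] by (simp add: has_symbol_iff)
  with c have "parametrix \<rho> \<delta> A (Op c)" by (simp add: parametrix_iff[OF a])
  with Op_in_op_class(1)[OF c(1)] show "\<exists>B \<in> op_class (symbol_class \<rho> \<delta> (- \<mu>)). parametrix \<rho> \<delta> A B" by blast
next
  note a = op_class_symbol[OF A]
  assume "\<exists>B \<in> op_class (symbol_class \<rho> \<delta> (- \<mu>)). parametrix \<rho> \<delta> A B"
  then obtain B where B: "B \<in> op_class (symbol_class \<rho> \<delta> (- \<mu>))" "parametrix \<rho> \<delta> A B" by blast
  note b = op_class_symbol[OF B(1)]
  have "elliptic_symbol \<rho> \<delta> \<mu> (symbol_of A)"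
    using B(2) parametrix_iff[OF a b] left_parametrix_imp_elliptic[OF a(2) b(2)] by blast
  with A show "elliptic_operator \<rho> \<delta> \<mu> A" by (simp add: elliptic_operator_def)
qed

text \<open>The sequence \<open>Bs\<close> is built from \<open>As\<close> and \<open>M\<close>
  alone, before any parametrix is chosen; hence one sequence is an expansion of every parametrix of
  \<open>A\<close> in the class of order -\<mu>.\<close>

lemma
  fixes A :: "'n::{finite,linorder} lattice_operator"
  assumes A: "A \<in> op_class (symbol_class \<rho> \<delta> \<mu>)" and el: "elliptic_operator \<rho> \<delta> \<mu> A"
    and As: "\<And>l. As l \<in> op_class (symbol_class \<rho> \<delta> (\<mu> - (\<rho> - \<delta>) * real l))"
    and expansion: "asymptotic_expansion \<rho> \<delta> \<mu> A As"
  shows elliptic_operator_leading: "elliptic_operator \<rho> \<delta> \<mu> (As 0)"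
    and parametrix_expansion: "(\<And>k x. M \<le> norm (rvec k) \<Longrightarrow> symbol_of (As 0) k x \<noteq> 0) \<Longrightarrow>
      \<exists>Bs. (\<forall>j. Bs j \<in> op_class (symbol_class \<rho> \<delta> (- \<mu> - (\<rho> - \<delta>) * real j))) \<and>
        (\<forall>k x. M \<le> norm (rvec k) \<longrightarrow> symbol_of (Bs 0) k x = 1 / symbol_of (As 0) k x) \<and>
        (\<forall>N\<ge>1. \<forall>k x. M \<le> norm (rvec k) \<longrightarrow>
           symbol_of (Bs N) k x = parametrix_term (\<lambda>l. symbol_of (As l)) (\<lambda>j. symbol_of (Bs j)) N k x) \<and>
        (\<forall>B \<in> op_class (symbol_class \<rho> \<delta> (- \<mu>)). parametrix \<rho> \<delta> A B \<longrightarrow> asymptotic_expansion \<rho> \<delta> (- \<mu>) B Bs)"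
proof -
  note a = op_class_symbol[OF A]
  let ?as = "\<lambda>l. symbol_of (As l)"
  have as: "?as l \<in> symb (\<mu> - (\<rho> - \<delta>) * real l)" for l by (rule op_class_symbol(2)[OF As])
  have ex: "(\<lambda>k x. symbol_of A k x - (\<Sum>l<N. ?as l k x)) \<in> symb (\<mu> - (\<rho> - \<delta>) * real N)" for N
    using expansion by (simp add: asymptotic_expansion_def symbol_class_eq_sym)
  have el0: "elliptic_symbol \<rho> \<delta> \<mu> (?as 0)"
    by (rule elliptic_leading_symbol[of \<mu> "symbol_of A"])
       (use el as[of 0] ex[of 1] in \<open>simp_all add: elliptic_operator_def\<close>)
  then show "elliptic_operator \<rho> \<delta> \<mu> (As 0)"
    using As[of 0] by (simp add: elliptic_operator_def)
  assume nz: "\<And>k x. M \<le> norm (rvec k) \<Longrightarrow> symbol_of (As 0) k x \<noteq> 0"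
  let ?b = "parametrix_symbol M ?as"
  define Bs where "Bs j = Op (?b j)" for j
  have b: "?b j \<in> symb (- \<mu> - (\<rho> - \<delta>) * real j)" for j
    by (rule parametrix_symbol_sym[OF as el0 nz])
  have sB: "symbol_of (Bs j) = ?b j" for j unfolding Bs_def by (rule Op_in_op_class(2)[OF b])
  show "\<exists>Bs. (\<forall>j. Bs j \<in> op_class (symbol_class \<rho> \<delta> (- \<mu> - (\<rho> - \<delta>) * real j))) \<and>
        (\<forall>k x. M \<le> norm (rvec k) \<longrightarrow> symbol_of (Bs 0) k x = 1 / symbol_of (As 0) k x) \<and>
        (\<forall>N\<ge>1. \<forall>k x. M \<le> norm (rvec k) \<longrightarrow>
           symbol_of (Bs N) k x = parametrix_term (\<lambda>l. symbol_of (As l)) (\<lambda>j. symbol_of (Bs j)) N k x) \<and>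
        (\<forall>B \<in> op_class (symbol_class \<rho> \<delta> (- \<mu>)). parametrix \<rho> \<delta> A B \<longrightarrow> asymptotic_expansion \<rho> \<delta> (- \<mu>) B Bs)"
  proof (intro exI[of _ Bs] conjI allI impI ballI)
    show "Bs j \<in> op_class (symbol_class \<rho> \<delta> (- \<mu> - (\<rho> - \<delta>) * real j))" for j
      unfolding Bs_def by (rule Op_in_op_class(1)[OF b])
    show "symbol_of (Bs 0) k x = 1 / symbol_of (As 0) k x" if "M \<le> norm (rvec k)" for k x
      using that by (simp add: sB parametrix_symbol_0)
    show "symbol_of (Bs N) k x = parametrix_term ?as (\<lambda>j. symbol_of (Bs j)) N k x"
      if "1 \<le> N" "M \<le> norm (rvec k)" for N k x
      using that parametrix_symbol_recursion[of N M k ?as x] by (simp add: sB)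
    fix B assume B: "B \<in> op_class (symbol_class \<rho> \<delta> (- \<mu>))" "parametrix \<rho> \<delta> A B"
    note sb = op_class_symbol[OF B(1)]
    have "smoothing (\<lambda>k x. compose_symbol (symbol_of A) (symbol_of B) k x - 1)"
      using B(2) parametrix_iff[OF a sb] by blast
    from parametrix_symbol_expansion[OF as el0 nz a(2) sb(2) this ex]
    show "asymptotic_expansion \<rho> \<delta> (- \<mu>) B Bs"
      by (simp add: asymptotic_expansion_def symbol_class_eq_sym sB)
  qed
qed

end

theorem theorem3p6:
  fixes \<rho> \<delta> \<mu> :: real
    and A :: "'n::{finite,linorder} lattice_operator"
  assumes "0 \<le> \<delta>" and "\<delta> < \<rho>" and "\<rho> \<le> 1"
    and "A \<in> op_class (symbol_class \<rho> \<delta> \<mu>)"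
  shows
    "(elliptic_operator \<rho> \<delta> \<mu> A \<longleftrightarrow>
        (\<exists>B \<in> op_class (symbol_class \<rho> \<delta> (- \<mu>)). parametrix \<rho> \<delta> A B)) \<and>
     (\<forall>As. elliptic_operator \<rho> \<delta> \<mu> A \<and>
        (\<forall>l. As l \<in> op_class (symbol_class \<rho> \<delta> (\<mu> - (\<rho> - \<delta>) * real l))) \<and>
        asymptotic_expansion \<rho> \<delta> \<mu> A As \<longrightarrow>
          elliptic_operator \<rho> \<delta> \<mu> (As 0) \<and>
          (\<forall>M>0. (\<forall>k x. M \<le> norm (rvec k) \<longrightarrow> symbol_of (As 0) k x \<noteq> 0) \<longrightarrow>
            (\<exists>Bs.
              (\<forall>j. Bs j \<in> op_class (symbol_class \<rho> \<delta> (- \<mu> - (\<rho> - \<delta>) * real j))) \<and>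
              (\<forall>k x. M \<le> norm (rvec k) \<longrightarrow>
                 symbol_of (Bs 0) k x = 1 / symbol_of (As 0) k x) \<and>
              (\<forall>N\<ge>1. \<forall>k x. M \<le> norm (rvec k) \<longrightarrow>
                 symbol_of (Bs N) k x =
                   parametrix_term (\<lambda>l. symbol_of (As l)) (\<lambda>j. symbol_of (Bs j)) N k x) \<and>
              (\<forall>B \<in> op_class (symbol_class \<rho> \<delta> (- \<mu>)).
                 parametrix \<rho> \<delta> A B \<longrightarrow> asymptotic_expansion \<rho> \<delta> (- \<mu>) B Bs))))"
proof -
  interpret symbol_orders \<rho> \<delta> using assms by unfold_locales
  show ?thesis
  proof (intro conjI allI impI; (elim conjE)?)
    show "elliptic_operator \<rho> \<delta> \<mu> A \<longleftrightarrow> (\<exists>B \<in> op_class (symbol_class \<rho> \<delta> (- \<mu>)). parametrix \<rho> \<delta> A B)"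
      by (rule elliptic_operator_iff_parametrix[OF assms(4)])
  next
    fix As
    assume *: "elliptic_operator \<rho> \<delta> \<mu> A" "\<forall>l. As l \<in> op_class (symbol_class \<rho> \<delta> (\<mu> - (\<rho> - \<delta>) * real l))"
      "asymptotic_expansion \<rho> \<delta> \<mu> A As"
    show "elliptic_operator \<rho> \<delta> \<mu> (As 0)"
      by (rule elliptic_operator_leading[OF assms(4) *(1) spec[OF *(2)] *(3)])
    fix M :: real assume M: "\<forall>k x. M \<le> norm (rvec k) \<longrightarrow> symbol_of (As 0) k x \<noteq> 0"
    show "\<exists>Bs.
              (\<forall>j. Bs j \<in> op_class (symbol_class \<rho> \<delta> (- \<mu> - (\<rho> - \<delta>) * real j))) \<and>
              (\<forall>k x. M \<le> norm (rvec k) \<longrightarrow>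
                 symbol_of (Bs 0) k x = 1 / symbol_of (As 0) k x) \<and>
              (\<forall>N\<ge>1. \<forall>k x. M \<le> norm (rvec k) \<longrightarrow>
                 symbol_of (Bs N) k x =
                   parametrix_term (\<lambda>l. symbol_of (As l)) (\<lambda>j. symbol_of (Bs j)) N k x) \<and>
              (\<forall>B \<in> op_class (symbol_class \<rho> \<delta> (- \<mu>)).
                 parametrix \<rho> \<delta> A B \<longrightarrow> asymptotic_expansion \<rho> \<delta> (- \<mu>) B Bs)"
      by (rule parametrix_expansion[OF assms(4) *(1) spec[OF *(2)] *(3)]) (use M in blast)
  qed
qed

end
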